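(* Let $M$ be the two-dimensional sphere $\mathbb S^2$ equipped with its canonical metric $g$ induced by the Euclidean metric of $\mathbb R^3$, let $S$ and $N$ be its south and north poles, and let $\mathcal V\in C^\infty([0,\pi^2],(0,1])$ be an increasing function. Let $V(x):=\mathcal V(\mathrm{dist}_g(x,S)^2)$ for $x\in\mathbb S^2$, where $V\in C^\infty(\mathbb S^2)$ and $\|V\|_{L^\infty(\mathbb S^2)}=1$. Then for every connected open subset $\omega$ of $\mathbb S^2$ containing $\{S,N\}$ there exists a time $T>0$ such that $(\omega,T)$ satisfies (GCC$_V^+$).
   Context: For a smooth real function $k$ on $T^*M$ (or on $T^*M$ minus the zero section), $\varphi^k_t$ denotes the flow of its Hamiltonian vector field $H_k=\sum_j \partial_{\xi_j}k\,\partial_{x_j}-\partial_{x_j}k\,\partial_{\xi_j}$ (canonical coordinates); $\pi_M:T^*M\to M$ is the canonical projection, $|\xi|_g$ the norm of a covector, $\mathrm{dist}_g$ the Riemannian distance, $S^*M=\{(x,\xi)\in T^*M:\ |\xi|_g=1\}$, and $q(x,\xi):=\sqrt{|\xi|_g^2+V(x)}$ on $T^*M$. For an open set $\omega\subset M$ and $T>0$: - $(\omega,T)$ satisfies (GCC) if for every $\rho\in S^*M$ there is $t\in(0,T)$ with $\pi_M\circ\varphi_t^{|\xi|_g}(\rho)\in\omega$; - $(\omega,T)$ satisfies (GCC$_V$) if for every $\rho\in T^*M$ there is $t\in(0,T)$ with $\pi_M\circ\varphi_t^{q}(\rho)\in\omega$; - $(\omega,T)$ satisfies (GCC$_V^+$)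 if it satisfies both (GCC) and (GCC$_V$).
   Formalization: "Increasing" is taken as strictly increasing with nonvanishing derivative on (0,π²); at an interior critical point of 𝒱 the claim fails: over x₀ with dist(x₀,S)² critical, (x₀,0) is stationary for q, so ω = S² minus x₀ violates (GCC_V). *)

theory Defs
  imports "HOL-Analysis.Analysis"
begin

section \<open>Smooth maps\<close>

text \<open>
  Intended for sets on which derivatives within the set are unique: open sets, and compact
  intervals (where the derivatives at the endpoints are one-sided).
\<close>

fun C_k_on :: "nat \<Rightarrow> 'a::euclidean_space set \<Rightarrow> ('a \<Rightarrow> 'b::real_normed_vector) \<Rightarrow> bool" where
  "C_k_on 0 A f \<longleftrightarrow> continuous_on A f"
| "C_k_on (Suc k) A f \<longleftrightarrow>
     f differentiable_on A \<and> (\<forall>v. C_k_on k A (\<lambda>x. frechet_derivative f (at x within A) v))"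

definition smooth_on :: "'a::euclidean_space set \<Rightarrow> ('a \<Rightarrow> 'b::real_normed_vector) \<Rightarrow> bool" where
  "smooth_on A f \<longleftrightarrow> (\<forall>k. C_k_on k A f)"


section \<open>The round sphere\<close>

abbreviation S2 :: "(real^3) set" where
  "S2 \<equiv> sphere 0 1"

definition north_pole :: "real^3" where
  "north_pole = axis 3 1"

definition south_pole :: "real^3" where
  "south_pole = - axis 3 1"

text \<open>
  Inverses of the charts of the smooth structure of the sphere as a submanifold of space.
\<close>

definition local_param :: "(real^2) set \<Rightarrow> (real^2 \<Rightarrow> real^3) \<Rightarrow> bool" where
  "local_param U \<psi> \<longleftrightarrow>
     open U \<and> smooth_on U \<psi> \<and> \<psi> ` U \<subseteq> S2 \<and> openin (top_of_set S2) (\<psi> ` U) \<and>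
     homeomorphism U (\<psi> ` U) \<psi> (inv_into U \<psi>) \<and>
     (\<forall>y\<in>U. inj (frechet_derivative \<psi> (at y)))"

definition smooth_on_S2 :: "(real^3 \<Rightarrow> real) \<Rightarrow> bool" where
  "smooth_on_S2 f \<longleftrightarrow> (\<forall>U \<psi>. local_param U \<psi> \<longrightarrow> smooth_on U (f \<circ> \<psi>))"

text \<open>
  Infimum of the lengths of piecewise C1 curves in the sphere, for the metric induced by the
  Euclidean one. The library's \<open>valid_path\<close> does not force the speed to be integrable, and
  \<open>integral\<close> is 0 for a non-integrable function, hence \<open>has_integral\<close>.
\<close>

definition dist_S2 :: "real^3 \<Rightarrow> real^3 \<Rightarrow> real" where
  "dist_S2 x y = Inf {L. \<exists>c. valid_path c \<and> path_image c \<subseteq> S2 \<and> pathstart c = x \<and> pathfinish c = y \<and>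
     ((\<lambda>t. norm (vector_derivative c (at t))) has_integral L) {0..1}}"


section \<open>The cotangent bundle and Hamiltonian flows\<close>

text \<open>
  A covector at \<open>x\<close> is represented through the metric by a vector \<open>\<xi>\<close> orthogonal to \<open>x\<close>; it is
  the linear form \<open>v \<mapsto> \<xi> \<bullet> v\<close> on the tangent plane, and its norm is \<open>norm \<xi>\<close>.
\<close>

type_synonym phase_point = "(real^3) \<times> (real^3)"

definition cotangent :: "(real^3) set \<Rightarrow> phase_point set" where
  "cotangent A = {(x, \<xi>). x \<in> A \<and> \<xi> \<bullet> x = 0}"

definition cotangent_nonzero :: "phase_point set" where
  "cotangent_nonzero = {(x, \<xi>) \<in> cotangent S2. \<xi> \<noteq> 0}"

definition unit_cotangent :: "phase_point set" where
  "unit_cotangent = {(x, \<xi>) \<in> cotangent S2. norm \<xi> = 1}"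

text \<open>
  Canonical coordinates \<open>(y, \<eta>)\<close> of \<open>(x, \<xi>)\<close>: the point \<open>y\<close> has \<open>\<psi> y = x\<close> and the covector is
  the sum of the \<open>\<eta>\<^sub>j dy\<^sub>j\<close>, that is, \<open>\<eta>\<^sub>j\<close> is the value of the covector on the j-th
  partial derivative of \<open>\<psi>\<close>.
\<close>

definition canonical_coords ::
    "(real^2) set \<Rightarrow> (real^2 \<Rightarrow> real^3) \<Rightarrow> phase_point \<Rightarrow> (real^2) \<times> (real^2)" where
  "canonical_coords U \<psi> = (\<lambda>(x, \<xi>). let y = inv_into U \<psi> x in
     (y, \<chi> j. \<xi> \<bullet> frechet_derivative \<psi> (at y) (axis j 1)))"

definition in_coords ::
    "(real^2) set \<Rightarrow> (real^2 \<Rightarrow> real^3) \<Rightarrow> (phase_point \<Rightarrow> real) \<Rightarrow> (real^2) \<times> (real^2) \<Rightarrow> real" where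
  "in_coords U \<psi> k = k \<circ> inv_into (cotangent (\<psi> ` U)) (canonical_coords U \<psi>)"

definition hamiltonian_field ::
    "((real^2) \<times> (real^2) \<Rightarrow> real) \<Rightarrow> (real^2) \<times> (real^2) \<Rightarrow> (real^2) \<times> (real^2)" where
  "hamiltonian_field K z =
     ((\<chi> j. frechet_derivative K (at z) (0, axis j 1)),
      (\<chi> j. - frechet_derivative K (at z) (axis j 1, 0)))"

text \<open>
  Complete integral curves of the Hamiltonian vector field of \<open>k\<close>, a function on the open subset
  \<open>D\<close> of the cotangent bundle; the velocity is read in all canonical coordinate systems.
\<close>

definition integral_curve ::
    "phase_point set \<Rightarrow> (phase_point \<Rightarrow> real) \<Rightarrow> (real \<Rightarrow> phase_point) \<Rightarrow> bool" where
  "integral_curve D k \<gamma> \<longleftrightarrow>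
     (\<forall>t. \<gamma> t \<in> D) \<and> continuous_on UNIV \<gamma> \<and>
     (\<forall>U \<psi> t. local_param U \<psi> \<and> fst (\<gamma> t) \<in> \<psi> ` U \<longrightarrow>
        ((canonical_coords U \<psi> \<circ> \<gamma>) has_vector_derivative
           hamiltonian_field (in_coords U \<psi> k) (canonical_coords U \<psi> (\<gamma> t))) (at t))"

text \<open>
  For the Hamiltonians below the flow is complete and the integral curve through a point is
  unique, so that the choice operator just names it.
\<close>

definition hamiltonian_flow ::
    "phase_point set \<Rightarrow> (phase_point \<Rightarrow> real) \<Rightarrow> real \<Rightarrow> phase_point \<Rightarrow> phase_point" where
  "hamiltonian_flow D k t \<rho> = (SOME \<gamma>. integral_curve D k \<gamma> \<and> \<gamma> 0 = \<rho>) t"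


section \<open>Geometric control conditions\<close>

definition ham_norm :: "phase_point \<Rightarrow> real" where
  "ham_norm = (\<lambda>(x, \<xi>). norm \<xi>)"

definition ham_q :: "(real^3 \<Rightarrow> real) \<Rightarrow> phase_point \<Rightarrow> real" where
  "ham_q V = (\<lambda>(x, \<xi>). sqrt ((norm \<xi>)\<^sup>2 + V x))"

definition GCC :: "(real^3) set \<Rightarrow> real \<Rightarrow> bool" where
  "GCC \<omega> T \<longleftrightarrow>
     (\<forall>\<rho>\<in>unit_cotangent. \<exists>t\<in>{0<..<T}. fst (hamiltonian_flow cotangent_nonzero ham_norm t \<rho>) \<in> \<omega>)"

definition GCC_V :: "(real^3 \<Rightarrow> real) \<Rightarrow> (real^3) set \<Rightarrow> real \<Rightarrow> bool" where
  "GCC_V V \<omega> T \<longleftrightarrow>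
     (\<forall>\<rho>\<in>cotangent S2. \<exists>t\<in>{0<..<T}. fst (hamiltonian_flow (cotangent S2) (ham_q V) t \<rho>) \<in> \<omega>)"

definition GCC_V_plus :: "(real^3 \<Rightarrow> real) \<Rightarrow> (real^3) set \<Rightarrow> real \<Rightarrow> bool" where
  "GCC_V_plus V \<omega> T \<longleftrightarrow> GCC \<omega> T \<and> GCC_V V \<omega> T"

end

theory Submission
  imports Defs "HOL-Complex_Analysis.Great_Picard"
begin

text \<open>
  The value \<open>c > 0\<close> of the Hamiltonian is conserved along its flow, so a trajectory is described by
  the position \<open>x\<close>, the velocity \<open>v = \<xi> / c\<close> and the parameter \<open>\<mu> = 1 / c\<^sup>2\<close>. In these variables the
  flow is an autonomous system on a compact energy surface, and \<open>\<mu> = 0\<close> is the geodesic flow: the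
  high-energy limit and both control conditions are covered by one compact family of trajectories.
  If no uniform control time existed, a limit of longer and longer uncontrolled trajectories would
  be a trajectory that never meets \<open>\<omega>\<close>.

  Such a trajectory stays away from the poles. If its angular momentum about the polar axis is 0, it
  moves on a meridian, and there the angular velocity decreases at a rate bounded away from 0 because
  the potential increases towards the north pole (for \<open>\<mu> = 0\<close> the velocity is constant and the
  trajectory reaches a pole); this is impossible for all times. Otherwise its longitude is a
  monotone unbounded function of time, so that in the universal cover of the sphere minus the poles
  the trajectory is the graph of a function of the longitude, and this graph crosses any path from
  the south pole to the north pole, in particular one inside \<open>\<omega>\<close>.

  Neither the existence of the flow nor the limit argument needs uniqueness, so a merely continuous
  force is enough: both rest on the pointwise compactness of equi-Lipschitz curves.
\<close>


section \<open>Existence and compactness of solutions\<close>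

text \<open>The flow is defined through charts and a choice operator. Two bridges are therefore
  needed: Hamilton's equations in all charts are equivalent to one equation in
  \<open>real^3\<close>, and whichever integral curve is chosen is shown to be a normalized
  solution, existence serving only to make the choice meaningful. The potential is written in the
  height \<open>z = x $ 3\<close>. Near the north pole the distance to the south pole has a cone
  singularity, so smoothness of \<V> alone says nothing there; smoothness of \<open>V\<close> on the
  sphere yields a derivative of the profile that is continuous up to the poles. No Lipschitz bound
  is established, hence Peano's theorem. Positivity of \<open>V\<close> keeps \<open>c\<close> away
  from 0, so that \<open>1 / c\<^sup>2\<close> is bounded and the energy surface compact. The
  absence of critical points between the poles excludes trajectories at rest at an intermediate
  latitude; at the poles themselves the force vanishes, and there \<omega> takes over.\<close>

lemma integral_Icc_lipschitz:
  fixes h :: "real \<Rightarrow> 'b::euclidean_space"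
  assumes h: "continuous_on UNIV h" and B: "\<And>s. norm (h s) \<le> B"
  shows "norm (integral {0..t} h - integral {0..s} h) \<le> B * \<bar>t - s\<bar>"
proof -
  have B0: "0 \<le> B" using B[of 0] norm_ge_zero order_trans by blast
  have int: "h integrable_on {a..b}" for a b
    using h by (intro integrable_continuous_real) (auto intro: continuous_on_subset)
  have bound: "norm (integral {a..b} h) \<le> B * (b - a)" if "a \<le> b" for a b
    using that B h by (intro integral_bound) (auto intro: continuous_on_subset)
  have main: "norm (integral {0..t} h - integral {0..s} h) \<le> B * \<bar>t - s\<bar>" if "s \<le> t" for s t
  proof -
    \<comment> \<open>For negative \<open>t\<close> the set \<open>{0..t}\<close> is empty and the
      integral is 0. Negative times matter because the delayed iterates are evaluated at
      \<open>s - d\<close>.\<close>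
    consider "0 \<le> s" | "s < 0" "0 \<le> t" | "t < 0" using that by linarith
    then show ?thesis
    proof cases
      case 1
      then have "integral {0..s} h + integral {s..t} h = integral {0..t} h"
        using that int by (intro Henstock_Kurzweil_Integration.integral_combine) auto
      then have "integral {0..t} h - integral {0..s} h = integral {s..t} h"
        by (simp add: algebra_simps)
      then show ?thesis using bound[OF that] that by simp
    next
      case 2
      then have "B * t \<le> B * \<bar>t - s\<bar>"
        by (intro mult_left_mono B0) auto
      then show ?thesis using 2 bound[of 0 t] by simp
    next
      case 3
      then show ?thesis using that B0 by simp
    qed
  qed
  show ?thesis
    using main[of s t] main[of t s] by (cases "s \<le> t") (auto simp: norm_minus_commute abs_minus_commute)
qed

text \<open>A diagonal sequence converges at all rational times; the common Lipschitz constant makes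
  it Cauchy at every other time.\<close>

lemma lipschitz_sequence_convergent_subsequence:
  fixes f :: "nat \<Rightarrow> real \<Rightarrow> 'b::euclidean_space"
  assumes lip: "\<And>n s t. 0 \<le> s \<Longrightarrow> 0 \<le> t \<Longrightarrow> norm (f n t - f n s) \<le> B * \<bar>t - s\<bar>"
    and bd: "\<And>n. norm (f n 0) \<le> R"
  obtains k g where "strict_mono (k :: nat \<Rightarrow> nat)" "\<And>t. 0 \<le> t \<Longrightarrow> (\<lambda>n. f (k n) t) \<longlonglongrightarrow> g t"
proof -
  have R0: "0 \<le> R" using bd[of 0] norm_ge_zero order_trans by blast
  have B0: "0 \<le> B" using order_trans[OF norm_ge_zero lip[of 0 1 0]] by simp
  \<comment> \<open>\<open>function_convergent_subsequence\<close> asks for one bound valid at all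
    times; dividing by this linear growth supplies the bound 1.\<close>
  define c where "c t = R + B * t + 1" for t
  have c: "0 < c t" if "0 \<le> t" for t
    using that R0 B0 by (simp add: c_def add_nonneg_pos)
  have "norm (f n t /\<^sub>R c t) \<le> 1" if "0 \<le> t" for n t
  proof -
    have "norm (f n t) \<le> norm (f n t - f n 0) + norm (f n 0)"
      by (metis diff_add_cancel norm_triangle_ineq)
    also have "\<dots> \<le> B * t + R"
      using lip[of 0 t n] bd[of n] that by simp
    finally have "norm (f n t) \<le> c t" by (simp add: c_def)
    then show ?thesis using c[OF that] by (simp add: divide_simps)
  qed
  then obtain k where k: "strict_mono (k :: nat \<Rightarrow> nat)"
    and lim: "\<And>t. t \<in> \<rat> \<inter> {0..} \<Longrightarrow> \<exists>l. (\<lambda>n. f (k n) t /\<^sub>R c t) \<longlonglongrightarrow> l"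
    using function_convergent_subsequence[of "\<rat> \<inter> {0::real..}" "\<lambda>n t. f n t /\<^sub>R c t" 1]
    by (metis IntE atLeast_iff countable_Int1 countable_rat)
  have conv_rat: "convergent (\<lambda>n. f (k n) q)" if q: "q \<in> \<rat>" "0 \<le> q" for q
  proof -
    obtain l where "(\<lambda>n. f (k n) q /\<^sub>R c q) \<longlonglongrightarrow> l" using lim q by auto
    then have "(\<lambda>n. c q *\<^sub>R (f (k n) q /\<^sub>R c q)) \<longlonglongrightarrow> c q *\<^sub>R l"
      by (intro tendsto_intros)
    then show ?thesis using c[OF q(2)] by (auto simp: convergent_def)
  qed
  have "convergent (\<lambda>n. f (k n) t)" if t: "0 \<le> t" for t
  proof -
    have "Cauchy (\<lambda>n. f (k n) t)"
    proof (rule metric_CauchyI)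
      fix e :: real assume e: "0 < e"
      \<comment> \<open>The rational \<open>q\<close> is so near \<open>t\<close> that the Lipschitz
        bound costs at most \<open>e / 3\<close> on each side; \<open>B + 1\<close> avoids a
        division by 0.\<close>
      obtain q where q: "q \<in> \<rat>" "t < q" "q < t + e / (3 * (B + 1))"
        using Rats_dense_in_real[of t "t + e / (3 * (B + 1))"] e B0 by auto
      have q0: "0 \<le> q" using q t by linarith
      have "B * \<bar>t - q\<bar> \<le> (B + 1) * (e / (3 * (B + 1)))"
        using q B0 by (intro mult_mono) auto
      also have "\<dots> = e / 3" using B0 by (simp add: field_simps)
      finally have Bq: "B * \<bar>t - q\<bar> \<le> e / 3" .
      have near: "dist (f n t) (f n q) \<le> e / 3" for n
        using lip[OF q0 t, of n] Bq by (simp add: dist_norm)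
      obtain M where M: "\<And>m n. m \<ge> M \<Longrightarrow> n \<ge> M \<Longrightarrow> dist (f (k m) q) (f (k n) q) < e / 3"
        using conv_rat[OF q(1) q0] e by (metis Cauchy_convergent_iff metric_CauchyD zero_less_divide_iff zero_less_numeral)
      show "\<exists>M. \<forall>m\<ge>M. \<forall>n\<ge>M. dist (f (k m) t) (f (k n) t) < e"
      proof (intro exI allI impI)
        fix m n assume mn: "m \<ge> M" "n \<ge> M"
        have "dist (f (k m) t) (f (k n) t) \<le> dist (f (k m) t) (f (k m) q) + dist (f (k m) q) (f (k n) q) + dist (f (k n) q) (f (k n) t)"
          by metric
        then show "dist (f (k m) t) (f (k n) t) < e"
          using near[of "k m"] near[of "k n"] M[OF mn] by (simp add: dist_commute)
      qed
    qed
    then show ?thesis by (simp add: Cauchy_convergent_iff)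
  qed
  then have "\<And>t. 0 \<le> t \<Longrightarrow> (\<lambda>n. f (k n) t) \<longlonglongrightarrow> lim (\<lambda>n. f (k n) t)"
    by (simp add: convergent_LIMSEQ_iff)
  then show thesis by (rule that[OF k])
qed

text \<open>The curve \<open>y n\<close> and the curve \<open>w n\<close> fed to \<open>F\<close>
  may differ as long as their limits agree: equal curves give compactness of the solution set, a
  delayed copy gives existence. Pointwise convergence suffices, since dominated convergence passes
  to the limit in the integral equation.\<close>

lemma limit_of_approximate_solutions:
  fixes F :: "'b::euclidean_space \<Rightarrow> 'b" and y w :: "nat \<Rightarrow> real \<Rightarrow> 'b"
  assumes F: "continuous_on UNIV F" and B: "\<And>x. norm (F x) \<le> B"
    and w: "\<And>n. continuous_on {0..} (w n)"
    and eq: "\<And>n t. 0 \<le> t \<Longrightarrow> y n t = y n 0 + integral {0..t} (\<lambda>s. F (w n s))"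
    and y_lim: "\<And>t. 0 \<le> t \<Longrightarrow> (\<lambda>n. y n t) \<longlonglongrightarrow> g t"
    and w_lim: "\<And>t. 0 \<le> t \<Longrightarrow> (\<lambda>n. w n t) \<longlonglongrightarrow> g t"
    and t: "0 \<le> t"
  shows "(g has_vector_derivative F (g t)) (at t within {0..})"
proof -
  have Fg: "(\<lambda>n. F (w n s)) \<longlonglongrightarrow> F (g s)" if "0 \<le> s" for s
    using continuous_on_tendsto_compose[OF F w_lim[OF that]] by simp
  have int: "(\<lambda>s. F (w n s)) integrable_on {0..t}" for n t
    by (intro integrable_continuous_real continuous_on_compose2[OF F] continuous_on_subset[OF w]) auto
  have lim: "(\<lambda>s. F (g s)) integrable_on {0..t}"
    "(\<lambda>n. integral {0..t} (\<lambda>s. F (w n s))) \<longlonglongrightarrow> integral {0..t} (\<lambda>s. F (g s))" for t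
    using dominated_convergence[of "\<lambda>n s. F (w n s)" "{0..t}" "\<lambda>_. B" "\<lambda>s. F (g s)"] int B Fg by auto
  have g: "g t = g 0 + integral {0..t} (\<lambda>s. F (g s))" if "0 \<le> t" for t
  proof (rule LIMSEQ_unique)
    show "(\<lambda>n. y n t) \<longlonglongrightarrow> g t" using y_lim that by simp
    show "(\<lambda>n. y n t) \<longlonglongrightarrow> g 0 + integral {0..t} (\<lambda>s. F (g s))"
      using tendsto_add[OF y_lim[of 0] lim(2)[of t]] by (simp add: eq[OF that])
  qed
  \<comment> \<open>A pointwise limit need not be continuous; continuity is read off the integral
    equation, whose integrand is already known to be integrable.\<close>
  have cont: "continuous_on {0..T} (\<lambda>s. F (g s))" for T
  proof -
    have "continuous_on {0..T} (\<lambda>t. g 0 + integral {0..t} (\<lambda>s. F (g s)))"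
      by (intro continuous_intros indefinite_integral_continuous_1 lim)
    then have "continuous_on {0..T} g"
      by (rule continuous_on_eq) (simp add: g[symmetric])
    then show ?thesis by (intro continuous_on_compose2[OF F]) auto
  qed
  have "((\<lambda>u. g 0 + integral {0..u} (\<lambda>s. F (g s))) has_vector_derivative F (g t)) (at t within {0..t+1})"
    using integral_has_vector_derivative[OF cont[of "t+1"], of t] t
    by (auto intro!: derivative_eq_intros)
  then have "(g has_vector_derivative F (g t)) (at t within {0..t+1})"
    by (rule has_vector_derivative_transform[rotated 2]) (use t in \<open>auto simp: g[symmetric]\<close>)
  moreover have "at t within {0..t+1} = at t within {0..}"
    by (rule at_within_nhd[of _ "{..<t+1}"]) (use t in auto)
  ultimately show ?thesis by simp
qed

text \<open>The bound on the field is a common Lipschitz constant for all solutions, so bounded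
  initial values suffice. The limit lemma is applied with \<open>w = y\<close>.\<close>

lemma solutions_convergent_subsequence:
  fixes F :: "'b::euclidean_space \<Rightarrow> 'b" and y :: "nat \<Rightarrow> real \<Rightarrow> 'b"
  assumes F: "continuous_on UNIV F" and B: "\<And>x. norm (F x) \<le> B"
    and y: "\<And>n t. 0 \<le> t \<Longrightarrow> (y n has_vector_derivative F (y n t)) (at t within {0..})"
    and R: "\<And>n. norm (y n 0) \<le> R"
  obtains k g where "strict_mono (k :: nat \<Rightarrow> nat)" "\<And>t. 0 \<le> t \<Longrightarrow> (\<lambda>n. y (k n) t) \<longlonglongrightarrow> g t"
    "\<And>t. 0 \<le> t \<Longrightarrow> (g has_vector_derivative F (g t)) (at t within {0..})"
proof -
  have cont: "continuous_on {0..} (y n)" for n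
    using y by (auto simp: continuous_on_eq_continuous_within intro: has_vector_derivative_continuous)
  have eq: "y n t = y n 0 + integral {0..t} (\<lambda>s. F (y n s))" if "0 \<le> t" for n t
  proof -
    have "((\<lambda>s. F (y n s)) has_integral y n t - y n 0) {0..t}"
      using that by (intro fundamental_theorem_of_calculus) (auto intro: has_vector_derivative_within_subset[OF y])
    then show ?thesis by (simp add: integral_unique)
  qed
  have "norm (y n t - y n s) \<le> B * \<bar>t - s\<bar>" if "0 \<le> s" "0 \<le> t" for n s t
  proof -
    have "onorm (\<lambda>h. h *\<^sub>R F (y n t)) \<le> B" for t
    proof (rule onorm_bound)
      show "0 \<le> B" using order_trans[OF norm_ge_zero B] .
      show "norm (h *\<^sub>R F (y n t)) \<le> B * norm h" for h
        using mult_right_mono[OF B, of "\<bar>h\<bar>" "y n t"] by (simp add: mult.commute)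
    qed
    then show ?thesis
      using differentiable_bound[of "{0..}" "y n" "\<lambda>t h. h *\<^sub>R F (y n t)" B t s] that y
      by (simp add: has_vector_derivative_def)
  qed
  from lipschitz_sequence_convergent_subsequence[of y, OF this R] obtain k g
    where k: "strict_mono (k :: nat \<Rightarrow> nat)" and g: "\<And>t. 0 \<le> t \<Longrightarrow> (\<lambda>n. y (k n) t) \<longlonglongrightarrow> g t"
    by metis
  show thesis
  proof (rule that[OF k g])
    show "(g has_vector_derivative F (g t)) (at t within {0..})" if "0 \<le> t" for t
      using limit_of_approximate_solutions[of F B "\<lambda>n. y (k n)" "\<lambda>n. y (k n)" g, OF F B cont _ g g that] eq
      by blast
  qed
qed

text \<open>
  Picard iterates of Tonelli's equation with delay \<open>d\<close>. The \<open>m\<close>-th iterate already solves the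
  equation on \<open>{..m * d}\<close>, so no fixed point is needed.
\<close>

primrec delayed_iterate :: "('b::euclidean_space \<Rightarrow> 'b) \<Rightarrow> 'b \<Rightarrow> real \<Rightarrow> nat \<Rightarrow> real \<Rightarrow> 'b" where
  "delayed_iterate F y0 d 0 = (\<lambda>t. y0)"
| "delayed_iterate F y0 d (Suc m) = (\<lambda>t. y0 + integral {0..t} (\<lambda>s. F (delayed_iterate F y0 d m (s - d))))"

lemma delayed_iterate_continuous:
  assumes F: "continuous_on UNIV F" and B: "\<And>x. norm (F x) \<le> B"
  shows "continuous_on UNIV (delayed_iterate F y0 d m)"
    and "norm (delayed_iterate F y0 d m t - delayed_iterate F y0 d m s) \<le> B * \<bar>t - s\<bar>"
proof (induction m arbitrary: s t)
  case 0
  { case 1 then show ?case by simp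
  next
    case 2 then show ?case using B[of 0] norm_ge_zero[of "F 0"] by (simp del: norm_ge_zero)}
next
  case (Suc m)
  have cont: "continuous_on UNIV (\<lambda>s. F (delayed_iterate F y0 d m (s - d)))"
    by (intro continuous_on_compose2[OF F] continuous_on_compose2[OF Suc(1)] continuous_intros) auto
  have lip: "norm (delayed_iterate F y0 d (Suc m) t - delayed_iterate F y0 d (Suc m) s) \<le> B * \<bar>t - s\<bar>" for s t
    using integral_Icc_lipschitz[OF cont B] by simp
  have B0: "0 \<le> B" using B[of 0] norm_ge_zero order_trans by blast
  { case 1
    have "B-lipschitz_on UNIV (delayed_iterate F y0 d (Suc m))"
      using lip B0 by (intro lipschitz_onI) (simp_all only: dist_norm real_norm_def)
    then show ?case by (rule lipschitz_on_continuous_on)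
  next
    case 2 show ?case by (rule lip)}
qed

text \<open>At time \<open>t\<close> the right-hand side uses the previous iterate only up to
  \<open>t - d\<close>, so agreement spreads by one delay per iteration. It starts at
  \<open>t \<le> 0\<close>, where the integral is 0 and every iterate equals
  \<open>y0\<close>.\<close>

lemma delayed_iterate_stable:
  "t \<le> real m * d \<Longrightarrow> delayed_iterate F y0 d (Suc m) t = delayed_iterate F y0 d m t"
proof (induction m arbitrary: t)
  case 0
  then show ?case by (cases "t = 0") auto
next
  case (Suc m)
  have "integral {0..t} (\<lambda>s. F (delayed_iterate F y0 d (Suc m) (s - d))) =
        integral {0..t} (\<lambda>s. F (delayed_iterate F y0 d m (s - d)))"
  proof (rule Henstock_Kurzweil_Integration.integral_cong)
    fix s assume "s \<in> {0..t}"
    then have "s - d \<le> real m * d" using Suc.prems by (simp add: algebra_simps)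
    then show "F (delayed_iterate F y0 d (Suc m) (s - d)) = F (delayed_iterate F y0 d m (s - d))"
      by (simp only: Suc.IH)
  qed
  then show ?case by simp
qed

lemma peano_half_line:
  fixes F :: "'b::euclidean_space \<Rightarrow> 'b"
  assumes F: "continuous_on UNIV F" and B: "\<And>x. norm (F x) \<le> B"
  obtains y where "y 0 = y0" "\<And>t. 0 \<le> t \<Longrightarrow> (y has_vector_derivative F (y t)) (at t within {0..})"
proof -
  have B0: "0 \<le> B" using B[of 0] norm_ge_zero order_trans by blast
  define d where "d n = 1 / real (Suc n)" for n
  \<comment> \<open>With delay \<open>1 / (n + 1)\<close>, the \<open>(n + 1)^2\<close> iterations
    reach time \<open>n + 1\<close>. \<open>Y\<close> takes one iteration more than
    \<open>W\<close>, so that the integral equation linking the two is exact.\<close>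
  define Y where "Y n = delayed_iterate F y0 (d n) (Suc (Suc n * Suc n))" for n
  define W where "W n s = delayed_iterate F y0 (d n) (Suc n * Suc n) (s - d n)" for n s
  note cont = delayed_iterate_continuous[OF F B]
  have Y_0: "Y n 0 = y0" for n by (simp add: Y_def)
  obtain k g where k: "strict_mono (k :: nat \<Rightarrow> nat)" and g: "\<And>t. 0 \<le> t \<Longrightarrow> (\<lambda>n. Y (k n) t) \<longlonglongrightarrow> g t"
    using lipschitz_sequence_convergent_subsequence[of Y B "norm y0"] cont(2) Y_0 by (metis Y_def order_refl)
  have near: "norm (W n t - Y n t) \<le> B * d n" if "t \<le> real n" for n t
  proof -
    have d: "0 \<le> d n" "real (Suc n * Suc n) * d n = real (Suc n)"
      unfolding d_def of_nat_mult by simp_all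
    \<comment> \<open>In this range the iterates have stabilized, so \<open>W n\<close> is
      \<open>Y n\<close> shifted by the delay and the Lipschitz bound makes the two close.\<close>
    have "t - d n \<le> real (Suc n * Suc n) * d n" using that d by linarith
    then have "W n t = Y n (t - d n)"
      unfolding W_def Y_def by (rule delayed_iterate_stable[symmetric])
    then show ?thesis
      using cont(2)[of y0 "d n" "Suc (Suc n * Suc n)" "t - d n" t] d by (simp add: Y_def del: delayed_iterate.simps mult_Suc mult_Suc_right)
  qed
  have "(g has_vector_derivative F (g t)) (at t within {0..})" if "0 \<le> t" for t
  proof (rule limit_of_approximate_solutions[OF F B _ _ g _ that])
    show "continuous_on {0..} (W (k n))" for n
      unfolding W_def by (intro continuous_on_compose2[OF cont(1)] continuous_intros) auto
    show "Y (k n) t = Y (k n) 0 + integral {0..t} (\<lambda>s. F (W (k n) s))" for n t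
      unfolding Y_0 by (simp add: Y_def W_def del: mult_Suc mult_Suc_right)
    fix t :: real assume t: "0 \<le> t"
    have "(\<lambda>n. B * d n) \<longlonglongrightarrow> B * 0"
      unfolding d_def inverse_eq_divide[symmetric] by (intro tendsto_mult tendsto_const LIMSEQ_inverse_real_of_nat)
    then have "(\<lambda>n. B * d (k n)) \<longlonglongrightarrow> 0"
      using LIMSEQ_subseq_LIMSEQ[OF _ k] by (auto simp: o_def)
    moreover have "\<forall>\<^sub>F n in sequentially. norm (W (k n) t - Y (k n) t) \<le> B * d (k n)"
    proof -
      obtain N :: nat where "t \<le> N" using real_arch_simple by blast
      then show ?thesis unfolding eventually_sequentially
        using near seq_suble[OF k] by (meson of_nat_mono order_trans)
    qed
    ultimately have "(\<lambda>n. W (k n) t - Y (k n) t) \<longlonglongrightarrow> 0"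
      by (rule Lim_null_comparison[rotated])
    from tendsto_add[OF this g[OF t]] show "(\<lambda>n. W (k n) t) \<longlonglongrightarrow> g t" by simp
  qed
  moreover have "g 0 = y0"
    using g[of 0] by (simp add: Y_0 LIMSEQ_const_iff)
  ultimately show thesis using that[of g] by simp
qed

text \<open>A forward solution for \<open>F\<close> and a time-reversed forward solution for
  \<open>- F\<close> are glued at time 0, where their one-sided derivatives agree.\<close>

lemma peano:
  fixes F :: "'b::euclidean_space \<Rightarrow> 'b"
  assumes F: "continuous_on UNIV F" and B: "\<And>x. norm (F x) \<le> B"
  obtains y where "y 0 = y0" "\<And>t. (y has_vector_derivative F (y t)) (at t)"
proof -
  obtain p where p: "p 0 = y0" "\<And>t. 0 \<le> t \<Longrightarrow> (p has_vector_derivative F (p t)) (at t within {0..})"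
    using peano_half_line[OF F B] by metis
  have "continuous_on UNIV (\<lambda>x. - F x)" "\<And>x. norm (- F x) \<le> B"
    using F B by (auto intro: continuous_intros)
  then obtain q where q: "q 0 = y0" "\<And>t. 0 \<le> t \<Longrightarrow> (q has_vector_derivative - F (q t)) (at t within {0..})"
    using peano_half_line by metis
  define y where "y t = (if 0 \<le> t then p t else q (- t))" for t
  have right: "(y has_vector_derivative F (y t)) (at t within {0..})" if "0 \<le> t" for t
  proof -
    have "F (y t) = F (p t)" using that by (simp add: y_def)
    then show ?thesis
      using has_vector_derivative_transform[OF _ _ p(2)[OF that], of y] that by (simp add: y_def)
  qed
  have left: "(y has_vector_derivative F (y t)) (at t within {..0})" if "t \<le> 0" for t
  proof -
    have "(uminus has_vector_derivative -1) (at t within {..0})" by (auto intro!: derivative_eq_intros)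
    moreover have "(q has_vector_derivative - F (q (- t))) (at (- t) within uminus ` {..0})"
      using q(2)[of "- t"] that by simp
    ultimately have "(q \<circ> uminus has_vector_derivative (-1) *\<^sub>R - F (q (- t))) (at t within {..0})"
      by (rule vector_diff_chain_within)
    then have "(y has_vector_derivative (-1) *\<^sub>R - F (q (- t))) (at t within {..0})"
      by (rule has_vector_derivative_transform[rotated 2]) (use that p(1) q(1) in \<open>auto simp: y_def\<close>)
    moreover have "F (q (- t)) = F (y t)" using that p(1) q(1) by (auto simp: y_def)
    ultimately show ?thesis by simp
  qed
  have "(y has_vector_derivative F (y t)) (at t)" for t
  proof (cases "t = 0")
    case True
    have "(y has_vector_derivative F (y t)) (at t within {..0} \<union> {0..})"
      using right[of t] left[of t] True
      unfolding has_vector_derivative_def has_derivative_within by (auto intro: Lim_Un)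
    moreover have "{..0::real} \<union> {0..} = UNIV" by auto
    ultimately show ?thesis by simp
  next
    case False
    then consider "t < 0" | "0 < t" by linarith
    then show ?thesis
    proof cases
      case 1
      then show ?thesis using left[of t] at_within_interior[of t "{..0::real}"] by simp
    next
      case 2
      then show ?thesis using right[of t] at_within_interior[of t "{0::real..}"] by simp
    qed
  qed
  moreover have "y 0 = y0" using p by (simp add: y_def)
  ultimately show thesis using that[of y] by simp
qed


section \<open>The distance to the south pole\<close>

text \<open>
  The colatitude is not differentiable at the poles, but \<open>arcsin (e * z)\<close> with \<open>e < 1\<close> is smooth in
  the height \<open>z\<close> and still 1-Lipschitz on the sphere; then \<open>e\<close> tends to 1.
\<close>

lemma dist_S2_lower_bound:
  assumes c: "valid_path c" "path_image c \<subseteq> S2" "pathfinish c = south_pole"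
    and L: "((\<lambda>t. norm (vector_derivative c (at t))) has_integral L) {0..1}"
  shows "arcsin (pathstart c $ 3) + pi / 2 \<le> L"
proof -
  define e3 :: "real^3" where "e3 = axis 3 1"
  have e3: "e3 \<bullet> e3 = 1" "x $ 3 = x \<bullet> e3" for x
    by (simp_all add: e3_def inner_axis inner_axis_axis)
  obtain S D where S: "finite S" and cont: "continuous_on {0..1} c"
    and D: "\<And>t. t \<in> {0..1} - S \<Longrightarrow> (c has_vector_derivative D t) (at t)"
    using c(1) unfolding valid_path_def piecewise_C1_differentiable_on_def C1_differentiable_on_def by blast
  have sphere: "c t \<bullet> c t = 1" if "t \<in> {0..1}" for t
    using c(2) that by (auto simp: path_image_def norm_eq_1 subset_iff)
  have c3: "\<bar>c t $ 3\<bar> \<le> 1" if "t \<in> {0..1}" for t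
    using sphere[OF that] component_le_norm_cart[of "c t" 3] by (simp add: norm_eq_sqrt_inner)
  have tangent: "D t \<bullet> c t = 0" if "t \<in> {0<..<1} - S" for t
  proof -
    have "((\<lambda>t. c t \<bullet> c t) has_vector_derivative c t \<bullet> D t + D t \<bullet> c t) (at t)"
      using D[of t] that unfolding has_vector_derivative_def
      by (auto intro!: derivative_eq_intros simp: algebra_simps)
    moreover have "((\<lambda>t. c t \<bullet> c t) has_vector_derivative 0) (at t)"
    proof (rule has_vector_derivative_transform_within_open[of "\<lambda>_. 1" _ _ "{0<..<1}"])
      show "((\<lambda>_. 1) has_vector_derivative 0) (at t)" by simp
    qed (use sphere that in auto)
    ultimately show ?thesis
      using vector_derivative_unique_at by (fastforce simp: inner_commute)
  qed
  have bound: "arcsin (e * (pathstart c $ 3)) + arcsin e \<le> L" if e: "e \<in> {0<..<1}" for e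
  proof -
    have ec: "\<bar>e * c t $ 3\<bar> < 1" if "t \<in> {0..1}" for t
    proof -
      have "e * \<bar>c t $ 3\<bar> \<le> e * 1" using c3[OF that] e by (intro mult_left_mono) auto
      moreover have "\<bar>e * c t $ 3\<bar> = e * \<bar>c t $ 3\<bar>" using e by (simp add: abs_mult)
      ultimately show ?thesis using e unfolding greaterThanLessThan_iff by linarith
    qed
    \<comment> \<open>The value 0 at the other times is harmless: the fundamental theorem tolerates
      finitely many exceptional points, and the comparison with the speed remains true
      there.\<close>
    define h' where "h' t = (if t \<in> {0<..<1} - S then e * (D t $ 3) / sqrt (1 - (e * c t $ 3)\<^sup>2) else 0)" for t
    have "(h' has_integral arcsin (e * c 1 $ 3) - arcsin (e * c 0 $ 3)) {0..1}"
    proof (rule fundamental_theorem_of_calculus_interior_strong[OF S])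
      show "continuous_on {0..1} (\<lambda>t. arcsin (e * c t $ 3))"
        using ec by (intro continuous_intros cont) (auto simp: abs_less_iff intro: less_imp_le)
      fix t assume t: "t \<in> {0<..<1} - S"
      have "((\<lambda>t. e * c t $ 3) has_vector_derivative e * D t $ 3) (at t)"
        using D[of t] t
        by (intro has_vector_derivative_mult_right bounded_linear.has_vector_derivative[OF bounded_linear_vec_nth]) auto
      moreover have "(arcsin has_field_derivative inverse (sqrt (1 - (e * c t $ 3)\<^sup>2))) (at (e * c t $ 3))"
        using ec[of t] t by (intro DERIV_arcsin) auto
      ultimately have "(arcsin \<circ> (\<lambda>t. e * c t $ 3) has_vector_derivative e * D t $ 3 * inverse (sqrt (1 - (e * c t $ 3)\<^sup>2))) (at t)"
        by (rule field_vector_diff_chain_at)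
      then show "((\<lambda>t. arcsin (e * c t $ 3)) has_vector_derivative h' t) (at t)"
        using t by (simp add: h'_def o_def divide_inverse)
    qed auto
    then have neg: "((\<lambda>t. - h' t) has_integral arcsin (e * c 0 $ 3) - arcsin (e * c 1 $ 3)) {0..1}"
      by (auto dest: has_integral_neg)
    have le: "- h' t \<le> norm (vector_derivative c (at t))" for t
    proof (cases "t \<in> {0<..<1} - S")
      case True
      have t: "t \<in> {0..1}" using True by auto
      have vd: "vector_derivative c (at t) = D t"
        using D[of t] True by (intro vector_derivative_at) auto
      define z where "z = c t $ 3"
      \<comment> \<open>The velocity is orthogonal to \<open>c t\<close>, so it sees only the
        tangential part of \<open>e3\<close>, of length \<open>sqrt (1 - z\<^sup>2)\<close>. This
        factor is what the denominator of the derivative of arcsin has to absorb.\<close>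
      have "D t $ 3 = D t \<bullet> (e3 - z *\<^sub>R c t)"
        using tangent[OF True] by (simp add: inner_diff_right e3)
      then have "\<bar>D t $ 3\<bar> \<le> norm (D t) * norm (e3 - z *\<^sub>R c t)"
        by (simp only: Cauchy_Schwarz_ineq2)
      also have "norm (e3 - z *\<^sub>R c t) = sqrt (1 - z\<^sup>2)"
        using sphere[OF t]
        by (simp add: norm_eq_sqrt_inner inner_diff_left inner_diff_right e3 z_def inner_commute power2_eq_square)
      finally have 1: "\<bar>D t $ 3\<bar> \<le> norm (D t) * sqrt (1 - z\<^sup>2)" .
      have z: "(e * z)\<^sup>2 < 1" using ec[OF t] by (simp add: z_def abs_square_less_1)
      have "e * sqrt (1 - z\<^sup>2) = sqrt (e\<^sup>2 * (1 - z\<^sup>2))"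
        using e by (simp add: real_sqrt_mult)
      also have "\<dots> \<le> sqrt (1 - (e * z)\<^sup>2)"
        using e by (simp add: algebra_simps power_mult_distrib power_le_one)
      finally have 2: "e * sqrt (1 - z\<^sup>2) \<le> sqrt (1 - (e * z)\<^sup>2)" .
      have "e * \<bar>D t $ 3\<bar> \<le> norm (D t) * (e * sqrt (1 - z\<^sup>2))"
        using mult_left_mono[OF 1, of e] e by (simp add: mult_ac)
      also have "\<dots> \<le> norm (D t) * sqrt (1 - (e * z)\<^sup>2)"
        by (intro mult_left_mono 2) auto
      finally have "e * \<bar>D t $ 3\<bar> / sqrt (1 - (e * z)\<^sup>2) \<le> norm (D t)"
        using z by (simp add: divide_le_eq)
      moreover have "- h' t \<le> e * \<bar>D t $ 3\<bar> / sqrt (1 - (e * z)\<^sup>2)"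
      proof -
        have "- h' t = e * - (D t $ 3) / sqrt (1 - (e * z)\<^sup>2)"
          using True by (simp add: h'_def z_def)
        also have "\<dots> \<le> e * \<bar>D t $ 3\<bar> / sqrt (1 - (e * z)\<^sup>2)"
          using e z by (intro divide_right_mono mult_left_mono) auto
        finally show ?thesis .
      qed
      ultimately show ?thesis using vd by simp
    qed (auto simp: h'_def)
    have "arcsin (e * c 0 $ 3) - arcsin (e * c 1 $ 3) \<le> L"
      by (rule has_integral_le[OF neg L le])
    moreover have "c 1 $ 3 = -1" using c(3) by (simp add: pathfinish_def south_pole_def)
    ultimately show ?thesis
      using e by (simp add: pathstart_def arcsin_minus)
  qed
  have p: "pathstart c $ 3 \<in> {-1..1}" using c3[of 0] by (simp add: pathstart_def abs_le_iff)
  \<comment> \<open>The estimate for \<open>e < 1\<close> holds even for curves through the poles,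
    and arcsin is continuous up to the endpoints, so \<open>e = 1\<close> follows by
    closure.\<close>
  have "arcsin (1 * (pathstart c $ 3)) + arcsin 1 \<le> L"
  proof (rule continuous_le_on_closure[of "{0<..<1}" "\<lambda>e. arcsin (e * (pathstart c $ 3)) + arcsin e"])
    have "\<bar>e * (pathstart c $ 3)\<bar> \<le> 1" if "e \<in> {0..1}" for e
      using that p mult_mono[of e 1 "\<bar>pathstart c $ 3\<bar>" 1] by (simp add: abs_mult abs_le_iff)
    then show "continuous_on (closure {0<..<1}) (\<lambda>e. arcsin (e * (pathstart c $ 3)) + arcsin e)"
      by (intro continuous_intros) (auto simp: abs_le_iff)
  qed (use bound in auto)
  then show ?thesis by simp
qed

text \<open>The minimizer is the great circle arc from \<open>x\<close> to the south pole, run at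
  constant speed equal to its length \<theta>.\<close>

lemma dist_S2_attained:
  assumes x: "x \<in> S2"
  defines "\<theta> \<equiv> arcsin (x $ 3) + pi / 2"
  obtains c where "valid_path c" "path_image c \<subseteq> S2" "pathstart c = x" "pathfinish c = south_pole"
    "((\<lambda>t. norm (vector_derivative c (at t))) has_integral \<theta>) {0..1}"
proof -
  define e3 :: "real^3" where "e3 = axis 3 1"
  have e3: "e3 \<bullet> e3 = 1" "x $ 3 = x \<bullet> e3" for x
    by (simp_all add: e3_def inner_axis inner_axis_axis)
  have x3: "\<bar>x $ 3\<bar> \<le> 1" using x component_le_norm_cart[of x 3] by simp
  have xx: "x \<bullet> x = 1" using x by (simp add: norm_eq_1)
  have \<theta>: "0 \<le> \<theta>" using x3 arcsin_lbound[of "x $ 3"] by (auto simp: \<theta>_def abs_le_iff)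
  have cos: "cos \<theta> = - (x $ 3)" using x3 by (simp add: \<theta>_def cos_add sin_arcsin abs_le_iff)
  have sin: "sin \<theta> = sqrt (1 - (x $ 3)\<^sup>2)" using x3 by (simp add: \<theta>_def sin_add cos_arcsin abs_le_iff)
  \<comment> \<open>\<open>u\<close> is the horizontal direction of \<open>x\<close>. At a pole no
    direction is distinguished, and any unit vector orthogonal to \<open>e3\<close> serves.\<close>
  define u where "u = (if sin \<theta> = 0 then axis 1 1 else (x - (x $ 3) *\<^sub>R e3) /\<^sub>R sin \<theta>)"
  have norm: "(x - (x $ 3) *\<^sub>R e3) \<bullet> (x - (x $ 3) *\<^sub>R e3) = (sin \<theta>)\<^sup>2"
  proof -
    have "x \<bullet> e3 = x $ 3" "e3 \<bullet> x = x $ 3" by (simp_all add: e3(2) inner_commute)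
    then have "(x - (x $ 3) *\<^sub>R e3) \<bullet> (x - (x $ 3) *\<^sub>R e3) = 1 - (x $ 3)\<^sup>2"
      by (simp add: inner_diff_left inner_diff_right e3(1) xx power2_eq_square)
    also have "\<dots> = (sin \<theta>)\<^sup>2" using x3 by (simp add: sin abs_square_le_1)
    finally show ?thesis .
  qed
  have u: "u \<bullet> u = 1" "u \<bullet> e3 = 0"
  proof -
    have "((x - (x $ 3) *\<^sub>R e3) /\<^sub>R a) \<bullet> ((x - (x $ 3) *\<^sub>R e3) /\<^sub>R a) = 1" if "a = sin \<theta>" "a \<noteq> 0" for a
      using norm that by (simp only: inner_scaleR_left inner_scaleR_right) (simp add: power2_eq_square divide_simps)
    then show "u \<bullet> u = 1" by (simp add: u_def inner_axis_axis)
    have "axis 1 1 \<bullet> e3 = 0" by (simp add: e3_def inner_axis_axis)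
    moreover have "(x - (x $ 3) *\<^sub>R e3) \<bullet> e3 = 0"
      by (simp add: inner_diff_left e3(1)) (simp add: e3(2))
    ultimately show "u \<bullet> e3 = 0" by (simp add: u_def)
  qed
  have eu: "e3 \<bullet> u = 0" using u(2) by (simp add: inner_commute)
  have xu: "x = - cos \<theta> *\<^sub>R e3 + sin \<theta> *\<^sub>R u"
  proof (cases "sin \<theta> = 0")
    case True
    then have "x - (x $ 3) *\<^sub>R e3 = 0" using norm by simp
    then show ?thesis using True cos by simp
  next
    case False
    then show ?thesis using cos by (simp add: u_def)
  qed
  define c where "c t = - cos ((1 - t) * \<theta>) *\<^sub>R e3 + sin ((1 - t) * \<theta>) *\<^sub>R u" for t
  define D where "D t = (- \<theta>) *\<^sub>R (sin ((1 - t) * \<theta>) *\<^sub>R e3 + cos ((1 - t) * \<theta>) *\<^sub>R u)" for t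
  have c: "(c has_vector_derivative D t) (at t)" for t
    unfolding c_def D_def has_vector_derivative_def
    by (auto intro!: derivative_eq_intros simp: algebra_simps)
  have "continuous_on UNIV D" unfolding D_def by (intro continuous_intros)
  then have "valid_path c"
    unfolding valid_path_def
    using c by (intro C1_differentiable_imp_piecewise) (auto simp: C1_differentiable_on_def intro: continuous_on_subset)
  moreover have "c t \<bullet> c t = 1" for t
    by (simp add: c_def inner_add_left inner_add_right inner_diff_left inner_diff_right u eu e3(1)
        sin_cos_squared_add[unfolded power2_eq_square])
  then have "path_image c \<subseteq> S2" by (auto simp: path_image_def norm_eq_1)
  moreover have "pathstart c = x" using xu by (simp add: pathstart_def c_def)
  moreover have "pathfinish c = south_pole" by (simp add: pathfinish_def c_def south_pole_def e3_def)
  moreover have "norm (vector_derivative c (at t)) = \<theta>" for t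
  proof -
    have "norm (sin ((1 - t) * \<theta>) *\<^sub>R e3 + cos ((1 - t) * \<theta>) *\<^sub>R u) = 1"
      by (simp add: norm_eq_1 inner_add_left inner_add_right u eu e3(1) sin_cos_squared_add[unfolded power2_eq_square])
    then show ?thesis
      using \<theta> by (simp add: vector_derivative_at[OF c] D_def)
  qed
  then have "((\<lambda>t. norm (vector_derivative c (at t))) has_integral \<theta>) {0..1}"
    using has_integral_const_real[of \<theta> 0 1] by simp
  ultimately show thesis by (rule that)
qed

lemma dist_S2_south_pole:
  assumes "x \<in> S2"
  shows "dist_S2 x south_pole = arcsin (x $ 3) + pi / 2"
  unfolding dist_S2_def
proof (rule cInf_eq_minimum)
  show "arcsin (x $ 3) + pi / 2 \<in> {L. \<exists>c. valid_path c \<and> path_image c \<subseteq> S2 \<and> pathstart c = x \<and>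
     pathfinish c = south_pole \<and> ((\<lambda>t. norm (vector_derivative c (at t))) has_integral L) {0..1}}"
    by (rule dist_S2_attained[OF assms]) blast
  fix L assume "L \<in> {L. \<exists>c. valid_path c \<and> path_image c \<subseteq> S2 \<and> pathstart c = x \<and>
     pathfinish c = south_pole \<and> ((\<lambda>t. norm (vector_derivative c (at t))) has_integral L) {0..1}}"
  then obtain c where "valid_path c" "path_image c \<subseteq> S2" "pathstart c = x" "pathfinish c = south_pole"
    "((\<lambda>t. norm (vector_derivative c (at t))) has_integral L) {0..1}" by blast
  then show "arcsin (x $ 3) + pi / 2 \<le> L" using dist_S2_lower_bound by metis
qed


section \<open>Stereographic charts\<close>

lemma C_k_on_UNIV_SucI:
  assumes "\<And>x. (f has_derivative f' x) (at x)" "\<And>v. C_k_on k UNIV (\<lambda>x. f' x v)"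
  shows "C_k_on (Suc k) UNIV f"
proof -
  have "frechet_derivative f (at x) = f' x" for x
    using assms(1) frechet_derivative_at by metis
  then show ?thesis
    using assms by (auto simp: differentiable_on_def differentiable_def)
qed

lemma C_k_on_UNIV_SucD:
  assumes "C_k_on (Suc k) UNIV f"
  shows "(f has_derivative frechet_derivative f (at x)) (at x)"
    and "C_k_on k UNIV (\<lambda>x. frechet_derivative f (at x) v)"
  using assms by (auto simp: differentiable_on_def frechet_derivative_works)

lemma C_k_on_UNIV_continuous: "C_k_on k UNIV f \<Longrightarrow> continuous_on UNIV f"
  by (cases k) (auto simp: differentiable_imp_continuous_on)

lemma C_k_on_UNIV_Suc_imp: "C_k_on (Suc k) UNIV f \<Longrightarrow> C_k_on k UNIV f"
proof (induction k arbitrary: f)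
  case 0
  then show ?case using C_k_on_UNIV_continuous by (metis C_k_on.simps(1))
next
  case (Suc k)
  show ?case
    by (rule C_k_on_UNIV_SucI[OF C_k_on_UNIV_SucD(1)[OF Suc.prems] Suc.IH[OF C_k_on_UNIV_SucD(2)[OF Suc.prems]]])
qed

lemma C_k_on_UNIV_const: "C_k_on k UNIV (\<lambda>x. c)"
  by (induction k arbitrary: c) (auto intro: C_k_on_UNIV_SucI[where f' = "\<lambda>x v. 0"])

lemma C_k_on_UNIV_linear: "bounded_linear f \<Longrightarrow> C_k_on k UNIV f"
proof (cases k)
  case (Suc n)
  assume f: "bounded_linear f"
  show ?thesis unfolding Suc
    by (rule C_k_on_UNIV_SucI[OF bounded_linear_imp_has_derivative[OF f] C_k_on_UNIV_const])
qed (simp add: linear_continuous_on)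

lemma C_k_on_UNIV_add:
  "C_k_on k UNIV f \<Longrightarrow> C_k_on k UNIV g \<Longrightarrow> C_k_on k UNIV (\<lambda>x. f x + g x)"
proof (induction k arbitrary: f g)
  case (Suc k)
  show ?case
    by (rule C_k_on_UNIV_SucI[OF has_derivative_add[OF C_k_on_UNIV_SucD(1)[OF Suc.prems(1)] C_k_on_UNIV_SucD(1)[OF Suc.prems(2)]]])
      (rule Suc.IH[OF C_k_on_UNIV_SucD(2)[OF Suc.prems(1)] C_k_on_UNIV_SucD(2)[OF Suc.prems(2)]])
qed (auto intro: continuous_on_add)

lemma C_k_on_UNIV_uminus:
  "C_k_on k UNIV f \<Longrightarrow> C_k_on k UNIV (\<lambda>x. - f x)"
proof (induction k arbitrary: f)
  case (Suc k)
  show ?case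
    by (rule C_k_on_UNIV_SucI[OF has_derivative_minus[OF C_k_on_UNIV_SucD(1)[OF Suc.prems]]])
      (rule Suc.IH[OF C_k_on_UNIV_SucD(2)[OF Suc.prems]])
qed (auto intro: continuous_on_minus)

text \<open>The Leibniz rule leaves \<open>f\<close> and \<open>g\<close> themselves in the
  derivative, so the induction also uses that order \<open>Suc k\<close> implies order
  \<open>k\<close>.\<close>

lemma C_k_on_UNIV_scaleR:
  "C_k_on k UNIV f \<Longrightarrow> C_k_on k UNIV g \<Longrightarrow> C_k_on k UNIV (\<lambda>x. f x *\<^sub>R g x)"
proof (induction k arbitrary: f g)
  case (Suc k)
  note f = C_k_on_UNIV_SucD[OF Suc.prems(1)] and g = C_k_on_UNIV_SucD[OF Suc.prems(2)]
  show ?case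
    by (rule C_k_on_UNIV_SucI[OF has_derivative_scaleR[OF f(1) g(1)]])
      (intro C_k_on_UNIV_add Suc.IH f g Suc.prems[THEN C_k_on_UNIV_Suc_imp])
qed (auto intro: continuous_on_scaleR)

lemma C_k_on_UNIV_mult:
  fixes f g :: "'a::euclidean_space \<Rightarrow> real"
  shows "C_k_on k UNIV f \<Longrightarrow> C_k_on k UNIV g \<Longrightarrow> C_k_on k UNIV (\<lambda>x. f x * g x)"
  using C_k_on_UNIV_scaleR[of k f g] by simp

lemma C_k_on_UNIV_inverse:
  fixes f :: "'a::euclidean_space \<Rightarrow> real"
  assumes f: "C_k_on k UNIV f" and nz: "\<And>x. f x \<noteq> 0"
  shows "C_k_on k UNIV (\<lambda>x. inverse (f x))"
  using f
proof (induction k)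
  case 0
  then show ?case using nz by (auto intro: continuous_on_inverse)
next
  case (Suc k)
  note f = C_k_on_UNIV_SucD[OF Suc.prems]
  have inv: "C_k_on k UNIV (\<lambda>x. inverse (f x))"
    by (rule Suc.IH[OF C_k_on_UNIV_Suc_imp[OF Suc.prems]])
  show ?case
    by (rule C_k_on_UNIV_SucI[OF Deriv.has_derivative_inverse[OF nz f(1)]])
      (intro C_k_on_UNIV_uminus C_k_on_UNIV_mult inv f)
qed

section \<open>Stereographic projection from either pole\<close>

text \<open>Inverse of the projection from the pole \<open>\<sigma> *\<^sub>R axis 3 1\<close>,
  where \<sigma> will be 1 or -1; the origin goes to the opposite pole. Only sums, products,
  negation and one inverse occur, so that the closure rules for \<open>C_k_on\<close> apply
  literally.\<close>

definition stereo :: "real \<Rightarrow> real^2 \<Rightarrow> real^3" where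
  "stereo \<sigma> y = (2 * inverse (1 + (y$1 * y$1 + y$2 * y$2))) *\<^sub>R (y$1 *\<^sub>R axis 1 1 + y$2 *\<^sub>R axis 2 1)
     + (\<sigma> * (1 + - (2 * inverse (1 + (y$1 * y$1 + y$2 * y$2))))) *\<^sub>R axis 3 1"

definition stereo_inv :: "real \<Rightarrow> real^3 \<Rightarrow> real^2" where
  "stereo_inv \<sigma> x = inverse (1 - \<sigma> * x$3) *\<^sub>R (x$1 *\<^sub>R axis 1 1 + x$2 *\<^sub>R axis 2 1)"

lemma stereo_denom_pos: "0 < 1 + (a * a + b * (b::real))"
  by (simp add: add_pos_nonneg)

lemma stereo_nth:
  "stereo \<sigma> y $ 1 = 2 * y$1 / (1 + (y$1 * y$1 + y$2 * y$2))"
  "stereo \<sigma> y $ 2 = 2 * y$2 / (1 + (y$1 * y$1 + y$2 * y$2))"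
  "stereo \<sigma> y $ 3 = \<sigma> * (y$1 * y$1 + y$2 * y$2 - 1) / (1 + (y$1 * y$1 + y$2 * y$2))"
  using stereo_denom_pos[of "y$1" "y$2"]
  by (auto simp: stereo_def axis_def field_simps)

lemma stereo_inv_nth:
  "stereo_inv \<sigma> x $ 1 = x$1 / (1 - \<sigma> * x$3)" "stereo_inv \<sigma> x $ 2 = x$2 / (1 - \<sigma> * x$3)"
  by (auto simp: stereo_inv_def axis_def field_simps)

lemma S2_iff: "x \<in> S2 \<longleftrightarrow> x$1 * x$1 + x$2 * x$2 + x$3 * x$3 = 1"
  by (simp add: norm_eq_1 inner_vec_def sum_3)

lemma smooth_stereo: "smooth_on UNIV (stereo \<sigma>)"
  unfolding smooth_on_def
proof
  fix k
  have nz: "1 + (y$1 * y$1 + y$2 * y$2) \<noteq> 0" for y :: "real^2"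
    using stereo_denom_pos[of "y$1" "y$2"] by simp
  show "C_k_on k UNIV (stereo \<sigma>)"
    unfolding stereo_def[abs_def]
    by (intro C_k_on_UNIV_add C_k_on_UNIV_scaleR C_k_on_UNIV_mult C_k_on_UNIV_uminus C_k_on_UNIV_inverse
        C_k_on_UNIV_const nz C_k_on_UNIV_linear[OF bounded_linear_vec_nth])
qed

context
  fixes \<sigma> :: real
  assumes \<sigma>: "\<sigma> * \<sigma> = 1"
begin

lemma stereo_in_S2: "stereo \<sigma> y \<in> S2" and stereo_neq_pole: "\<sigma> * stereo \<sigma> y $ 3 < 1"
proof -
  define r where "r = y$1 * y$1 + y$2 * y$2"
  have r: "0 < 1 + r" unfolding r_def by (rule stereo_denom_pos)
  have 1: "(2 * y$1 / (1 + r)) * (2 * y$1 / (1 + r)) + (2 * y$2 / (1 + r)) * (2 * y$2 / (1 + r)) = 4 * r / (1 + r)\<^sup>2"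
    using r by (simp add: power2_eq_square flip: add_divide_distrib) (simp add: r_def)
  have 2: "(\<sigma> * (r - 1) / (1 + r)) * (\<sigma> * (r - 1) / (1 + r)) = (\<sigma> * \<sigma>) * (r - 1)\<^sup>2 / (1 + r)\<^sup>2"
    by (simp add: power2_eq_square)
  have 3: "4 * r / (1 + r)\<^sup>2 + (r - 1)\<^sup>2 / (1 + r)\<^sup>2 = 1"
    using r by (simp add: power2_eq_square divide_simps) (simp add: algebra_simps)
  show "stereo \<sigma> y \<in> S2"
    unfolding S2_iff stereo_nth r_def[symmetric] by (simp only: 1 2 3 \<sigma> mult_1)
  have "\<sigma> * (\<sigma> * (r - 1) / (1 + r)) = (\<sigma> * \<sigma>) * (r - 1) / (1 + r)" by simp
  also have "\<dots> < 1" using r by (simp add: \<sigma>)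
  finally show "\<sigma> * stereo \<sigma> y $ 3 < 1" by (simp add: stereo_nth flip: r_def)
qed

lemma stereo_inv_stereo: "stereo_inv \<sigma> (stereo \<sigma> y) = y"
proof -
  define r where "r = y$1 * y$1 + y$2 * y$2"
  have r: "0 < 1 + r" unfolding r_def by (rule stereo_denom_pos)
  have "1 - \<sigma> * stereo \<sigma> y $ 3 = 1 - (\<sigma> * \<sigma>) * (r - 1) / (1 + r)" by (simp add: stereo_nth r_def)
  also have "\<dots> = 2 / (1 + r)" using r by (simp add: \<sigma> field_simps)
  finally show ?thesis
    using r by (simp add: vec_eq_iff forall_2 stereo_inv_nth) (simp add: stereo_nth flip: r_def)
qed

lemma stereo_stereo_inv:
  assumes x: "x \<in> S2" "\<sigma> * x$3 \<noteq> 1"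
  shows "stereo \<sigma> (stereo_inv \<sigma> x) = x"
proof -
  define y where "y = stereo_inv \<sigma> x"
  define d where "d = 1 - \<sigma> * x$3"
  have d: "d \<noteq> 0" using x by (simp add: d_def)
  have sx3: "\<sigma> * x$3 = 1 - d" "x$3 = \<sigma> * (1 - d)" using \<sigma> by (simp_all add: d_def algebra_simps flip: mult.assoc)
  have x3: "x$3 * x$3 = (1 - d) * (1 - d)"
  proof -
    have "x$3 * x$3 = (\<sigma> * \<sigma>) * ((1 - d) * (1 - d))" unfolding sx3(2) by (simp only: mult_ac)
    then show ?thesis by (simp add: \<sigma>)
  qed
  have y: "y$1 = x$1 / d" "y$2 = x$2 / d" by (simp_all add: y_def stereo_inv_nth d_def)
  have "y$1 * y$1 + y$2 * y$2 = (x$1 * x$1 + x$2 * x$2) / (d * d)"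
    by (simp add: y add_divide_distrib)
  also have "x$1 * x$1 + x$2 * x$2 = d * (2 - d)"
  proof -
    have "x$1 * x$1 + x$2 * x$2 + x$3 * x$3 = 1" using x(1) by (simp only: S2_iff)
    then have "x$1 * x$1 + x$2 * x$2 = 1 - (1 - d) * (1 - d)" using x3 by linarith
    then show ?thesis by (simp add: algebra_simps)
  qed
  finally have r: "y$1 * y$1 + y$2 * y$2 = (2 - d) / d" using d by simp
  have r1: "1 + (2 - d) / d = 2 / d" "(2 - d) / d - 1 = 2 * (1 - d) / d" using d by (simp_all add: field_simps)
  show ?thesis
    unfolding y_def[symmetric] vec_eq_iff forall_3 stereo_nth r r1
    using d by (simp add: y sx3(2))
qed

lemma range_stereo: "range (stereo \<sigma>) = {x \<in> S2. \<sigma> * x$3 \<noteq> 1}"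
proof (intro equalityI subsetI)
  fix x assume "x \<in> {x \<in> S2. \<sigma> * x$3 \<noteq> 1}"
  then show "x \<in> range (stereo \<sigma>)" using stereo_stereo_inv by (metis (mono_tags, lifting) mem_Collect_eq rangeI)
next
  fix x assume "x \<in> range (stereo \<sigma>)"
  then obtain y where "x = stereo \<sigma> y" by blast
  then show "x \<in> {x \<in> S2. \<sigma> * x$3 \<noteq> 1}"
    using stereo_in_S2[of y] stereo_neq_pole[of y] by simp
qed

lemma local_param_stereo: "local_param UNIV (stereo \<sigma>)"
  unfolding local_param_def
proof (intro conjI ballI)
  show "stereo \<sigma> ` UNIV \<subseteq> S2" using stereo_in_S2 by auto
  have "open {x::real^3. \<sigma> * x$3 \<noteq> 1}"
    by (intro open_Collect_neq continuous_intros)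
  moreover have "range (stereo \<sigma>) = S2 \<inter> {x. \<sigma> * x$3 \<noteq> 1}" unfolding range_stereo by auto
  ultimately show "openin (top_of_set S2) (range (stereo \<sigma>))"
    by (auto simp: openin_open)
  have inv: "inv_into UNIV (stereo \<sigma>) x = stereo_inv \<sigma> x" if "x \<in> range (stereo \<sigma>)" for x
    using that stereo_inv_stereo by (metis f_inv_into_f)
  have nz: "1 - \<sigma> * stereo \<sigma> y $ 3 \<noteq> 0" for y using stereo_neq_pole[of y] by simp
  have "continuous_on (range (stereo \<sigma>)) (stereo_inv \<sigma>)"
    unfolding stereo_inv_def[abs_def] using nz by (intro continuous_intros) auto
  then have cinv: "continuous_on (range (stereo \<sigma>)) (inv_into UNIV (stereo \<sigma>))"
    by (rule continuous_on_eq) (simp add: inv)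
  have "C_k_on 0 UNIV (stereo \<sigma>)" using smooth_stereo smooth_on_def by blast
  then have "continuous_on UNIV (stereo \<sigma>)" by simp
  moreover have "inj (stereo \<sigma>)" using stereo_inv_stereo by (metis injI)
  ultimately show "homeomorphism UNIV (range (stereo \<sigma>)) (stereo \<sigma>) (inv_into UNIV (stereo \<sigma>))"
    using cinv by (auto simp: homeomorphism_def f_inv_into_f)
  fix y :: "real^2"
  have "C_k_on (Suc 0) UNIV (stereo \<sigma>)" using smooth_stereo smooth_on_def by blast
  then have D: "(stereo \<sigma> has_derivative frechet_derivative (stereo \<sigma>) (at y)) (at y)"
    by (rule C_k_on_UNIV_SucD)
  \<comment> \<open>The formula for the left inverse is differentiable in the ambient space near
    this point, so the chain rule makes the differential of \<open>stereo\<close> left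
    invertible.\<close>
  have "stereo_inv \<sigma> differentiable at (stereo \<sigma> y)"
    unfolding stereo_inv_def[abs_def] using nz[of y]
    by (intro derivative_intros bounded_linear_imp_differentiable bounded_linear_vec_nth) auto
  then obtain D' where D': "(stereo_inv \<sigma> has_derivative D') (at (stereo \<sigma> y))"
    by (auto simp: differentiable_def)
  have "(stereo_inv \<sigma> \<circ> stereo \<sigma> has_derivative D' \<circ> frechet_derivative (stereo \<sigma>) (at y)) (at y)"
    using D D' by (rule diff_chain_at)
  moreover have "stereo_inv \<sigma> \<circ> stereo \<sigma> = id" by (auto simp: stereo_inv_stereo)
  ultimately have "D' \<circ> frechet_derivative (stereo \<sigma>) (at y) = id"
    using has_derivative_unique has_derivative_id by metis
  then show "inj (frechet_derivative (stereo \<sigma>) (at y))"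
    by (metis inj_on_id inj_on_imageI2)
qed (use smooth_stereo in auto)

end

text \<open>Integral curves are constrained only through charts, so every point must lie in one; the
  pole to project from is chosen different from \<open>x\<close>.\<close>

lemma local_param_exists:
  assumes "x \<in> S2"
  obtains U \<psi> where "local_param U \<psi>" "x \<in> \<psi> ` U"
proof -
  obtain \<sigma> :: real where \<sigma>: "\<sigma> * \<sigma> = 1" "\<sigma> * x$3 \<noteq> 1"
    by (cases "x$3 = 1") (use that[of 1] that[of "-1"] in auto)
  show thesis
    using that[OF local_param_stereo[OF \<sigma>(1)]] range_stereo[OF \<sigma>(1)] assms \<sigma>(2) by auto
qed


section \<open>The profile of the potential\<close>

text \<open>
  In the stereographic chart centred at a pole the potential is an even \<open>C\<^sup>2\<close> function \<open>h\<close> of the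
  radius \<open>r\<close>, so \<open>h' r / r\<close> has a limit; the height being a function of \<open>r\<^sup>2\<close>, this quotient is the
  derivative of the profile up to a smooth factor.
\<close>

lemma profile_derivative_at_pole:
  fixes f fp :: "real \<Rightarrow> real" and V :: "real^3 \<Rightarrow> real"
  assumes V: "smooth_on_S2 V" and Vf: "\<And>x. x \<in> S2 \<Longrightarrow> V x = f (x$3)"
    and fp: "\<And>z. z \<in> {-1<..<1} \<Longrightarrow> (f has_real_derivative fp z) (at z)"
    and \<sigma>: "\<sigma> = 1 \<or> \<sigma> = -1"
  obtains l where "((\<lambda>s. fp (\<sigma> * (s - 1))) \<longlongrightarrow> l) (at_right 0)"
proof -
  have \<sigma>2: "\<sigma> * \<sigma> = 1" using \<sigma> by auto
  define H where "H = V \<circ> stereo \<sigma>"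
  define e :: "real^2" where "e = axis 1 1"
  define h where "h r = H (r *\<^sub>R e)" for r
  define H1 where "H1 y = frechet_derivative H (at y) e" for y
  define h1 where "h1 r = H1 (r *\<^sub>R e)" for r
  have "smooth_on UNIV H"
    using V local_param_stereo[OF \<sigma>2] by (auto simp: smooth_on_S2_def H_def)
  then have C2: "C_k_on (Suc (Suc 0)) UNIV H" by (simp add: smooth_on_def del: C_k_on.simps)
  have line: "((\<lambda>r. r *\<^sub>R e) has_derivative (\<lambda>r. r *\<^sub>R e)) (at r)" for r
    by (auto intro!: derivative_eq_intros)
  have h1: "(h has_real_derivative h1 r) (at r)" for r
  proof -
    have D: "(H has_derivative frechet_derivative H (at (r *\<^sub>R e))) (at (r *\<^sub>R e))"
      by (rule C_k_on_UNIV_SucD[OF C2])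
    have "((\<lambda>r. H (r *\<^sub>R e)) has_derivative (\<lambda>t. frechet_derivative H (at (r *\<^sub>R e)) (t *\<^sub>R e))) (at r)"
      using diff_chain_at[OF line D] by (simp add: o_def)
    moreover have "frechet_derivative H (at (r *\<^sub>R e)) (t *\<^sub>R e) = h1 r * t" for t
      using linear_scale[OF has_derivative_linear[OF D]] by (simp add: h1_def H1_def)
    ultimately show ?thesis by (simp add: has_field_derivative_def h_def[abs_def])
  qed
  have "C_k_on (Suc 0) UNIV H1" unfolding H1_def by (rule C_k_on_UNIV_SucD[OF C2])
  then have D1: "(H1 has_derivative frechet_derivative H1 (at (0 *\<^sub>R e))) (at (0 *\<^sub>R e))"
    by (rule C_k_on_UNIV_SucD)
  then have "((\<lambda>r. H1 (r *\<^sub>R e)) has_derivative (\<lambda>t. frechet_derivative H1 (at (0 *\<^sub>R e)) (t *\<^sub>R e))) (at 0)"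
    using diff_chain_at[OF line D1] by (simp add: o_def)
  moreover define h2 where "h2 = frechet_derivative H1 (at (0 *\<^sub>R e)) e"
  moreover have "frechet_derivative H1 (at (0 *\<^sub>R e)) (t *\<^sub>R e) = h2 * t" for t
    using linear_scale[OF has_derivative_linear[OF D1], of t e] by (simp add: h2_def)
  ultimately have h2: "(h1 has_real_derivative h2) (at 0)"
    by (simp add: has_field_derivative_def h1_def[abs_def])
  define z where "z r = \<sigma> * (r * r - 1) / (1 + r * r)" for r
  have hz: "h r = f (z r)" for r
    using Vf[OF stereo_in_S2[OF \<sigma>2]] by (simp add: h_def H_def stereo_nth e_def axis_def z_def)
  \<comment> \<open>Evenness of \<open>h\<close> forces \<open>h1 0 = 0\<close>, so
    \<open>h1 r / r\<close> is a difference quotient of \<open>h1\<close> at 0.\<close>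
  have "(h has_real_derivative - h1 0) (at 0)"
  proof -
    have "((\<lambda>r. h (- r)) has_real_derivative h1 0 * - 1) (at 0)"
      by (rule DERIV_chain2[of h]) (use h1[of 0] in \<open>auto intro!: derivative_eq_intros\<close>)
    moreover have "h (- r) = h r" for r unfolding hz z_def by simp
    ultimately show ?thesis by simp
  qed
  from DERIV_unique[OF h1[of 0] this] have "h1 0 = 0" by simp
  then have lim: "((\<lambda>r. h1 r / r) \<longlongrightarrow> h2) (at 0)"
    using h2 by (simp add: DERIV_def)
  have fpz: "fp (z r) = \<sigma> * (h1 r / r) * (1 + r * r)\<^sup>2 / 4" if r: "0 < r" for r
  proof -
    have pos: "0 < 1 + r * r" by (simp add: add_pos_nonneg)
    have "\<sigma> * z r = (\<sigma> * \<sigma>) * (r * r - 1) / (1 + r * r)" by (simp add: z_def)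
    then have sz: "\<sigma> * z r = (r * r - 1) / (1 + r * r)" by (simp add: \<sigma>2)
    have "\<bar>z r\<bar> = \<bar>\<sigma> * z r\<bar>" using \<sigma> by auto
    also have "\<dots> = \<bar>(r * r - 1) / (1 + r * r)\<bar>" by (simp only: sz)
    also have "\<dots> < 1" using pos r by (simp add: abs_less_iff divide_simps)
    finally have zr: "z r \<in> {-1<..<1}" by (auto simp: abs_less_iff)
    have "(z has_real_derivative \<sigma> * (4 * r) / (1 + r * r)\<^sup>2) (at r)"
      unfolding z_def[abs_def] using pos
      by (auto intro!: derivative_eq_intros simp: divide_simps power2_eq_square) (simp add: algebra_simps)
    then have "((\<lambda>r. f (z r)) has_real_derivative fp (z r) * (\<sigma> * (4 * r) / (1 + r * r)\<^sup>2)) (at r)"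
      by (rule DERIV_chain2[of f _ z, OF fp[OF zr]])
    then have "fp (z r) * (\<sigma> * (4 * r) / (1 + r * r)\<^sup>2) = h1 r"
      using DERIV_unique[OF h1[of r]] by (simp add: hz[abs_def])
    then have "\<sigma> * (h1 r / r) * (1 + r * r)\<^sup>2 / 4 = (\<sigma> * \<sigma>) * fp (z r)"
      using pos r by (simp add: field_simps)
    then show ?thesis by (simp add: \<sigma>2)
  qed
  \<comment> \<open>\<open>s\<close> is the vertical distance to the pole at the centre of the
    chart; solving \<open>s = 2 * r\<^sup>2 / (1 + r\<^sup>2)\<close> for the radius gives this
    formula.\<close>
  define \<rho> where "\<rho> s = sqrt (s / (2 - s))" for s :: real
  have small: "\<forall>\<^sub>F s in at_right (0::real). 0 < s \<and> s < 2"
    using eventually_at_right_less[of 0] eventually_at_right_field[of "\<lambda>s. s < (2::real)" 0]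
    by (auto simp: eventually_conj_iff intro!: exI[of _ 1])
  have \<rho>: "0 < \<rho> s" "z (\<rho> s) = \<sigma> * (s - 1)" if s: "0 < s" "s < 2" for s
  proof -
    show "0 < \<rho> s" using s by (simp add: \<rho>_def)
    have "\<rho> s * \<rho> s = s / (2 - s)" using s by (simp add: \<rho>_def)
    moreover have "s / (2 - s) - 1 = (s - 1) * (2 / (2 - s))" "1 + s / (2 - s) = 2 / (2 - s)"
      using s by (simp_all add: field_simps)
    ultimately show "z (\<rho> s) = \<sigma> * (s - 1)" using s by (simp add: z_def)
  qed
  have "(\<rho> \<longlongrightarrow> sqrt (0 / (2 - 0))) (at_right 0)"
    unfolding \<rho>_def by (intro tendsto_intros) auto
  then have \<rho>0: "(\<rho> \<longlongrightarrow> 0) (at_right 0)" by simp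
  with small have "filterlim \<rho> (at 0) (at_right 0)"
    by (auto simp: filterlim_at elim!: eventually_mono dest: \<rho>(1))
  then have "((\<lambda>s. \<sigma> * (h1 (\<rho> s) / \<rho> s) * (1 + \<rho> s * \<rho> s)\<^sup>2 / 4) \<longlongrightarrow> \<sigma> * h2 * (1 + 0 * 0)\<^sup>2 / 4) (at_right 0)"
    by (intro tendsto_intros filterlim_compose[OF lim] \<rho>0) auto
  moreover have "\<forall>\<^sub>F s in at_right 0. \<sigma> * (h1 (\<rho> s) / \<rho> s) * (1 + \<rho> s * \<rho> s)\<^sup>2 / 4 = fp (\<sigma> * (s - 1))"
    using small by eventually_elim (use fpz \<rho> in metis)
  ultimately show thesis by (blast intro: that Lim_transform_eventually)
qed

text \<open>Energy is differentiated along trajectories that may cross a pole, so a two-sided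
  derivative is needed at heights 1 and -1, although \<open>V\<close> prescribes the profile on
  \<open>{-1..1}\<close> only. Hence \<open>F\<close> is rebuilt as an antiderivative of a
  continuous extension \<open>g\<close> of the derivative.\<close>

lemma potential_profile:
  fixes \<V> :: "real \<Rightarrow> real" and V :: "real^3 \<Rightarrow> real"
  assumes V_smooth_interval: "smooth_on {0..pi\<^sup>2} \<V>"
    and V_range: "\<V> ` {0..pi\<^sup>2} \<subseteq> {0<..1}"
    and V_increasing: "strict_mono_on {0..pi\<^sup>2} \<V>"
    and V_no_critical: "\<And>s. s \<in> {0<..<pi\<^sup>2} \<Longrightarrow> deriv \<V> s \<noteq> 0"
    and V_eq: "\<And>x. x \<in> S2 \<Longrightarrow> V x = \<V> ((dist_S2 x south_pole)\<^sup>2)"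
    and V_smooth: "smooth_on_S2 V"
  obtains F g :: "real \<Rightarrow> real" where "continuous_on UNIV g"
    "\<And>z. z \<in> {-1..1} \<Longrightarrow> (F has_real_derivative g z) (at z)"
    "\<And>x. x \<in> S2 \<Longrightarrow> V x = F (x$3)"
    "\<And>z. z \<in> {-1<..<1} \<Longrightarrow> 0 < g z"
    "\<And>z. z \<in> {-1..1} \<Longrightarrow> 0 < F z"
proof -
  let ?I = "{0..pi\<^sup>2}"
  have C1: "C_k_on (Suc 0) ?I \<V>" using V_smooth_interval unfolding smooth_on_def by blast
  then have diff: "\<V> differentiable_on ?I"
    and cont': "continuous_on ?I (\<lambda>s. frechet_derivative \<V> (at s within ?I) 1)" by auto
  have deriv: "(\<V> has_real_derivative deriv \<V> s) (at s)"
    and deriv_eq: "frechet_derivative \<V> (at s within ?I) 1 = deriv \<V> s" if s: "s \<in> {0<..<pi\<^sup>2}" for s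
  proof -
    have w: "at s within ?I = at s" using s by (intro at_within_interior) auto
    have "\<V> differentiable at s within ?I" using diff s by (auto simp: differentiable_on_def)
    then have "\<V> differentiable at s" by (simp only: w)
    then obtain d where d: "(\<V> has_real_derivative d) (at s)" by (auto simp: real_differentiable_def)
    then show D: "(\<V> has_real_derivative deriv \<V> s) (at s)" by (simp add: DERIV_imp_deriv)
    then have "frechet_derivative \<V> (at s) = (*) (deriv \<V> s)"
      unfolding has_field_derivative_def by (metis frechet_derivative_at)
    then show "frechet_derivative \<V> (at s within ?I) 1 = deriv \<V> s" by (simp add: w)
  qed
  \<comment> \<open>Monotonicity gives the weak sign, the absence of critical points the strict one.
    A zero would be a latitude where the force vanishes.\<close>
  have deriv_pos: "0 < deriv \<V> s" if s: "s \<in> {0<..<pi\<^sup>2}" for s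
  proof -
    have "0 \<le> deriv \<V> s"
      using mono_on_imp_deriv_nonneg[OF strict_mono_on_imp_mono_on[OF V_increasing] deriv[OF s]] s by auto
    then show ?thesis using V_no_critical[OF s] by simp
  qed
  have cont_deriv: "continuous_on {0<..<pi\<^sup>2} (deriv \<V>)"
    by (rule continuous_on_eq[OF continuous_on_subset[OF cont']]) (auto simp: deriv_eq)
  define \<theta> where "\<theta> z = arcsin z + pi / 2" for z
  have \<theta>: "\<theta> z \<in> {0<..<pi}" if "z \<in> {-1<..<1}" for z
    using that arcsin_lt_bounded[of z] by (auto simp: \<theta>_def)
  have \<theta>': "(\<theta> z)\<^sup>2 \<in> {0<..<pi\<^sup>2}" if "z \<in> {-1<..<1}" for z
    using \<theta>[OF that] by (auto intro: power_strict_mono)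
  have \<theta>c: "(\<theta> z)\<^sup>2 \<in> ?I" if "z \<in> {-1..1}" for z
    using that arcsin_bounded[of z] by (auto simp: \<theta>_def intro!: power_mono)
  define f where "f z = \<V> ((\<theta> z)\<^sup>2)" for z
  define fp where "fp z = deriv \<V> ((\<theta> z)\<^sup>2) * (2 * \<theta> z * inverse (sqrt (1 - z\<^sup>2)))" for z
  have Vf: "V x = f (x$3)" if "x \<in> S2" for x
    using V_eq[OF that] dist_S2_south_pole[OF that] by (simp add: f_def \<theta>_def)
  have sq: "0 < 1 - z\<^sup>2" if "z \<in> {-1<..<1}" for z :: real
    using that by (simp add: abs_square_less_1 abs_less_iff)
  have fp: "(f has_real_derivative fp z) (at z)" if z: "z \<in> {-1<..<1}" for z
  proof -
    have "(\<theta> has_real_derivative inverse (sqrt (1 - z\<^sup>2))) (at z)"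
      unfolding \<theta>_def[abs_def] using DERIV_arcsin[of z] z by (auto intro!: derivative_eq_intros)
    from DERIV_power[OF this, of 2] have "((\<lambda>z. (\<theta> z)\<^sup>2) has_real_derivative 2 * \<theta> z * inverse (sqrt (1 - z\<^sup>2))) (at z)"
      by (simp add: mult_ac)
    then show ?thesis unfolding f_def[abs_def] fp_def
      by (rule DERIV_chain2[of \<V> _ "\<lambda>z. (\<theta> z)\<^sup>2", OF deriv[OF \<theta>'[OF z]]])
  qed
  have fp_pos: "0 < fp z" if "z \<in> {-1<..<1}" for z
    using deriv_pos[OF \<theta>'[OF that]] \<theta>[OF that] sq[OF that] by (simp add: fp_def)
  have \<theta>_cont: "continuous_on {-1..1} \<theta>" unfolding \<theta>_def by (intro continuous_intros) auto
  have fp_cont: "continuous_on {-1<..<1} fp"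
    unfolding fp_def
  proof (intro continuous_intros)
    show "continuous_on {-1<..<1} \<theta>" by (rule continuous_on_subset[OF \<theta>_cont]) auto
    then show "continuous_on {-1<..<1} (\<lambda>z. deriv \<V> ((\<theta> z)\<^sup>2))"
      using \<theta>' by (intro continuous_on_compose2[OF cont_deriv] continuous_intros) auto
  qed (use sq in force)
  have f_cont: "continuous_on {-1..1} f"
    unfolding f_def using \<theta>c
    by (intro continuous_on_compose2[OF differentiable_imp_continuous_on[OF diff]] continuous_intros \<theta>_cont) auto
  obtain l where l: "((\<lambda>s. fp (1 * (s - 1))) \<longlongrightarrow> l) (at_right 0)"
    using profile_derivative_at_pole[OF V_smooth Vf fp, of 1] by auto
  obtain l' where l': "((\<lambda>s. fp (-1 * (s - 1))) \<longlongrightarrow> l') (at_right 0)"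
    using profile_derivative_at_pole[OF V_smooth Vf fp, of "-1"] by auto
  \<comment> \<open>The endpoint values are the limits found in the two charts: \<sigma> = 1 is
    centred at the south pole, \<sigma> = -1 at the north pole.\<close>
  define g0 where "g0 z = (if z = -1 then l else if z = 1 then l' else fp z)" for z
  have g0: "g0 z = fp z" if "z \<in> {-1<..<1}" for z using that by (auto simp: g0_def)
  have g0_cont: "continuous_on {-1..1} g0"
  proof (rule continuous_on_IccI)
    have "(fp \<longlongrightarrow> l) (at_right (-1))"
      using l by (simp add: filterlim_at_right_to_0[of fp])
    moreover have "\<forall>\<^sub>F z in at_right (-1). fp z = g0 z"
      unfolding eventually_at_right_field by (intro exI[of _ 1]) (auto simp: g0_def)
    ultimately show "(g0 \<longlongrightarrow> g0 (-1)) (at_right (-1))"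
      by (auto dest: Lim_transform_eventually simp: g0_def[of "-1"])
    have "(fp \<longlongrightarrow> l') (at_left 1)"
      using l' by (simp add: filterlim_at_left_to_right filterlim_at_right_to_0[of "\<lambda>x. fp (- x)"])
    moreover have "\<forall>\<^sub>F z in at_left 1. fp z = g0 z"
      unfolding eventually_at_left_field by (intro exI[of _ "-1"]) (auto simp: g0_def)
    ultimately show "(g0 \<longlongrightarrow> g0 1) (at_left 1)"
      by (auto dest: Lim_transform_eventually simp: g0_def[of 1])
    show "g0 \<midarrow>z\<rightarrow> g0 z" if z: "-1 < z" "z < 1" for z
    proof -
      have "continuous_on {-1<..<1} g0" by (rule continuous_on_eq[OF fp_cont]) (simp add: g0)
      then show ?thesis using z by (simp add: continuous_on_eq_continuous_at isCont_def)
    qed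
  qed simp
  define g where "g z = g0 (max (-1) (min 1 z))" for z
  have g: "g z = g0 z" if "z \<in> {-1..1}" for z
  proof -
    have "max (-1) (min 1 z) = z" using that by auto
    then show ?thesis by (simp add: g_def)
  qed
  have g_cont: "continuous_on UNIV g"
    unfolding g_def by (intro continuous_on_compose2[OF g0_cont] continuous_intros) auto
  obtain F0 where F0: "\<And>z. z \<in> {-2..2} \<Longrightarrow> (F0 has_vector_derivative g z) (at z within {-2..2})"
    using antiderivative_continuous[OF continuous_on_subset[OF g_cont]] by (metis subset_UNIV)
  define F where "F z = F0 z + (f (-1) - F0 (-1))" for z
  have F: "(F has_real_derivative g z) (at z)" if "z \<in> {-1..1}" for z
  proof -
    have "at z within {-2..2} = at z" using that by (intro at_within_interior) auto
    then have "(F0 has_real_derivative g z) (at z)"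
      using F0[of z] that by (simp add: has_real_derivative_iff_has_vector_derivative)
    then show ?thesis unfolding F_def[abs_def] by (auto intro!: derivative_eq_intros)
  qed
  have Ff: "F z = f z" if z: "z \<in> {-1..1}" for z
  proof -
    have "continuous_on {-1..1} F"
      using F by (meson DERIV_isCont continuous_at_imp_continuous_on)
    then have "continuous_on {-1..1} (\<lambda>z. F z - f z)" using f_cont by (rule continuous_on_diff)
    moreover have "((\<lambda>z. F z - f z) has_real_derivative 0) (at x)" if "-1 < x" "x < 1" for x
    proof -
      have "g x = fp x" using that g[of x] g0[of x] by simp
      then show ?thesis using DERIV_diff[OF F[of x] fp[of x]] that by simp
    qed
    ultimately have "F z - f z = F (-1) - f (-1)"
      using z DERIV_isconst2[of "-1" 1 "\<lambda>z. F z - f z" z] by simp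
    then show ?thesis by (simp add: F_def)
  qed
  show thesis
  proof (rule that[OF g_cont F])
    show "V x = F (x$3)" if "x \<in> S2" for x
    proof -
      have "\<bar>x$3\<bar> \<le> 1" using that component_le_norm_cart[of x 3] by simp
      then show ?thesis using Vf[OF that] Ff[of "x$3"] by (simp add: abs_le_iff)
    qed
    show "0 < g z" if "z \<in> {-1<..<1}" for z using that g[of z] g0[of z] fp_pos[of z] by auto
    show "0 < F z" if "z \<in> {-1..1}" for z
      using Ff[OF that] V_range \<theta>c[OF that] by (auto simp: f_def image_subset_iff)
  qed auto
qed


section \<open>Hamilton's equations in the ambient space\<close>

lemma has_real_derivative_along_line:
  assumes "(f has_derivative f') (at (p + s *\<^sub>R v))"
  shows "((\<lambda>s. f (p + s *\<^sub>R v) :: real) has_real_derivative f' v) (at s)"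
proof -
  have "((\<lambda>s. p + s *\<^sub>R v) has_derivative (\<lambda>h. h *\<^sub>R v)) (at s)"
    by (auto intro!: derivative_eq_intros)
  from diff_chain_at[OF this assms] have "((\<lambda>s. f (p + s *\<^sub>R v)) has_derivative (\<lambda>h. f' (h *\<^sub>R v))) (at s)"
    by (simp add: o_def)
  moreover have "(\<lambda>h. f' (h *\<^sub>R v)) = (*) (f' v)"
    using linear_scale[OF has_derivative_linear[OF assms]] by (auto simp: mult.commute)
  ultimately show ?thesis by (simp add: has_field_derivative_def)
qed

text \<open>The mean value theorem is used twice: along \<open>v\<close> for the increment of
  \<open>f\<close> by \<open>h *\<^sub>R w\<close>, then along \<open>w\<close> for the derivative
  in direction \<open>v\<close>.\<close>

lemma second_difference_mean_value:
  fixes f :: "'a::real_normed_vector \<Rightarrow> real"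
  assumes h: "0 < h" and U: "\<And>s t. s \<in> {0..h} \<Longrightarrow> t \<in> {0..h} \<Longrightarrow> y + s *\<^sub>R v + t *\<^sub>R w \<in> U"
    and f': "\<And>x. x \<in> U \<Longrightarrow> (f has_derivative f' x) (at x)"
    and f'': "\<And>x. x \<in> U \<Longrightarrow> ((\<lambda>x. f' x v) has_derivative f'' x) (at x)"
  obtains s t where "s \<in> {0<..<h}" "t \<in> {0<..<h}"
    "f (y + h *\<^sub>R v + h *\<^sub>R w) - f (y + h *\<^sub>R v) - f (y + h *\<^sub>R w) + f y = h * h * f'' (y + s *\<^sub>R v + t *\<^sub>R w) w"
proof -
  have "((\<lambda>s. f (y + s *\<^sub>R v + h *\<^sub>R w) - f (y + s *\<^sub>R v)) has_real_derivative
      f' (y + s *\<^sub>R v + h *\<^sub>R w) v - f' (y + s *\<^sub>R v) v) (at s)" if "0 \<le> s" "s \<le> h" for s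
    using has_real_derivative_along_line[of f _ "y + h *\<^sub>R w" s v] f'[of "y + s *\<^sub>R v + h *\<^sub>R w"] U[of s h] that h
      has_real_derivative_along_line[of f _ y s v] f'[of "y + s *\<^sub>R v"] U[of s 0]
    by (intro DERIV_diff) (auto simp: algebra_simps)
  from MVT2[OF h this] obtain s where s: "0 < s" "s < h"
    "f (y + h *\<^sub>R v + h *\<^sub>R w) - f (y + h *\<^sub>R v) - (f (y + h *\<^sub>R w) - f y) =
      h * (f' (y + s *\<^sub>R v + h *\<^sub>R w) v - f' (y + s *\<^sub>R v) v)"
    by auto
  have "((\<lambda>t. f' (y + s *\<^sub>R v + t *\<^sub>R w) v) has_real_derivative f'' (y + s *\<^sub>R v + t *\<^sub>R w) w) (at t)"
    if "0 \<le> t" "t \<le> h" for t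
    using that s U[of s t] by (intro has_real_derivative_along_line f'') auto
  from MVT2[OF h this] obtain t where t: "0 < t" "t < h"
    "f' (y + s *\<^sub>R v + h *\<^sub>R w) v - f' (y + s *\<^sub>R v) v = h * f'' (y + s *\<^sub>R v + t *\<^sub>R w) w"
    by auto
  show thesis by (rule that[of s t]) (use s t in auto)
qed

text \<open>Schwarz's theorem: the second difference over a small parallelogram is symmetric in
  \<open>v\<close> and \<open>w\<close>, and taking the two mean values in either order expresses it
  by either mixed derivative at a nearby point.\<close>

lemma mixed_derivatives_symmetric:
  fixes f :: "'a::real_normed_vector \<Rightarrow> real"
  assumes U: "open U" "y \<in> U"
    and f': "\<And>x. x \<in> U \<Longrightarrow> (f has_derivative f' x) (at x)"
    and fv: "\<And>x. x \<in> U \<Longrightarrow> ((\<lambda>x. f' x v) has_derivative fv x) (at x)"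
    and fw: "\<And>x. x \<in> U \<Longrightarrow> ((\<lambda>x. f' x w) has_derivative fw x) (at x)"
    and cv: "continuous_on U (\<lambda>x. fv x w)" and cw: "continuous_on U (\<lambda>x. fw x v)"
  shows "fv y w = fw y v"
proof -
  have "\<bar>fv y w - fw y v\<bar> < e" if e: "0 < e" for e
  proof -
    have "isCont (\<lambda>x. fv x w) y" "isCont (\<lambda>x. fw x v) y"
      using cv cw U by (auto simp: continuous_on_eq_continuous_at)
    moreover have "\<forall>\<^sub>F x in nhds y. dist (u x) (u y) < e / 2" if "isCont u y" for u :: "'a \<Rightarrow> real"
      using that e unfolding eventually_nhds_metric continuous_at_eps_delta by (meson half_gt_zero)
    ultimately have "\<forall>\<^sub>F x in nhds y. dist (fv x w) (fv y w) < e / 2" "\<forall>\<^sub>F x in nhds y. dist (fw x v) (fw y v) < e / 2"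
      by blast+
    moreover have "\<forall>\<^sub>F x in nhds y. x \<in> U" using U by (rule eventually_nhds_in_open)
    ultimately have "\<forall>\<^sub>F x in nhds y. dist (fv x w) (fv y w) < e / 2 \<and> dist (fw x v) (fw y v) < e / 2 \<and> x \<in> U"
      by (intro eventually_conj)
    then obtain d where d: "0 < d" "\<And>x. dist x y < d \<Longrightarrow> dist (fv x w) (fv y w) < e / 2 \<and> dist (fw x v) (fw y v) < e / 2 \<and> x \<in> U"
      by (auto simp: eventually_nhds_metric)
    \<comment> \<open>Small enough for the parallelogram with sides \<open>h *\<^sub>R v\<close> and
      \<open>h *\<^sub>R w\<close> to stay within distance \<open>d\<close> of
      \<open>y\<close>.\<close>
    define h where "h = d / (norm v + norm w + 1)"
    have n: "0 < norm v + norm w + 1" by (simp add: add_nonneg_pos)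
    have h: "0 < h" using d n by (simp add: h_def)
    have near: "dist (y + s *\<^sub>R v + t *\<^sub>R w) y < d" if "s \<in> {0..h}" "t \<in> {0..h}" for s t
    proof -
      have "norm (s *\<^sub>R v + t *\<^sub>R w) \<le> s * norm v + t * norm w"
        using that norm_triangle_ineq[of "s *\<^sub>R v" "t *\<^sub>R w"] by auto
      also have "\<dots> \<le> h * norm v + h * norm w"
        using that by (intro add_mono mult_right_mono) auto
      also have "\<dots> < h * (norm v + norm w + 1)" using h by (simp add: algebra_simps)
      also have "\<dots> = d" using n by (simp add: h_def)
      finally show ?thesis by (simp add: dist_norm algebra_simps)
    qed
    obtain s t where st: "s \<in> {0<..<h}" "t \<in> {0<..<h}"
      "f (y + h *\<^sub>R v + h *\<^sub>R w) - f (y + h *\<^sub>R v) - f (y + h *\<^sub>R w) + f y = h * h * fv (y + s *\<^sub>R v + t *\<^sub>R w) w"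
      by (rule second_difference_mean_value[where U = U and y = y and v = v and w = w, OF h _ f' fv]) (use near d(2) in blast)+
    have near': "dist (y + s *\<^sub>R w + t *\<^sub>R v) y < d" if "s \<in> {0..h}" "t \<in> {0..h}" for s t
      using near[OF that(2,1)] by (simp add: algebra_simps)
    obtain s' t' where st': "s' \<in> {0<..<h}" "t' \<in> {0<..<h}"
      "f (y + h *\<^sub>R w + h *\<^sub>R v) - f (y + h *\<^sub>R w) - f (y + h *\<^sub>R v) + f y = h * h * fw (y + s' *\<^sub>R w + t' *\<^sub>R v) v"
      by (rule second_difference_mean_value[where U = U and y = y and v = w and w = v, OF h _ f' fw]) (use near' d(2) in blast)+
    have "y + h *\<^sub>R w + h *\<^sub>R v = y + h *\<^sub>R v + h *\<^sub>R w" by (simp add: algebra_simps)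
    then have "h * h * fv (y + s *\<^sub>R v + t *\<^sub>R w) w = h * h * fw (y + s' *\<^sub>R w + t' *\<^sub>R v) v"
      using st(3) st'(3) by (simp add: algebra_simps)
    then have "fv (y + s *\<^sub>R v + t *\<^sub>R w) w = fw (y + s' *\<^sub>R w + t' *\<^sub>R v) v"
      using h by simp
    moreover have "dist (fv (y + s *\<^sub>R v + t *\<^sub>R w) w) (fv y w) < e / 2"
      using d(2)[OF near[of s t]] st by auto
    moreover have "dist (fw (y + s' *\<^sub>R w + t' *\<^sub>R v) v) (fw y v) < e / 2"
      using d(2)[OF near'[of s' t']] st' by auto
    ultimately show ?thesis unfolding dist_real_def by linarith
  qed
  from this[of "\<bar>fv y w - fw y v\<bar>"] show ?thesis by auto
qed

text \<open>A chart comes with an inverse that is only continuous. Differentiability of the lifted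
  curve is recovered from the injective differential, which is bounded below: the error
  \<open>E\<close> of the lift is controlled by \<open>D E\<close>.\<close>

lemma lifted_curve_has_vector_derivative:
  fixes \<psi> :: "'a::euclidean_space \<Rightarrow> 'b::euclidean_space" and y :: "real \<Rightarrow> 'a"
  assumes D: "(\<psi> has_derivative D) (at (y t))" and inj: "inj D" and cont: "isCont y t"
    and x: "((\<lambda>s. \<psi> (y s)) has_vector_derivative D w) (at t)"
  shows "(y has_vector_derivative w) (at t)"
proof -
  have lin: "linear D" using D by (rule has_derivative_linear)
  obtain B where B: "0 < B" "\<And>h. B * norm h \<le> norm (D h)"
    using linear_inj_bounded_below_pos[OF lin inj] by (metis mult.commute)
  have "\<exists>d>0. \<forall>s. norm (s - t) < d \<longrightarrow> norm (y s - y t - (s - t) *\<^sub>R w) \<le> e * norm (s - t)" if e: "0 < e" for e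
  proof -
    \<comment> \<open>The first bound lets \<open>c * norm E\<close> be absorbed into
      \<open>B * norm E\<close>; the second turns what is left into
      \<open>e * norm (s - t)\<close>.\<close>
    define c where "c = min (B / 2) (e * B / (2 * (norm w + 1)))"
    have n: "0 < norm w + 1" by (simp add: add_nonneg_pos)
    have c: "0 < c" "c \<le> B / 2" "c \<le> e * B / (2 * (norm w + 1))"
    proof -
      show "0 < c" using B(1) e n by (simp add: c_def)
    qed (simp_all only: c_def min.cobounded1 min.cobounded2)
    then have c3: "c * (2 * (norm w + 1)) \<le> e * B" using n by (simp add: pos_le_divide_eq)
    obtain d1 where d1: "0 < d1" "\<And>z. norm (z - y t) < d1 \<Longrightarrow> norm (\<psi> z - \<psi> (y t) - D (z - y t)) \<le> c * norm (z - y t)"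
      using D c(1) unfolding has_derivative_at_alt by meson
    obtain d2 where d2: "0 < d2" "\<And>s. norm (s - t) < d2 \<Longrightarrow> norm (\<psi> (y s) - \<psi> (y t) - (s - t) *\<^sub>R D w) \<le> c * norm (s - t)"
      using x c(1) unfolding has_vector_derivative_def has_derivative_at_alt by meson
    obtain d3 where d3: "0 < d3" "\<And>s. dist s t < d3 \<Longrightarrow> dist (y s) (y t) < d1"
      using cont d1(1) unfolding continuous_at_eps_delta by meson
    show ?thesis
    proof (intro exI conjI allI impI)
      show "0 < min d2 d3" using d2 d3 by simp
      fix s assume s: "norm (s - t) < min d2 d3"
      define E where "E = y s - y t - (s - t) *\<^sub>R w"
      have 1: "norm (\<psi> (y s) - \<psi> (y t) - D (y s - y t)) \<le> c * norm (y s - y t)"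
        using d1(2) d3(2)[of s] s by (simp add: dist_norm)
      have 2: "norm (\<psi> (y s) - \<psi> (y t) - (s - t) *\<^sub>R D w) \<le> c * norm (s - t)"
        using d2(2) s by simp
      have "D E = (\<psi> (y s) - \<psi> (y t) - (s - t) *\<^sub>R D w) - (\<psi> (y s) - \<psi> (y t) - D (y s - y t))"
        by (simp add: E_def linear_diff[OF lin] linear_scale[OF lin])
      then have "norm (D E) \<le> c * norm (s - t) + c * norm (y s - y t)"
        using 1 2 norm_triangle_ineq4 by (smt (verit))
      then have "B * norm E \<le> c * norm (s - t) + c * norm (y s - y t)"
        using B(2)[of E] by linarith
      moreover have "c * norm (y s - y t) \<le> c * (norm E + norm (s - t) * norm w)"
      proof -
        have "y s - y t = E + (s - t) *\<^sub>R w" by (simp add: E_def)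
        then have "norm (y s - y t) \<le> norm E + norm (s - t) * norm w"
          using norm_triangle_ineq[of E "(s - t) *\<^sub>R w"] by simp
        then show ?thesis using c(1) by simp
      qed
      moreover have "c * norm E \<le> B / 2 * norm E" using c(2) by (intro mult_right_mono) auto
      ultimately have "B * norm E \<le> c * (2 * (norm w + 1)) * norm (s - t)"
        by (simp add: algebra_simps)
      also have "\<dots> \<le> e * B * norm (s - t)" using c3 by (intro mult_right_mono) auto
      finally show "norm (y s - y t - (s - t) *\<^sub>R w) \<le> e * norm (s - t)"
        using B(1) by (simp add: E_def)
    qed
  qed
  then show ?thesis
    unfolding has_vector_derivative_def has_derivative_at_alt by (auto intro: bounded_linear_scaleR_left)
qed

section \<open>The coordinate frame of a chart and the inverse of canonical coordinates\<close>

definition tangent :: "(real^2 \<Rightarrow> real^3) \<Rightarrow> real^2 \<Rightarrow> real^2 \<Rightarrow> real^3" where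
  "tangent \<psi> v y = frechet_derivative \<psi> (at y) v"

definition hessian :: "(real^2 \<Rightarrow> real^3) \<Rightarrow> real^2 \<Rightarrow> real^2 \<Rightarrow> real^2 \<Rightarrow> real^3" where
  "hessian \<psi> v y w = frechet_derivative (tangent \<psi> v) (at y) w"

definition gram :: "(real^2 \<Rightarrow> real^3) \<Rightarrow> 2 \<Rightarrow> 2 \<Rightarrow> real^2 \<Rightarrow> real" where
  "gram \<psi> i j y = tangent \<psi> (axis i 1) y \<bullet> tangent \<psi> (axis j 1) y"

definition gram_det :: "(real^2 \<Rightarrow> real^3) \<Rightarrow> real^2 \<Rightarrow> real" where
  "gram_det \<psi> y = gram \<psi> 1 1 y * gram \<psi> 2 2 y - gram \<psi> 1 2 y * gram \<psi> 1 2 y"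

text \<open>The Gram matrix of the coordinate frame, inverted by Cramer's rule.\<close>

definition raised :: "(real^2 \<Rightarrow> real^3) \<Rightarrow> real^2 \<Rightarrow> real^2 \<Rightarrow> real^2" where
  "raised \<psi> y \<eta> = inverse (gram_det \<psi> y) *\<^sub>R
     ((\<eta>$1 * gram \<psi> 2 2 y - \<eta>$2 * gram \<psi> 1 2 y) *\<^sub>R axis 1 1 + (\<eta>$2 * gram \<psi> 1 1 y - \<eta>$1 * gram \<psi> 1 2 y) *\<^sub>R axis 2 1)"

text \<open>Explicit inverse of \<open>canonical_coords\<close> in the fibre: the tangent vector
  whose pairings with the frame are the components of \<eta>. A formula is wanted because the
  Hamiltonian in coordinates has to be differentiated.\<close>

definition covector :: "(real^2 \<Rightarrow> real^3) \<Rightarrow> real^2 \<Rightarrow> real^2 \<Rightarrow> real^3" where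
  "covector \<psi> y \<eta> = raised \<psi> y \<eta> $ 1 *\<^sub>R tangent \<psi> (axis 1 1) y + raised \<psi> y \<eta> $ 2 *\<^sub>R tangent \<psi> (axis 2 1) y"

lemma axis_2_nth [simp]:
  "axis 1 1 $ (1::2) = (1::real)" "axis 1 1 $ (2::2) = (0::real)"
  "axis 2 1 $ (1::2) = (0::real)" "axis 2 1 $ (2::2) = (1::real)"
  by (simp_all add: axis_def)

lemma vec2_expand: "(v::real^2) = v$1 *\<^sub>R axis 1 1 + v$2 *\<^sub>R axis 2 1"
  by (simp add: vec_eq_iff forall_2)

lemma lambda2_expand: "(\<chi> j. f j) = (f 1 *\<^sub>R axis 1 1 + f 2 *\<^sub>R axis 2 1 :: real^2)"
  by (simp add: vec_eq_iff forall_2)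

context
  fixes U \<psi> assumes lp: "local_param U \<psi>"
begin

lemma open_domain: "open U"
  using lp by (simp add: local_param_def)

lemma at_within_domain: "y \<in> U \<Longrightarrow> at y within U = at y"
  by (rule at_within_open[OF _ open_domain])

lemma C_k_on_param: "C_k_on k U \<psi>"
  using lp by (simp add: local_param_def smooth_on_def)

lemma param_in_S2: "y \<in> U \<Longrightarrow> \<psi> y \<in> S2"
  using lp by (auto simp: local_param_def)

lemma inv_into_param: "y \<in> U \<Longrightarrow> inv_into U \<psi> (\<psi> y) = y"
  using lp by (auto simp: local_param_def homeomorphism_def)

lemma param_has_derivative:
  assumes "y \<in> U"
  shows "(\<psi> has_derivative (\<lambda>v. tangent \<psi> v y)) (at y)"
proof -
  have "\<psi> differentiable at y"
    using C_k_on_param[of "Suc 0"] assms at_within_domain by (auto simp: differentiable_on_def)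
  then show ?thesis by (simp add: tangent_def[abs_def] frechet_derivative_works)
qed

lemma linear_tangent: "y \<in> U \<Longrightarrow> linear (\<lambda>v. tangent \<psi> v y)"
  using param_has_derivative has_derivative_linear by blast

lemma inj_tangent: "y \<in> U \<Longrightarrow> inj (\<lambda>v. tangent \<psi> v y)"
  using lp by (simp add: local_param_def tangent_def[abs_def])

lemma tangent_expand:
  assumes "y \<in> U"
  shows "tangent \<psi> v y = v$1 *\<^sub>R tangent \<psi> (axis 1 1) y + v$2 *\<^sub>R tangent \<psi> (axis 2 1) y"
proof -
  have "tangent \<psi> (v$1 *\<^sub>R axis 1 1 + v$2 *\<^sub>R axis 2 1) y = v$1 *\<^sub>R tangent \<psi> (axis 1 1) y + v$2 *\<^sub>R tangent \<psi> (axis 2 1) y"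
    using linear_add[OF linear_tangent[OF assms]] linear_scale[OF linear_tangent[OF assms]] by simp
  then show ?thesis by (simp only: vec2_expand[of v, symmetric])
qed

lemma tangent_has_derivative:
  assumes y: "y \<in> U"
  shows "(tangent \<psi> v has_derivative hessian \<psi> v y) (at y)"
    and "continuous_on U (\<lambda>y. hessian \<psi> v y w)"
proof -
  have "C_k_on (Suc (Suc 0)) U \<psi>" by (rule C_k_on_param)
  then have 1: "(\<lambda>x. frechet_derivative \<psi> (at x within U) v) differentiable_on U"
    and 2: "continuous_on U (\<lambda>x. frechet_derivative (\<lambda>x. frechet_derivative \<psi> (at x within U) v) (at x within U) w)"
    by auto
  have eq: "frechet_derivative \<psi> (at x within U) v = tangent \<psi> v x" if "x \<in> U" for x
    using at_within_domain[OF that] by (simp add: tangent_def)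
  have d: "(\<lambda>x. frechet_derivative \<psi> (at x within U) v) differentiable (at x)" if "x \<in> U" for x
    using 1[unfolded differentiable_on_def, rule_format, OF that] by (simp only: at_within_domain[OF that])
  have diff: "tangent \<psi> v differentiable (at x)" if "x \<in> U" for x
    using d[OF that] eq that open_domain unfolding differentiable_def
    by (blast intro: has_derivative_transform_within_open)
  show "(tangent \<psi> v has_derivative hessian \<psi> v y) (at y)"
    using diff[OF y] by (simp add: frechet_derivative_works hessian_def[abs_def])
  have "frechet_derivative (\<lambda>x. frechet_derivative \<psi> (at x within U) v) (at x within U) w = hessian \<psi> v x w" if "x \<in> U" for x
    using frechet_derivative_transform_within_open[OF d[OF that] open_domain that eq] at_within_domain[OF that]
    by (simp add: hessian_def)
  with 2 show "continuous_on U (\<lambda>y. hessian \<psi> v y w)" by (rule continuous_on_eq)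
qed

lemma hessian_symmetric:
  assumes y: "y \<in> U"
  shows "hessian \<psi> v y w = hessian \<psi> w y v"
proof -
  have "b \<bullet> hessian \<psi> v y w = b \<bullet> hessian \<psi> w y v" for b
    by (rule mixed_derivatives_symmetric[OF open_domain y, of "\<lambda>x. b \<bullet> \<psi> x" "\<lambda>x u. b \<bullet> tangent \<psi> u x" v "\<lambda>x u. b \<bullet> hessian \<psi> v x u" w "\<lambda>x u. b \<bullet> hessian \<psi> w x u"])
      (intro has_derivative_inner_right param_has_derivative tangent_has_derivative continuous_intros; use y in simp)+
  then show ?thesis by (metis vector_eq_ldot)
qed

lemma linear_hessian: "y \<in> U \<Longrightarrow> linear (hessian \<psi> v y)"
  using tangent_has_derivative(1) has_derivative_linear by blast

lemma tangent_orthogonal: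
  assumes y: "y \<in> U"
  shows "tangent \<psi> v y \<bullet> \<psi> y = 0"
proof -
  have "((\<lambda>x. \<psi> x \<bullet> \<psi> x) has_derivative (\<lambda>h. \<psi> y \<bullet> tangent \<psi> h y + tangent \<psi> h y \<bullet> \<psi> y)) (at y)"
    by (intro has_derivative_inner param_has_derivative y)
  moreover have "((\<lambda>x. \<psi> x \<bullet> \<psi> x) has_derivative (\<lambda>h. 0)) (at y)"
  proof (rule has_derivative_transform_within_open[where f = "\<lambda>_. 1", OF _ open_domain y])
    show "((\<lambda>_. 1) has_derivative (\<lambda>h. 0)) (at y)" by simp
    show "1 = \<psi> x \<bullet> \<psi> x" if "x \<in> U" for x using param_in_S2[OF that] by (simp add: norm_eq_1)
  qed
  ultimately have "(\<lambda>h. \<psi> y \<bullet> tangent \<psi> h y + tangent \<psi> h y \<bullet> \<psi> y) = (\<lambda>h. 0)"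
    by (rule has_derivative_unique)
  from fun_cong[OF this, of v] show ?thesis by (simp add: inner_commute)
qed

text \<open>The differential maps the plane injectively into the plane orthogonal to
  \<open>\<psi> y\<close>, hence onto it by dimension. Vectors of \<open>real^3\<close> can thus be
  compared through their pairings with the normal and the frame.\<close>

lemma orthogonal_to_frame_eq_0:
  assumes y: "y \<in> U" and d: "d \<bullet> \<psi> y = 0" "\<And>v. d \<bullet> tangent \<psi> v y = 0"
  shows "d = 0"
proof -
  have nz: "\<psi> y \<noteq> 0" using param_in_S2[OF y] by auto
  have "range (\<lambda>v. tangent \<psi> v y) = {x. \<psi> y \<bullet> x = 0}"
  proof (rule subspace_dim_equal)
    show "subspace (range (\<lambda>v. tangent \<psi> v y))"
      by (intro linear_subspace_image linear_tangent y) simp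
    show "subspace {x. \<psi> y \<bullet> x = 0}" by (rule subspace_hyperplane)
    show "range (\<lambda>v. tangent \<psi> v y) \<subseteq> {x. \<psi> y \<bullet> x = 0}"
      using tangent_orthogonal[OF y] by (auto simp: inner_commute)
    have "dim (range (\<lambda>v. tangent \<psi> v y)) = dim (UNIV :: (real^2) set)"
      by (intro dim_image_eq linear_tangent y) (use inj_tangent[OF y] in \<open>simp add: inj_on_def\<close>)
    then show "dim (range (\<lambda>v. tangent \<psi> v y)) \<ge> dim {x. \<psi> y \<bullet> x = 0}"
      using nz by (simp add: dim_hyperplane)
  qed
  then obtain v where "d = tangent \<psi> v y" using d(1) by (auto simp: inner_commute)
  then have "d \<bullet> d = 0" using d(2)[of v] by simp
  then show ?thesis by simp
qed

lemma gram_det_nonzero: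
  assumes y: "y \<in> U"
  shows "gram_det \<psi> y \<noteq> 0"
proof
  let ?a = "tangent \<psi> (axis 1 1) y" and ?b = "tangent \<psi> (axis 2 1) y"
  assume 0: "gram_det \<psi> y = 0"
  have ba: "?b \<bullet> ?a = ?a \<bullet> ?b" by (rule inner_commute)
  \<comment> \<open>Up to a factor this vector is the part of \<open>?a\<close> orthogonal to
    \<open>?b\<close>; a zero Gram determinant kills it and makes the frame dependent, against
    injectivity.\<close>
  have "((?b \<bullet> ?b) *\<^sub>R ?a - (?a \<bullet> ?b) *\<^sub>R ?b) \<bullet> ((?b \<bullet> ?b) *\<^sub>R ?a - (?a \<bullet> ?b) *\<^sub>R ?b) = (?b \<bullet> ?b) * gram_det \<psi> y"
    by (simp add: inner_diff_left inner_diff_right gram_det_def gram_def ba algebra_simps)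
  then have "(?b \<bullet> ?b) *\<^sub>R ?a - (?a \<bullet> ?b) *\<^sub>R ?b = 0" using 0 by simp
  then have "(?b \<bullet> ?b) *\<^sub>R ?a + (- (?a \<bullet> ?b)) *\<^sub>R ?b = tangent \<psi> 0 y"
    by (simp add: tangent_expand[OF y, of 0])
  moreover have "tangent \<psi> (p *\<^sub>R axis 1 1 + q *\<^sub>R axis 2 1) y = p *\<^sub>R ?a + q *\<^sub>R ?b" for p q
    by (subst tangent_expand[OF y]) simp
  ultimately have "tangent \<psi> ((?b \<bullet> ?b) *\<^sub>R axis 1 1 + (- (?a \<bullet> ?b)) *\<^sub>R axis 2 1) y = tangent \<psi> 0 y"
    by metis
  then have "(?b \<bullet> ?b) *\<^sub>R axis 1 1 + (- (?a \<bullet> ?b)) *\<^sub>R axis 2 1 = (0 :: real^2)"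
    by (rule injD[OF inj_tangent[OF y]])
  then have "?b \<bullet> ?b = 0" by (simp add: vec_eq_iff forall_2)
  then have "tangent \<psi> (axis 2 1) y = tangent \<psi> 0 y" by (simp add: tangent_expand[OF y, of 0])
  then have "axis 2 1 = (0 :: real^2)" by (rule injD[OF inj_tangent[OF y]])
  then show False by simp
qed

lemma covector_eq_tangent: "y \<in> U \<Longrightarrow> covector \<psi> y \<eta> = tangent \<psi> (raised \<psi> y \<eta>) y"
  by (simp add: covector_def tangent_expand[of y "raised \<psi> y \<eta>"])

lemma covector_orthogonal: "y \<in> U \<Longrightarrow> covector \<psi> y \<eta> \<bullet> \<psi> y = 0"
  by (simp add: covector_eq_tangent tangent_orthogonal)

lemma covector_inner_tangent:
  assumes y: "y \<in> U"
  shows "covector \<psi> y \<eta> \<bullet> tangent \<psi> v y = \<eta> \<bullet> v"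
proof -
  let ?a = "tangent \<psi> (axis 1 1) y" and ?b = "tangent \<psi> (axis 2 1) y"
  have g: "?a \<bullet> ?a = gram \<psi> 1 1 y" "?a \<bullet> ?b = gram \<psi> 1 2 y" "?b \<bullet> ?a = gram \<psi> 1 2 y" "?b \<bullet> ?b = gram \<psi> 2 2 y"
    by (simp_all add: gram_def inner_commute)
  have "covector \<psi> y \<eta> \<bullet> ?a = inverse (gram_det \<psi> y) * (\<eta>$1 * gram_det \<psi> y)"
    by (simp add: covector_def raised_def inner_add_left g) (simp add: gram_det_def algebra_simps)
  then have a: "covector \<psi> y \<eta> \<bullet> ?a = \<eta>$1" using gram_det_nonzero[OF y] by simp
  have "covector \<psi> y \<eta> \<bullet> ?b = inverse (gram_det \<psi> y) * (\<eta>$2 * gram_det \<psi> y)"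
    by (simp add: covector_def raised_def inner_add_left g) (simp add: gram_det_def algebra_simps)
  then have b: "covector \<psi> y \<eta> \<bullet> ?b = \<eta>$2" using gram_det_nonzero[OF y] by simp
  show ?thesis
    by (simp add: tangent_expand[OF y, of v] inner_add_right a b) (simp add: inner_vec_def sum_2 mult.commute)
qed

lemma canonical_coords_param:
  assumes "y \<in> U"
  shows "canonical_coords U \<psi> (\<psi> y, \<xi>) = (y, \<chi> j. \<xi> \<bullet> tangent \<psi> (axis j 1) y)"
  using assms by (simp add: canonical_coords_def inv_into_param tangent_def Let_def)

lemma canonical_coords_covector:
  assumes "y \<in> U"
  shows "canonical_coords U \<psi> (\<psi> y, covector \<psi> y \<eta>) = (y, \<eta>)"
  using assms by (simp add: canonical_coords_param covector_inner_tangent vec_eq_iff inner_axis)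

lemma covector_canonical_coords:
  assumes y: "y \<in> U" and \<xi>: "\<xi> \<bullet> \<psi> y = 0"
  shows "covector \<psi> y (\<chi> j. \<xi> \<bullet> tangent \<psi> (axis j 1) y) = \<xi>"
proof -
  let ?\<eta> = "\<chi> j. \<xi> \<bullet> tangent \<psi> (axis j 1) y"
  have "covector \<psi> y ?\<eta> - \<xi> = 0"
  proof (rule orthogonal_to_frame_eq_0[OF y])
    show "(covector \<psi> y ?\<eta> - \<xi>) \<bullet> \<psi> y = 0"
      by (simp add: inner_diff_left covector_orthogonal[OF y] \<xi>)
    show "(covector \<psi> y ?\<eta> - \<xi>) \<bullet> tangent \<psi> v y = 0" for v
      by (simp add: inner_diff_left covector_inner_tangent[OF y] tangent_expand[OF y, of v] inner_add_right)
        (simp add: inner_vec_def sum_2 mult.commute)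
  qed
  then show ?thesis by simp
qed

lemma in_coords_eq:
  assumes y: "y \<in> U"
  shows "in_coords U \<psi> k (y, \<eta>) = k (\<psi> y, covector \<psi> y \<eta>)"
proof -
  have "inj_on (canonical_coords U \<psi>) (cotangent (\<psi> ` U))"
    by (rule inj_on_inverseI[where g = "\<lambda>(y, \<eta>). (\<psi> y, covector \<psi> y \<eta>)"])
      (auto simp: cotangent_def canonical_coords_param covector_canonical_coords)
  then have "inv_into (cotangent (\<psi> ` U)) (canonical_coords U \<psi>) (y, \<eta>) = (\<psi> y, covector \<psi> y \<eta>)"
    by (rule inv_into_f_eq) (use y in \<open>auto simp: cotangent_def covector_orthogonal canonical_coords_covector\<close>)
  then show ?thesis by (simp add: in_coords_def)
qed

text \<open>Cramer's formula has a nonzero determinant. The result serves both to differentiate the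
  Hamiltonian and to recover differentiability of a covector along a curve from that of its
  coordinates.\<close>

lemma covector_differentiable:
  assumes y: "fst z \<in> U"
  shows "(\<lambda>z. covector \<psi> (fst z) (snd z)) differentiable (at z)"
proof -
  have fst: "fst differentiable (at z)" and snd: "snd differentiable (at z)"
    by (simp_all add: bounded_linear_imp_differentiable bounded_linear_fst bounded_linear_snd)
  have tan: "(\<lambda>z. tangent \<psi> v (fst z)) differentiable (at z)" for v
  proof -
    have "tangent \<psi> v differentiable (at (fst z))"
      using tangent_has_derivative(1)[OF y] unfolding differentiable_def by blast
    from differentiable_chain_at[OF fst this] show ?thesis by (simp add: o_def)
  qed
  have nth: "(\<lambda>z. snd z $ i) differentiable (at z)" for i :: 2
    by (rule bounded_linear_imp_differentiable) (rule bounded_linear_compose[OF bounded_linear_vec_nth bounded_linear_snd])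
  have gram: "(\<lambda>z. gram \<psi> i j (fst z)) differentiable (at z)" for i j
    unfolding gram_def by (intro differentiable_inner tan)
  have "(\<lambda>z. inverse (gram_det \<psi> (fst z))) differentiable (at z)"
    using gram_det_nonzero[OF y] by (intro differentiable_inverse) (auto simp: gram_det_def intro!: differentiable_diff differentiable_mult gram)
  then show ?thesis
    unfolding covector_def raised_def
    by (auto intro!: differentiable_add differentiable_diff differentiable_mult differentiable_scaleR gram tan nth)
qed

end

section \<open>From canonical coordinates to an equation in the ambient space\<close>

lemma has_vector_derivative_compose_curve:
  assumes "(y has_vector_derivative w) (at t)" "(f has_derivative D) (at (y t))"
  shows "((\<lambda>s. f (y s)) has_vector_derivative D w) (at t)"
proof -
  have "((\<lambda>s. f (y s)) has_derivative (\<lambda>h. D (h *\<^sub>R w))) (at t)"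
    using diff_chain_at[OF assms(1)[unfolded has_vector_derivative_def] assms(2)] by (simp add: o_def)
  then show ?thesis
    using linear_scale[OF has_derivative_linear[OF assms(2)]] by (simp add: has_vector_derivative_def)
qed

text \<open>The squared norm of the covector depends on \<open>y\<close> through the inverse Gram
  matrix. Its derivative is obtained without differentiating that matrix, from the defining identity
  that pairs the covector with the frame.\<close>

lemma hamiltonian_field_in_coords:
  fixes k :: "phase_point \<Rightarrow> real"
  assumes lp: "local_param U \<psi>" and y: "y \<in> U"
    and k: "\<And>x \<xi>. x \<in> S2 \<Longrightarrow> \<xi> \<bullet> x = 0 \<Longrightarrow> k (x, \<xi>) = sqrt (\<xi> \<bullet> \<xi> + F (x$3))"
    and F: "(F has_real_derivative g) (at (\<psi> y $ 3))"
    and q: "k (\<psi> y, covector \<psi> y \<eta>) = q" "0 < q"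
  shows "hamiltonian_field (in_coords U \<psi> k) (y, \<eta>) =
    (raised \<psi> y \<eta> /\<^sub>R q,
     \<chi> j. (covector \<psi> y \<eta> \<bullet> hessian \<psi> (axis j 1) y (raised \<psi> y \<eta>) - g / 2 * tangent \<psi> (axis j 1) y $ 3) / q)"
proof -
  define \<Xi> where "\<Xi> z = covector \<psi> (fst z) (snd z)" for z
  define \<alpha> where "\<alpha> = raised \<psi> y \<eta>"
  let ?z = "(y, \<eta>)"
  have \<Xi>_tangent: "\<Xi> ?z = tangent \<psi> \<alpha> y" by (simp add: \<Xi>_def \<alpha>_def covector_eq_tangent[OF lp y])
  obtain \<Xi>' where \<Xi>': "(\<Xi> has_derivative \<Xi>') (at ?z)"
    using covector_differentiable[OF lp, of ?z] y unfolding differentiable_def \<Xi>_def[abs_def] by auto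
  have fst: "(fst has_derivative fst) (at ?z)" and snd: "(snd has_derivative snd) (at ?z)"
    by (auto intro!: derivative_eq_intros)
  have open_dom: "open (U \<times> (UNIV :: (real^2) set))"
    by (intro open_Times open_domain[OF lp]) simp
  \<comment> \<open>Here \<alpha> is frozen at its value at the base point. The pairing of
    \<open>\<Xi> z\<close> with the tangent vector of coordinates \<alpha> is
    \<open>snd z \<bullet> \<alpha>\<close>; differentiating it isolates \<open>\<Xi>'\<close>,
    because that tangent vector is \<Xi> itself at the base point.\<close>
  have \<Xi>'_inner: "\<Xi> ?z \<bullet> \<Xi>' h = snd h \<bullet> \<alpha> - \<Xi> ?z \<bullet> hessian \<psi> \<alpha> y (fst h)" for h
  proof -
    have tan: "((\<lambda>z. tangent \<psi> \<alpha> (fst z)) has_derivative (\<lambda>h. hessian \<psi> \<alpha> y (fst h))) (at ?z)"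
      using diff_chain_at[OF fst, of "tangent \<psi> \<alpha>" "hessian \<psi> \<alpha> y"] tangent_has_derivative(1)[OF lp y]
      by (simp add: o_def)
    have "((\<lambda>z. \<Xi> z \<bullet> tangent \<psi> \<alpha> (fst z)) has_derivative
        (\<lambda>h. \<Xi> ?z \<bullet> hessian \<psi> \<alpha> y (fst h) + \<Xi>' h \<bullet> tangent \<psi> \<alpha> y)) (at ?z)"
      using has_derivative_inner[OF \<Xi>' tan] by simp
    moreover have "((\<lambda>z. \<Xi> z \<bullet> tangent \<psi> \<alpha> (fst z)) has_derivative (\<lambda>h. snd h \<bullet> \<alpha>)) (at ?z)"
    proof (rule has_derivative_transform_within_open[where f = "\<lambda>z. snd z \<bullet> \<alpha>", OF _ open_dom])
      show "((\<lambda>z. snd z \<bullet> \<alpha>) has_derivative (\<lambda>h. snd h \<bullet> \<alpha>)) (at ?z)"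
        by (intro has_derivative_inner_left snd)
    qed (use y in \<open>auto simp: \<Xi>_def covector_inner_tangent[OF lp]\<close>)
    ultimately have "(\<lambda>h. \<Xi> ?z \<bullet> hessian \<psi> \<alpha> y (fst h) + \<Xi>' h \<bullet> tangent \<psi> \<alpha> y) = (\<lambda>h. snd h \<bullet> \<alpha>)"
      by (rule has_derivative_unique)
    from fun_cong[OF this, of h] show ?thesis by (simp add: \<Xi>_tangent inner_commute)
  qed
  define E where "E z = \<Xi> z \<bullet> \<Xi> z + F (\<psi> (fst z) $ 3)" for z
  have K: "in_coords U \<psi> k z = sqrt (E z)" if "z \<in> U \<times> UNIV" for z
    using that k[OF param_in_S2[OF lp] covector_orthogonal[OF lp]]
    by (auto simp: in_coords_eq[OF lp] E_def \<Xi>_def)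
  have Eq: "sqrt (E ?z) = q" using K[of ?z] y q(1) by (simp add: in_coords_eq[OF lp])
  then have E0: "0 < E ?z" using q(2) by auto
  have psi3: "((\<lambda>z. \<psi> (fst z) $ 3) has_derivative (\<lambda>h. tangent \<psi> (fst h) y $ 3)) (at ?z)"
    using diff_chain_at[OF fst, of \<psi> "\<lambda>v. tangent \<psi> v y"] param_has_derivative[OF lp y]
    by (intro bounded_linear.has_derivative[OF bounded_linear_vec_nth]) (simp add: o_def)
  have "((\<lambda>z. F (\<psi> (fst z) $ 3)) has_derivative (\<lambda>h. tangent \<psi> (fst h) y $ 3 * g)) (at ?z)"
    using F by (intro DERIV_compose_FDERIV[OF _ psi3]) simp
  then have "(E has_derivative (\<lambda>h. (\<Xi> ?z \<bullet> \<Xi>' h + \<Xi>' h \<bullet> \<Xi> ?z) + tangent \<psi> (fst h) y $ 3 * g)) (at ?z)"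
    unfolding E_def[abs_def] by (intro has_derivative_add has_derivative_inner \<Xi>')
  from DERIV_compose_FDERIV[OF DERIV_real_sqrt[OF E0] this]
  have "((\<lambda>z. sqrt (E z)) has_derivative
      (\<lambda>h. (\<Xi> ?z \<bullet> \<Xi>' h + \<Xi>' h \<bullet> \<Xi> ?z + tangent \<psi> (fst h) y $ 3 * g) * (inverse q / 2))) (at ?z)"
    by (simp only: Eq)
  moreover have "(\<Xi> ?z \<bullet> \<Xi>' h + \<Xi>' h \<bullet> \<Xi> ?z + tangent \<psi> (fst h) y $ 3 * g) * (inverse q / 2) =
      (snd h \<bullet> \<alpha> - \<Xi> ?z \<bullet> hessian \<psi> \<alpha> y (fst h) + g / 2 * tangent \<psi> (fst h) y $ 3) / q" for h
    by (simp add: inner_commute[of "\<Xi>' h"] \<Xi>'_inner field_simps)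
  ultimately have "((\<lambda>z. sqrt (E z)) has_derivative
      (\<lambda>h. (snd h \<bullet> \<alpha> - \<Xi> ?z \<bullet> hessian \<psi> \<alpha> y (fst h) + g / 2 * tangent \<psi> (fst h) y $ 3) / q)) (at ?z)"
    by (simp only:)
  then have "(in_coords U \<psi> k has_derivative
      (\<lambda>h. (snd h \<bullet> \<alpha> - \<Xi> ?z \<bullet> hessian \<psi> \<alpha> y (fst h) + g / 2 * tangent \<psi> (fst h) y $ 3) / q)) (at ?z)"
    by (rule has_derivative_transform_within_open[OF _ open_dom]) (use y K in auto)
  from frechet_derivative_at[OF this, symmetric]
  have fd: "frechet_derivative (in_coords U \<psi> k) (at ?z) =
      (\<lambda>h. (snd h \<bullet> \<alpha> - \<Xi> ?z \<bullet> hessian \<psi> \<alpha> y (fst h) + g / 2 * tangent \<psi> (fst h) y $ 3) / q)" .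
  have hess0: "hessian \<psi> \<alpha> y 0 = 0" by (rule linear_0[OF linear_hessian[OF lp y]])
  have tan0: "tangent \<psi> 0 y = 0" by (rule linear_0[OF linear_tangent[OF lp y]])
  have "frechet_derivative (in_coords U \<psi> k) (at ?z) (0, axis j 1) = (\<alpha> /\<^sub>R q) $ j" for j
    by (simp add: fd hess0 tan0 inner_axis') (simp add: field_simps)
  moreover have "- frechet_derivative (in_coords U \<psi> k) (at ?z) (axis j 1, 0) =
      (\<Xi> ?z \<bullet> hessian \<psi> (axis j 1) y \<alpha> - g / 2 * tangent \<psi> (axis j 1) y $ 3) / q" for j
    by (simp add: fd hessian_symmetric[OF lp y, of \<alpha> "axis j 1"] diff_divide_distrib add_divide_distrib)
  ultimately show ?thesis
    by (simp add: hamiltonian_field_def \<Xi>_def \<alpha>_def vec_eq_iff)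
qed

text \<open>The last term is the reaction that keeps the curve on the sphere.\<close>

definition ambient_field :: "(real \<Rightarrow> real) \<Rightarrow> real \<Rightarrow> phase_point \<Rightarrow> phase_point" where
  "ambient_field g c = (\<lambda>(x, \<xi>). (\<xi> /\<^sub>R c,
     - (g (x$3) / (2 * c)) *\<^sub>R (axis 3 1 - x$3 *\<^sub>R x) - ((\<xi> \<bullet> \<xi>) / c) *\<^sub>R x))"

text \<open>A canonical momentum is the pairing of \<xi> with a frame vector. In its derivative the
  Hessian term matches the one in Hamilton's equation, which leaves the tangential part of the
  acceleration; the normal part is forced by \<open>\<xi> \<bullet> x = 0\<close>.\<close>

lemma chart_velocity_iff_ambient_field:
  fixes k :: "phase_point \<Rightarrow> real" and x \<xi> :: "real \<Rightarrow> real^3"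
  assumes lp: "local_param U \<psi>" and xt: "x t \<in> \<psi> ` U"
    and cot: "\<And>s. x s \<in> S2" "\<And>s. \<xi> s \<bullet> x s = 0" and cont: "continuous_on UNIV x"
    and k: "\<And>x \<xi>. x \<in> S2 \<Longrightarrow> \<xi> \<bullet> x = 0 \<Longrightarrow> k (x, \<xi>) = sqrt (\<xi> \<bullet> \<xi> + F (x$3))"
    and F: "(F has_real_derivative g (x t $ 3)) (at (x t $ 3))"
    and q: "k (x t, \<xi> t) = q" "0 < q"
  shows "((canonical_coords U \<psi> \<circ> (\<lambda>s. (x s, \<xi> s))) has_vector_derivative
      hamiltonian_field (in_coords U \<psi> k) (canonical_coords U \<psi> (x t, \<xi> t))) (at t) \<longleftrightarrow>
    ((\<lambda>s. (x s, \<xi> s)) has_vector_derivative ambient_field g q (x t, \<xi> t)) (at t)" (is "?chart \<longleftrightarrow> ?ambient")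
proof -
  define y where "y s = inv_into U \<psi> (x s)" for s
  define \<eta> where "\<eta> s = (\<chi> j. \<xi> s \<bullet> tangent \<psi> (axis j 1) (y s))" for s
  define I where "I = {s. x s \<in> \<psi> ` U}"
  have I: "t \<in> I" using xt by (simp add: I_def)
  \<comment> \<open>The chart covers only an open piece of the sphere. Its identities hold at all
    times near \<open>t\<close>, which is enough to transfer derivatives.\<close>
  have "open I"
  proof -
    obtain T where T: "open T" "\<psi> ` U = S2 \<inter> T"
      using lp by (auto simp: local_param_def openin_open)
    then have "I = x -` T" using cot by (auto simp: I_def simp del: mem_sphere)
    then show ?thesis using T(1) cont by (simp add: continuous_on_open_vimage)
  qed
  have yU: "y s \<in> U" and psi_y: "\<psi> (y s) = x s" if "s \<in> I" for s
    using that by (auto simp: I_def y_def inv_into_into f_inv_into_f)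
  have cov: "covector \<psi> (y s) (\<eta> s) = \<xi> s" if "s \<in> I" for s
    unfolding \<eta>_def by (rule covector_canonical_coords[OF lp yU[OF that]]) (simp add: psi_y[OF that] cot)
  have cc: "canonical_coords U \<psi> (x s, \<xi> s) = (y s, \<eta> s)" for s
    by (simp add: canonical_coords_def y_def \<eta>_def tangent_def Let_def)
  define \<alpha> where "\<alpha> = raised \<psi> (y t) (\<eta> t)"
  define \<eta>' :: "real^2" where "\<eta>' = (\<chi> j. (\<xi> t \<bullet> hessian \<psi> (axis j 1) (y t) \<alpha> - g (x t $ 3) / 2 * tangent \<psi> (axis j 1) (y t) $ 3) / q)"
  have ham: "hamiltonian_field (in_coords U \<psi> k) (y t, \<eta> t) = (\<alpha> /\<^sub>R q, \<eta>')"
    using hamiltonian_field_in_coords[where k = k and F = F and g = "g (x t $ 3)" and \<eta> = "\<eta> t" and q = q,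
        OF lp yU[OF I] k] F q
    by (simp add: psi_y[OF I] cov[OF I] \<alpha>_def \<eta>'_def)
  have tan_\<alpha>: "tangent \<psi> (\<alpha> /\<^sub>R q) (y t) = \<xi> t /\<^sub>R q"
    using covector_eq_tangent[OF lp yU[OF I], of "\<eta> t"] linear_scale[OF linear_tangent[OF lp yU[OF I]]]
    by (simp add: cov[OF I] \<alpha>_def)
  have hess_\<alpha>: "hessian \<psi> v (y t) (\<alpha> /\<^sub>R q) = hessian \<psi> v (y t) \<alpha> /\<^sub>R q" for v
    by (rule linear_scale[OF linear_hessian[OF lp yU[OF I]]])
  define X where "X = - (g (x t $ 3) / (2 * q)) *\<^sub>R (axis 3 1 - x t $ 3 *\<^sub>R x t) - ((\<xi> t \<bullet> \<xi> t) / q) *\<^sub>R x t"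
  have amb: "ambient_field g q (x t, \<xi> t) = (\<xi> t /\<^sub>R q, X)"
    by (simp add: ambient_field_def X_def)
  have X_tan: "X \<bullet> tangent \<psi> v (y t) = - (g (x t $ 3) / (2 * q)) * tangent \<psi> v (y t) $ 3" for v
  proof -
    have "x t \<bullet> tangent \<psi> v (y t) = 0"
      using tangent_orthogonal[OF lp yU[OF I], of v] by (simp add: psi_y[OF I] inner_commute)
    then show ?thesis by (simp add: X_def inner_diff_left inner_axis')
  qed
  have tan_curve: "((\<lambda>s. tangent \<psi> v (y s)) has_vector_derivative hessian \<psi> v (y t) \<alpha> /\<^sub>R q) (at t)"
    if "(y has_vector_derivative \<alpha> /\<^sub>R q) (at t)" for v
    using has_vector_derivative_compose_curve[OF that tangent_has_derivative(1)[OF lp yU[OF I]]]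
    by (simp add: hess_\<alpha>)
  have pairing: "((\<lambda>s. \<xi> s \<bullet> tangent \<psi> v (y s)) has_vector_derivative
      \<xi> t \<bullet> hessian \<psi> v (y t) \<alpha> / q + Z \<bullet> tangent \<psi> v (y t)) (at t)"
    if "(y has_vector_derivative \<alpha> /\<^sub>R q) (at t)" "(\<xi> has_vector_derivative Z) (at t)" for v Z
    using has_derivative_inner[OF that(2)[unfolded has_vector_derivative_def] tan_curve[OF that(1), unfolded has_vector_derivative_def]]
    by (simp add: has_vector_derivative_def algebra_simps divide_inverse)
  show ?thesis
  proof
    assume ?chart
    then have "((\<lambda>s. (y s, \<eta> s)) has_vector_derivative (\<alpha> /\<^sub>R q, \<eta>')) (at t)"
      by (simp add: cc ham o_def)
    note y\<eta> = this
    have y': "(y has_vector_derivative \<alpha> /\<^sub>R q) (at t)" and \<eta>': "(\<eta> has_vector_derivative \<eta>') (at t)"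
      using bounded_linear.has_vector_derivative[OF bounded_linear_fst y\<eta>]
        bounded_linear.has_vector_derivative[OF bounded_linear_snd y\<eta>] by simp_all
    have "((\<lambda>s. \<psi> (y s)) has_vector_derivative \<xi> t /\<^sub>R q) (at t)"
      using has_vector_derivative_compose_curve[OF y' param_has_derivative[OF lp yU[OF I]]] by (simp add: tan_\<alpha>)
    then have x': "(x has_vector_derivative \<xi> t /\<^sub>R q) (at t)"
      by (rule has_vector_derivative_transform_within_open[OF _ \<open>open I\<close> I]) (rule psi_y)
    \<comment> \<open>This only establishes that \<xi> is differentiable; its derivative
      \<open>Z\<close> is identified afterwards, by pairing with the frame and with
      \<open>x t\<close>.\<close>
    obtain \<Xi>' where "((\<lambda>z. covector \<psi> (fst z) (snd z)) has_derivative \<Xi>') (at (y t, \<eta> t))"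
      using covector_differentiable[OF lp, of "(y t, \<eta> t)"] yU[OF I] unfolding differentiable_def by auto
    from has_vector_derivative_compose_curve[OF y\<eta> this]
    have "((\<lambda>s. covector \<psi> (y s) (\<eta> s)) has_vector_derivative \<Xi>' (\<alpha> /\<^sub>R q, \<eta>')) (at t)" by simp
    then have "(\<xi> has_vector_derivative \<Xi>' (\<alpha> /\<^sub>R q, \<eta>')) (at t)"
      by (rule has_vector_derivative_transform_within_open[OF _ \<open>open I\<close> I]) (rule cov)
    then obtain Z where \<xi>': "(\<xi> has_vector_derivative Z) (at t)" by blast
    have Z_axis: "Z \<bullet> tangent \<psi> (axis j 1) (y t) = X \<bullet> tangent \<psi> (axis j 1) (y t)" for j :: 2
    proof -
      have "((\<lambda>s. \<eta> s $ j) has_vector_derivative \<eta>' $ j) (at t)"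
        by (rule bounded_linear.has_vector_derivative[OF bounded_linear_vec_nth \<eta>'])
      then have "\<eta>' $ j = \<xi> t \<bullet> hessian \<psi> (axis j 1) (y t) \<alpha> / q + Z \<bullet> tangent \<psi> (axis j 1) (y t)"
        using vector_derivative_unique_at[OF _ pairing[OF y' \<xi>', of "axis j 1"]] by (simp add: \<eta>_def)
      then show ?thesis by (simp add: \<eta>'_def X_tan diff_divide_distrib)
    qed
    \<comment> \<open>The frame says nothing about the normal component of \<open>Z\<close>; the
      constraint \<open>\<xi> \<bullet> x = 0\<close> determines it.\<close>
    have "((\<lambda>s. \<xi> s \<bullet> x s) has_vector_derivative \<xi> t \<bullet> (\<xi> t /\<^sub>R q) + Z \<bullet> x t) (at t)"
      using has_derivative_inner[OF \<xi>'[unfolded has_vector_derivative_def] x'[unfolded has_vector_derivative_def]]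
      by (simp add: has_vector_derivative_def algebra_simps)
    moreover have "((\<lambda>s. \<xi> s \<bullet> x s) has_vector_derivative 0) (at t)" by (simp add: cot)
    ultimately have Z_x: "Z \<bullet> x t = - ((\<xi> t \<bullet> \<xi> t) / q)"
      by (auto dest: vector_derivative_unique_at simp: divide_inverse mult.commute)
    have xx: "x t \<bullet> x t = 1" using cot(1)[of t] by (simp add: norm_eq_1)
    have "Z - X = 0"
    proof (rule orthogonal_to_frame_eq_0[OF lp yU[OF I]])
      show "(Z - X) \<bullet> \<psi> (y t) = 0"
        by (simp add: psi_y[OF I] inner_diff_left Z_x X_def xx inner_axis')
      show "(Z - X) \<bullet> tangent \<psi> v (y t) = 0" for v
        by (simp add: tangent_expand[OF lp yU[OF I], of v] inner_add_right inner_diff_left Z_axis)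
    qed
    then have "Z = X" by simp
    then show ?ambient unfolding amb using x' \<xi>' by (auto intro: has_vector_derivative_Pair)
  next
    assume ?ambient
    note x\<xi> = this[unfolded amb]
    have x': "(x has_vector_derivative \<xi> t /\<^sub>R q) (at t)" and \<xi>': "(\<xi> has_vector_derivative X) (at t)"
      using bounded_linear.has_vector_derivative[OF bounded_linear_fst x\<xi>]
        bounded_linear.has_vector_derivative[OF bounded_linear_snd x\<xi>] by simp_all
    have y': "(y has_vector_derivative \<alpha> /\<^sub>R q) (at t)"
    proof (rule lifted_curve_has_vector_derivative[where y = y and t = t, OF param_has_derivative[OF lp yU[OF I]] inj_tangent[OF lp yU[OF I]]])
      have "continuous_on (\<psi> ` U) (inv_into U \<psi>)"
        using lp by (simp add: local_param_def homeomorphism_def)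
      then have "continuous_on I y"
        unfolding y_def by (rule continuous_on_compose2) (use cont in \<open>auto simp: I_def intro: continuous_on_subset\<close>)
      then show "isCont y t" using \<open>open I\<close> I by (simp add: continuous_on_eq_continuous_at)
      show "((\<lambda>s. \<psi> (y s)) has_vector_derivative tangent \<psi> (\<alpha> /\<^sub>R q) (y t)) (at t)"
        unfolding tan_\<alpha> by (rule has_vector_derivative_transform_within_open[OF x' \<open>open I\<close> I]) (simp add: psi_y)
    qed
    have "((\<lambda>s. \<xi> s \<bullet> tangent \<psi> (axis j 1) (y s)) has_vector_derivative \<eta>' $ j) (at t)" for j :: 2
      using pairing[OF y' \<xi>', of "axis j 1"] by (simp add: \<eta>'_def X_tan diff_divide_distrib)
    then have "((\<lambda>s. (\<xi> s \<bullet> tangent \<psi> (axis 1 1) (y s)) *\<^sub>R axis 1 1 + (\<xi> s \<bullet> tangent \<psi> (axis 2 1) (y s)) *\<^sub>R axis (2::2) (1::real))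
        has_vector_derivative \<eta>' $ 1 *\<^sub>R axis 1 1 + \<eta>' $ 2 *\<^sub>R axis 2 1) (at t)"
      by (intro has_vector_derivative_add bounded_linear.has_vector_derivative[OF bounded_linear_scaleR_left])
    then have "(\<eta> has_vector_derivative \<eta>') (at t)"
      by (simp add: \<eta>_def[abs_def] lambda2_expand flip: vec2_expand)
    then show ?chart using y' by (simp add: cc ham o_def has_vector_derivative_Pair)
  qed
qed

text \<open>One chart around each point suffices from left to right, while the converse serves all
  charts at once. The energy is kept as \<open>k (\<gamma> t)\<close>, because its conservation is
  derived from this equation only later.\<close>

lemma integral_curve_iff_ambient_field:
  assumes D: "D \<subseteq> cotangent S2"
    and k: "\<And>x \<xi>. x \<in> S2 \<Longrightarrow> \<xi> \<bullet> x = 0 \<Longrightarrow> k (x, \<xi>) = sqrt (\<xi> \<bullet> \<xi> + F (x$3))"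
    and F: "\<And>z. z \<in> {-1..1} \<Longrightarrow> (F has_real_derivative g z) (at z)"
    and pos: "\<And>p. p \<in> D \<Longrightarrow> 0 < k p"
  shows "integral_curve D k \<gamma> \<longleftrightarrow>
    (\<forall>t. \<gamma> t \<in> D) \<and> (\<forall>t. (\<gamma> has_vector_derivative ambient_field g (k (\<gamma> t)) (\<gamma> t)) (at t))"
proof -
  define x \<xi> where "x s = fst (\<gamma> s)" and "\<xi> s = snd (\<gamma> s)" for s
  have \<gamma>: "\<gamma> = (\<lambda>s. (x s, \<xi> s))" by (simp add: x_def \<xi>_def)
  have key: "((canonical_coords U \<psi> \<circ> \<gamma>) has_vector_derivative
      hamiltonian_field (in_coords U \<psi> k) (canonical_coords U \<psi> (\<gamma> t))) (at t) \<longleftrightarrow>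
    (\<gamma> has_vector_derivative ambient_field g (k (\<gamma> t)) (\<gamma> t)) (at t)"
    if \<gamma>D: "\<forall>t. \<gamma> t \<in> D" and c: "continuous_on UNIV \<gamma>" and lp: "local_param U \<psi>" and t: "fst (\<gamma> t) \<in> \<psi> ` U" for U \<psi> t
  proof -
    have cot: "x s \<in> S2" "\<xi> s \<bullet> x s = 0" for s
    proof -
      have "(x s, \<xi> s) \<in> cotangent S2" using \<gamma>D D \<gamma> by (metis subsetD)
      then show "x s \<in> S2" "\<xi> s \<bullet> x s = 0" by (auto simp: cotangent_def)
    qed
    have "\<bar>x t $ 3\<bar> \<le> 1" using cot(1)[of t] component_le_norm_cart[of "x t" 3] by simp
    then have "(F has_real_derivative g (x t $ 3)) (at (x t $ 3))" by (intro F) (simp add: abs_le_iff)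
    moreover have "continuous_on UNIV x" using c unfolding x_def[abs_def] by (rule continuous_on_fst)
    moreover have "0 < k (x t, \<xi> t)" using pos \<gamma>D \<gamma> by metis
    moreover have "x t \<in> \<psi> ` U" using t by (simp add: x_def)
    ultimately show ?thesis
      using chart_velocity_iff_ambient_field[where k = k and F = F and g = g and x = x and \<xi> = \<xi>, OF lp _ cot _ k]
      unfolding \<gamma> by blast
  qed
  show ?thesis
  proof
    assume ic: "integral_curve D k \<gamma>"
    then have \<gamma>D: "\<forall>t. \<gamma> t \<in> D" and c: "continuous_on UNIV \<gamma>" by (auto simp: integral_curve_def)
    have "(\<gamma> has_vector_derivative ambient_field g (k (\<gamma> t)) (\<gamma> t)) (at t)" for t
    proof -
      have "\<gamma> t \<in> cotangent S2" using \<gamma>D D by blast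
      then have "fst (\<gamma> t) \<in> S2" by (auto simp: cotangent_def)
      then obtain U \<psi> where lp: "local_param U \<psi>" "fst (\<gamma> t) \<in> \<psi> ` U" using local_param_exists by blast
      then show ?thesis using ic key[OF \<gamma>D c lp] by (auto simp: integral_curve_def)
    qed
    then show "(\<forall>t. \<gamma> t \<in> D) \<and> (\<forall>t. (\<gamma> has_vector_derivative ambient_field g (k (\<gamma> t)) (\<gamma> t)) (at t))"
      using \<gamma>D by blast
  next
    assume a: "(\<forall>t. \<gamma> t \<in> D) \<and> (\<forall>t. (\<gamma> has_vector_derivative ambient_field g (k (\<gamma> t)) (\<gamma> t)) (at t))"
    then have c: "continuous_on UNIV \<gamma>"
      by (auto simp: continuous_on_eq_continuous_within intro: has_vector_derivative_continuous)
    show "integral_curve D k \<gamma>"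
      unfolding integral_curve_def using a c key by blast
  qed
qed


section \<open>The normalized flow\<close>

text \<open>The state \<open>((x, \<xi> / c), 1 / c\<^sup>2)\<close>, where \<open>c\<close> is the value of the Hamiltonian.\<close>

type_synonym normalized_state = "((real^3) \<times> (real^3)) \<times> real"

definition normalized_field :: "(real \<Rightarrow> real) \<Rightarrow> normalized_state \<Rightarrow> normalized_state" where
  "normalized_field g = (\<lambda>((x, v), \<mu>).
     ((v, - (\<mu> / 2 * g (x$3)) *\<^sub>R (axis 3 1 - x$3 *\<^sub>R x) - (v \<bullet> v) *\<^sub>R x), 0))"

definition energy_surface :: "(real \<Rightarrow> real) \<Rightarrow> real \<Rightarrow> normalized_state set" where
  "energy_surface F M = {((x, v), \<mu>). x \<in> S2 \<and> v \<bullet> x = 0 \<and> v \<bullet> v + \<mu> * F (x$3) = 1 \<and> 0 \<le> \<mu> \<and> \<mu> \<le> M}"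

section \<open>Global solutions on the energy surface\<close>

text \<open>The normalized field is unbounded, being quadratic in the velocity, whereas the
  existence and compactness results ask for a bounded field. The factor is 1 on the ball of radius
  \<open>r\<close>, chosen to contain the energy surface.\<close>

definition cutoff :: "real \<Rightarrow> 'a::real_normed_vector \<Rightarrow> real" where
  "cutoff r p = max 0 (min 1 (r + 1 - norm p))"

lemma cutoff_bounds: "0 \<le> cutoff r p" "cutoff r p \<le> 1"
  by (auto simp: cutoff_def)

lemma cutoff_eq_1: "norm p \<le> r \<Longrightarrow> cutoff r p = 1"
  by (simp add: cutoff_def)

lemma continuous_on_cutoff: "continuous_on A (cutoff r)"
  unfolding cutoff_def by (intro continuous_intros)

lemma cutoff_scaleR_bounded:
  fixes h :: "'a::euclidean_space \<Rightarrow> 'b::real_normed_vector"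
  assumes "continuous_on UNIV h"
  shows "\<exists>B\<ge>0. \<forall>p. norm (cutoff r p *\<^sub>R h p) \<le> B"
proof -
  have "compact (h ` cball 0 (r + 1))"
    using assms by (intro compact_continuous_image) (auto intro: continuous_on_subset)
  then obtain B where B: "\<forall>p\<in>cball 0 (r + 1). norm (h p) \<le> B"
    by (auto dest!: compact_imp_bounded simp: bounded_iff)
  have "norm (cutoff r p *\<^sub>R h p) \<le> \<bar>B\<bar>" for p
  proof (cases "norm p \<le> r + 1")
    case True
    then have "norm (h p) \<le> \<bar>B\<bar>" using bspec[OF B, of p] by simp
    then have "cutoff r p * norm (h p) \<le> 1 * \<bar>B\<bar>"
      using cutoff_bounds[of r p] by (intro mult_mono) auto
    then show ?thesis using cutoff_bounds[of r p] by simp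
  qed (simp add: cutoff_def)
  then show ?thesis by (intro exI[of _ "\<bar>B\<bar>"]) simp
qed

text \<open>\<open>N t * exp (- C * t)\<close> decreases forwards and
  \<open>N t * exp (C * t)\<close> decreases backwards from 0. It serves to show that the
  constraints defining the cotangent bundle persist.\<close>

lemma gronwall_zero:
  fixes N N' :: "real \<Rightarrow> real"
  assumes N: "\<And>t. (N has_real_derivative N' t) (at t)" and bound: "\<And>t. \<bar>N' t\<bar> \<le> C * N t"
    and N0: "N 0 = 0" and nonneg: "\<And>t. 0 \<le> N t"
  shows "N t = 0"
proof -
  have 1: "((\<lambda>t. N t * exp (- C * t)) has_real_derivative (N' s - C * N s) * exp (- C * s)) (at s)" for s
    by (auto intro!: derivative_eq_intros N simp: algebra_simps)
  have 2: "((\<lambda>t. N t * exp (C * t)) has_real_derivative (N' s + C * N s) * exp (C * s)) (at s)" for s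
    by (auto intro!: derivative_eq_intros N simp: algebra_simps)
  have "N t * exp (- C * t) \<le> N 0 * exp (- C * 0)" if "0 \<le> t"
  proof (rule DERIV_nonpos_imp_nonincreasing[OF that, of "\<lambda>t. N t * exp (- C * t)"])
    show "\<exists>y. ((\<lambda>t. N t * exp (- C * t)) has_real_derivative y) (at s) \<and> y \<le> 0" for s
      using 1[of s] bound[of s] by (intro exI[of _ "(N' s - C * N s) * exp (- C * s)"] conjI mult_nonpos_nonneg) auto
  qed
  moreover have "N t * exp (C * t) \<le> N 0 * exp (C * 0)" if "t \<le> 0"
  proof (rule DERIV_nonneg_imp_nondecreasing[OF that, of "\<lambda>t. N t * exp (C * t)"])
    show "\<exists>y. ((\<lambda>t. N t * exp (C * t)) has_real_derivative y) (at s) \<and> 0 \<le> y" for s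
      using 2[of s] bound[of s] by (intro exI[of _ "(N' s + C * N s) * exp (C * s)"] conjI mult_nonneg_nonneg) auto
  qed
  ultimately have "N t \<le> 0"
    by (cases "0 \<le> t") (auto simp: N0 mult_le_0_iff)
  then show ?thesis using nonneg[of t] by simp
qed

lemma has_real_derivative_inner:
  fixes a b :: "real \<Rightarrow> 'a::real_inner"
  assumes "(a has_vector_derivative a') (at t within S)" "(b has_vector_derivative b') (at t within S)"
  shows "((\<lambda>s. a s \<bullet> b s) has_real_derivative a t \<bullet> b' + a' \<bullet> b t) (at t within S)"
proof -
  have "(\<lambda>h. a t \<bullet> (h *\<^sub>R b') + (h *\<^sub>R a') \<bullet> b t) = (*) (a t \<bullet> b' + a' \<bullet> b t)"
    by (auto simp: algebra_simps)
  then show ?thesis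
    using has_derivative_inner[OF assms[unfolded has_vector_derivative_def]]
    unfolding has_field_derivative_def by simp
qed

lemma S2_component_le: "x \<in> S2 \<Longrightarrow> \<bar>x $ 3\<bar> \<le> 1"
  using component_le_norm_cart[of x 3] by simp

lemma S2_inner_self: "x \<in> S2 \<Longrightarrow> x \<bullet> x = 1"
  by (simp add: norm_eq_1)

lemma continuous_normalized_field:
  assumes "continuous_on UNIV g"
  shows "continuous_on UNIV (normalized_field g)"
  unfolding normalized_field_def case_prod_beta
  by (intro continuous_intros continuous_on_compose2[OF assms]) auto

lemma norm_energy_surface_le:
  assumes p: "p \<in> energy_surface F M" and F: "\<And>z. z \<in> {-1..1} \<Longrightarrow> 0 \<le> F z"
  shows "norm p \<le> 2 + M"
proof -
  obtain x v \<mu> where p_eq: "p = ((x, v), \<mu>)" by (metis surj_pair)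
  then have xv: "norm x = 1" "v \<bullet> v + \<mu> * F (x$3) = 1" "0 \<le> \<mu>" "\<mu> \<le> M"
    using p by (auto simp: energy_surface_def)
  have "0 \<le> F (x$3)" using F S2_component_le[of x] xv(1) by (simp add: abs_le_iff)
  then have "v \<bullet> v \<le> 1" using xv mult_nonneg_nonneg[of \<mu> "F (x$3)"] by linarith
  then have "norm v \<le> 1" by (simp add: norm_eq_sqrt_inner)
  then show ?thesis
    using norm_Pair_le[of "(x, v)" \<mu>] norm_Pair_le[of x v] xv by (simp add: p_eq)
qed

text \<open>The cutoff multiplies the whole field by a scalar, so the constraints and the energy are
  invariant for the cut-off field too. Its solutions therefore stay on the energy surface, where the
  cutoff is 1.\<close>

lemma normalized_solution_exists:
  assumes g: "continuous_on UNIV g"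
    and F: "\<And>z. z \<in> {-1..1} \<Longrightarrow> (F has_real_derivative g z) (at z)" "\<And>z. z \<in> {-1..1} \<Longrightarrow> 0 \<le> F z"
    and p0: "p0 \<in> energy_surface F M"
  obtains y where "y 0 = p0" "\<And>t. (y has_vector_derivative normalized_field g (y t)) (at t)"
    "\<And>t. y t \<in> energy_surface F M"
proof -
  define r where "r = 2 + M"
  define G where "G p = cutoff r p *\<^sub>R normalized_field g p" for p
  obtain B where "\<And>p. norm (G p) \<le> B"
    unfolding G_def using cutoff_scaleR_bounded[OF continuous_normalized_field[OF g], of r] by blast
  moreover have "continuous_on UNIV G"
    unfolding G_def by (intro continuous_on_scaleR continuous_on_cutoff continuous_normalized_field g)
  ultimately obtain y where y: "y 0 = p0" "\<And>t. (y has_vector_derivative G (y t)) (at t)"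
    using peano[where F = G and ?y0.0 = p0] by blast
  define x v \<mu> c where "x t = fst (fst (y t))" and "v t = snd (fst (y t))" and "\<mu> t = snd (y t)"
    and "c t = cutoff r (y t)" for t
  have y_eq: "y t = ((x t, v t), \<mu> t)" for t by (simp add: x_def v_def \<mu>_def)
  define a where "a t = - (\<mu> t / 2 * g (x t $ 3))" for t
  have G: "G (y t) = ((c t *\<^sub>R v t, c t *\<^sub>R (a t *\<^sub>R (axis 3 1 - x t $ 3 *\<^sub>R x t) - (v t \<bullet> v t) *\<^sub>R x t)), 0)" for t
    by (simp add: G_def c_def y_eq normalized_field_def a_def)
  have y1: "((\<lambda>t. fst (y t)) has_vector_derivative fst (G (y t))) (at t)" for t
    by (rule bounded_linear.has_vector_derivative[OF bounded_linear_fst y(2)])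
  have x': "(x has_vector_derivative c t *\<^sub>R v t) (at t)" for t
    using bounded_linear.has_vector_derivative[OF bounded_linear_fst y1[of t]] by (simp add: x_def[abs_def] G)
  have v': "(v has_vector_derivative c t *\<^sub>R (a t *\<^sub>R (axis 3 1 - x t $ 3 *\<^sub>R x t) - (v t \<bullet> v t) *\<^sub>R x t)) (at t)" for t
    using bounded_linear.has_vector_derivative[OF bounded_linear_snd y1[of t]] by (simp add: v_def[abs_def] G)
  have \<mu>': "(\<mu> has_real_derivative 0) (at t)" for t
    using bounded_linear.has_vector_derivative[OF bounded_linear_snd y(2)[of t]]
    by (simp add: \<mu>_def[abs_def] G has_real_derivative_iff_has_vector_derivative)
  then have \<mu>: "\<mu> t = \<mu> 0" for t by (metis DERIV_isconst_all)
  have init: "x 0 \<in> S2" "v 0 \<bullet> x 0 = 0" "v 0 \<bullet> v 0 + \<mu> 0 * F (x 0 $ 3) = 1" "0 \<le> \<mu> 0" "\<mu> 0 \<le> M"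
    using p0 y(1) y_eq[of 0] by (auto simp: energy_surface_def)

  \<comment> \<open>The defects \<open>u\<close> of \<open>x \<bullet> x = 1\<close> and
    \<open>w\<close> of \<open>v \<bullet> x = 0\<close> solve the linear system
    \<open>u' = 2 * c * w\<close>, \<open>w' = c * \<kappa> * u\<close>, whose coefficients are
    bounded thanks to the cutoff.\<close>
  define \<kappa> :: "normalized_state \<Rightarrow> real" where "\<kappa> = (\<lambda>((x, v), \<mu>). - (v \<bullet> v) + \<mu> / 2 * g (x$3) * x$3)"
  have "continuous_on UNIV \<kappa>"
    unfolding \<kappa>_def case_prod_beta by (intro continuous_intros continuous_on_compose2[OF g]) auto
  then obtain C where C: "0 \<le> C" "\<And>p. norm (cutoff r p *\<^sub>R \<kappa> p) \<le> C"
    using cutoff_scaleR_bounded[of \<kappa> r] by auto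
  define u w where "u t = x t \<bullet> x t - 1" and "w t = v t \<bullet> x t" for t
  have u': "(u has_real_derivative 2 * c t * w t) (at t)" for t
    unfolding u_def[abs_def] w_def
    by (auto intro!: derivative_eq_intros has_real_derivative_inner x' simp: inner_commute)
  have w': "(w has_real_derivative c t * \<kappa> (y t) * u t) (at t)" for t
  proof -
    have "(w has_real_derivative v t \<bullet> (c t *\<^sub>R v t) +
        (c t *\<^sub>R (a t *\<^sub>R (axis 3 1 - x t $ 3 *\<^sub>R x t) - (v t \<bullet> v t) *\<^sub>R x t)) \<bullet> x t) (at t)"
      unfolding w_def[abs_def] by (intro has_real_derivative_inner x' v')
    moreover have "v t \<bullet> (c t *\<^sub>R v t) +
        (c t *\<^sub>R (a t *\<^sub>R (axis 3 1 - x t $ 3 *\<^sub>R x t) - (v t \<bullet> v t) *\<^sub>R x t)) \<bullet> x t = c t * \<kappa> (y t) * u t"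
      by (simp add: inner_diff_left inner_axis' u_def \<kappa>_def y_eq a_def) (simp add: field_simps)
    ultimately show ?thesis by simp
  qed
  define N where "N t = u t * u t + w t * w t" for t
  have "N t = 0" for t
  proof (rule gronwall_zero[of N "\<lambda>t. 2 * u t * (2 * c t * w t) + 2 * w t * (c t * \<kappa> (y t) * u t)" "2 + C"])
    show "(N has_real_derivative 2 * u t * (2 * c t * w t) + 2 * w t * (c t * \<kappa> (y t) * u t)) (at t)" for t
      unfolding N_def[abs_def] by (auto intro!: derivative_eq_intros u' w')
    show "\<bar>2 * u t * (2 * c t * w t) + 2 * w t * (c t * \<kappa> (y t) * u t)\<bar> \<le> (2 + C) * N t" for t
    proof -
      have c: "0 \<le> c t" "c t \<le> 1" using cutoff_bounds by (auto simp: c_def)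
      have k: "\<bar>c t * \<kappa> (y t)\<bar> \<le> C" using C(2)[of "y t"] by (simp add: c_def)
      have uw: "\<bar>2 * u t * w t\<bar> \<le> N t"
        using sum_squares_ge_zero[of "u t - w t" 0] sum_squares_ge_zero[of "u t + w t" 0]
        by (simp add: N_def abs_le_iff algebra_simps)
      have "2 * u t * (2 * c t * w t) + 2 * w t * (c t * \<kappa> (y t) * u t) = (2 * c t + c t * \<kappa> (y t)) * (2 * u t * w t)"
        by (simp add: algebra_simps)
      then have "\<bar>2 * u t * (2 * c t * w t) + 2 * w t * (c t * \<kappa> (y t) * u t)\<bar> = \<bar>2 * c t + c t * \<kappa> (y t)\<bar> * \<bar>2 * u t * w t\<bar>"
        by (simp add: abs_mult)
      also have "\<dots> \<le> (2 + C) * N t" using c k uw C(1) by (intro mult_mono) auto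
      finally show ?thesis .
    qed
    show "N 0 = 0" using init by (simp add: N_def u_def w_def S2_inner_self)
    show "0 \<le> N t" for t by (simp add: N_def)
  qed
  then have "u t = 0" "w t = 0" for t by (simp_all add: N_def sum_squares_eq_zero_iff)
  then have xx: "x t \<bullet> x t = 1" and vx: "v t \<bullet> x t = 0" for t by (simp_all add: u_def w_def)
  have xS: "x t \<in> S2" for t using xx by (simp add: norm_eq_1)
  \<comment> \<open>With \<open>v \<bullet> x = 0\<close> available, the reaction does no work and
    the work of the force cancels the change of potential.\<close>
  have "v t \<bullet> v t + \<mu> t * F (x t $ 3) = v 0 \<bullet> v 0 + \<mu> 0 * F (x 0 $ 3)" for t
  proof (rule DERIV_isconst_all[of "\<lambda>t. v t \<bullet> v t + \<mu> t * F (x t $ 3)"], rule allI)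
    fix t
    have "((\<lambda>t. x t $ 3) has_real_derivative c t * v t $ 3) (at t)"
      using bounded_linear.has_vector_derivative[OF bounded_linear_vec_nth x'[of t]]
      by (simp add: has_real_derivative_iff_has_vector_derivative)
    note x3' = this
    have "(F has_real_derivative g (x t $ 3)) (at (x t $ 3))"
      using S2_component_le[OF xS[of t]] by (intro F) (auto simp: abs_le_iff)
    from DERIV_chain2[OF this x3']
    have "((\<lambda>t. F (x t $ 3)) has_real_derivative g (x t $ 3) * (c t * v t $ 3)) (at t)" .
    then have "((\<lambda>t. v t \<bullet> v t + \<mu> t * F (x t $ 3)) has_real_derivative
      (v t \<bullet> (c t *\<^sub>R (a t *\<^sub>R (axis 3 1 - x t $ 3 *\<^sub>R x t) - (v t \<bullet> v t) *\<^sub>R x t)) +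
       (c t *\<^sub>R (a t *\<^sub>R (axis 3 1 - x t $ 3 *\<^sub>R x t) - (v t \<bullet> v t) *\<^sub>R x t)) \<bullet> v t) +
      (0 * F (x t $ 3) + g (x t $ 3) * (c t * v t $ 3) * \<mu> t)) (at t)"
      by (intro DERIV_add DERIV_mult has_real_derivative_inner v' \<mu>')
    moreover have "v t \<bullet> (axis 3 1 - x t $ 3 *\<^sub>R x t) = v t $ 3" "x t \<bullet> v t = 0" "(axis 3 1 - x t $ 3 *\<^sub>R x t) \<bullet> v t = v t $ 3"
      using vx[of t] by (simp_all add: inner_diff_right inner_diff_left inner_axis inner_axis' inner_commute)
    ultimately show "((\<lambda>t. v t \<bullet> v t + \<mu> t * F (x t $ 3)) has_real_derivative 0) (at t)"
      by (simp add: inner_diff_left[of "a t *\<^sub>R _"] inner_diff_right[of _ "a t *\<^sub>R _"] vx a_def algebra_simps)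
  qed
  then have energy: "v t \<bullet> v t + \<mu> t * F (x t $ 3) = 1" for t using init by simp
  have K: "y t \<in> energy_surface F M" for t
    using energy[of t] init xS[of t] vx[of t] \<mu>[of t] by (simp add: energy_surface_def y_eq)
  have "G (y t) = normalized_field g (y t)" for t
    using norm_energy_surface_le[OF K F(2)] by (simp add: G_def cutoff_eq_1 r_def)
  then show thesis using that[of y] y K by simp
qed


section \<open>Trajectories meet the control region\<close>

text \<open>The signed angular velocity on the meridian is \<open>v\<^sub>3 / sqrt (1 - z\<^sup>2)\<close>.\<close>

lemma meridian_solution_leaves_band:
  fixes x v :: "real \<Rightarrow> real^3"
  assumes x': "\<And>t. 0 < t \<Longrightarrow> (x has_vector_derivative v t) (at t)"
    and v': "\<And>t. 0 < t \<Longrightarrow> (v has_vector_derivative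
      - (\<mu> / 2 * g (x t $ 3)) *\<^sub>R (axis 3 1 - x t $ 3 *\<^sub>R x t) - (v t \<bullet> v t) *\<^sub>R x t) (at t)"
    and xS: "\<And>t. 0 < t \<Longrightarrow> x t \<bullet> x t = 1" and vx: "\<And>t. 0 < t \<Longrightarrow> v t \<bullet> x t = 0"
    and speed: "\<And>t. 0 < t \<Longrightarrow> v t \<bullet> v t \<le> 1" and speed0: "\<And>t. \<mu> = 0 \<Longrightarrow> 0 < t \<Longrightarrow> v t \<bullet> v t = 1"
    and \<mu>: "0 \<le> \<mu>" and g: "continuous_on UNIV g" "\<And>z. z \<in> {-1<..<1} \<Longrightarrow> 0 < g z"
    and flat: "\<And>t. 0 < t \<Longrightarrow> x t $ 1 * v t $ 2 - x t $ 2 * v t $ 1 = 0"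
    and b: "0 \<le> b" "b < 1" and band: "\<And>t. 0 < t \<Longrightarrow> \<bar>x t $ 3\<bar> \<le> b"
  shows False
proof -
  define z where "z t = x t $ 3" for t
  define r where "r t = sqrt (1 - z t * z t)" for t
  define W where "W t = v t $ 3 / r t" for t
  define \<delta> where "\<delta> = sqrt (1 - b * b)"
  have bb: "b * b < 1" using b mult_strict_mono[of b 1 b 1] by (cases "b = 0") auto
  then have \<delta>: "0 < \<delta>" by (simp add: \<delta>_def)
  have zz: "z t * z t \<le> b * b" if "0 < t" for t
    using band[OF that] b abs_mult_self_eq[of "z t"] mult_mono[of "\<bar>z t\<bar>" b "\<bar>z t\<bar>" b] by (simp add: z_def)
  have r\<delta>: "\<delta> \<le> r t" if "0 < t" for t using zz[OF that] by (simp add: \<delta>_def r_def)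
  have r0: "0 < r t" if "0 < t" for t using r\<delta>[OF that] \<delta> by linarith
  have rr: "r t * r t = 1 - z t * z t" if "0 < t" for t
    using zz[OF that] bb by (simp add: r_def)
  have z': "(z has_real_derivative v t $ 3) (at t)" if "0 < t" for t
    using bounded_linear.has_vector_derivative[OF bounded_linear_vec_nth x'[OF that]]
    by (simp add: z_def[abs_def] has_real_derivative_iff_has_vector_derivative)
  have v3': "((\<lambda>t. v t $ 3) has_real_derivative - (\<mu> / 2 * g (z t)) * (r t * r t) - (v t \<bullet> v t) * z t) (at t)" if "0 < t" for t
    using bounded_linear.has_vector_derivative[OF bounded_linear_vec_nth[of 3] v'[OF that]]
    by (simp add: z_def has_real_derivative_iff_has_vector_derivative rr[OF that])
  have v3: "v t $ 3 * v t $ 3 = (v t \<bullet> v t) * (r t * r t)" if t: "0 < t" for t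
  proof -
    define x1 x2 v1 v2 v3 where "x1 = x t $ 1" and "x2 = x t $ 2" and "v1 = v t $ 1" and "v2 = v t $ 2" and "v3 = v t $ 3"
    note defs = x1_def x2_def v1_def v2_def v3_def
    have 1: "x1 * x1 + x2 * x2 = r t * r t"
      using xS[OF t] by (simp add: inner_vec_def sum_3 rr[OF t] defs z_def)
    have 2: "x1 * v1 + x2 * v2 = - (z t * v3)"
      using vx[OF t] by (simp add: inner_vec_def sum_3 defs z_def algebra_simps)
    have 3: "x1 * v2 - x2 * v1 = 0" using flat[OF t] by (simp add: defs)
    have 4: "v t \<bullet> v t = v1 * v1 + v2 * v2 + v3 * v3" by (simp add: inner_vec_def sum_3 defs)
    \<comment> \<open>Lagrange's identity for the horizontal parts: with zero angular momentum they
      are parallel, so the speed is determined by the vertical component.\<close>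
    have "(x1 * x1 + x2 * x2) * (v1 * v1 + v2 * v2) = (x1 * v1 + x2 * v2) * (x1 * v1 + x2 * v2) + (x1 * v2 - x2 * v1) * (x1 * v2 - x2 * v1)"
      by (simp add: algebra_simps)
    then have "(r t * r t) * (v1 * v1 + v2 * v2) = (z t * z t) * (v3 * v3)" unfolding 1 2 3 by simp
    then have "(r t * r t) * (v t \<bullet> v t) = (r t * r t + z t * z t) * (v3 * v3)" unfolding 4 by (simp add: algebra_simps)
    then show ?thesis using rr[OF t] by (simp add: v3_def mult.commute)
  qed
  have W2: "W t * W t = v t \<bullet> v t" if "0 < t" for t
    using v3[OF that] r0[OF that] by (simp add: W_def)
  have W1: "\<bar>W t\<bar> \<le> 1" if "0 < t" for t
    using W2[OF that] speed[OF that] by (simp add: abs_square_le_1[unfolded power2_eq_square, symmetric])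
  have W': "(W has_real_derivative - (\<mu> / 2 * g (z t)) * r t) (at t)" if t: "0 < t" for t
  proof -
    have "((\<lambda>t. 1 - z t * z t) has_real_derivative - 2 * z t * v t $ 3) (at t)"
      by (auto intro!: derivative_eq_intros z'[OF t])
    from DERIV_chain2[of sqrt, OF DERIV_real_sqrt this] rr[OF t] r0[OF t]
    have "(r has_real_derivative inverse (r t) / 2 * (- 2 * z t * v t $ 3)) (at t)"
      unfolding r_def[abs_def] by (metis mult_pos_pos r_def)
    from DERIV_divide[OF v3'[OF t] this]
    have "(W has_real_derivative ((- (\<mu> / 2 * g (z t)) * (r t * r t) - (v t \<bullet> v t) * z t) * r t
        - v t $ 3 * (inverse (r t) / 2 * (- 2 * z t * v t $ 3))) / (r t * r t)) (at t)"
      using r0[OF t] by (simp add: W_def[abs_def])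
    moreover have "v t $ 3 * (inverse (r t) / 2 * (- 2 * z t * v t $ 3)) = - (z t * (v t $ 3 * v t $ 3) * inverse (r t))"
      by simp
    moreover have "\<dots> = - (z t * (v t \<bullet> v t) * r t)"
      using v3[OF t] r0[OF t] by (simp add: field_simps)
    ultimately have "(W has_real_derivative ((- (\<mu> / 2 * g (z t)) * (r t * r t) - (v t \<bullet> v t) * z t) * r t
        - (- (z t * (v t \<bullet> v t) * r t))) / (r t * r t)) (at t)"
      by metis
    moreover have "((- (\<mu> / 2 * g (z t)) * (r t * r t) - (v t \<bullet> v t) * z t) * r t
        - (- (z t * (v t \<bullet> v t) * r t))) / (r t * r t) = - (\<mu> / 2 * g (z t)) * r t"
      using r0[OF t] by (simp add: field_simps)
    ultimately show ?thesis by metis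
  qed
  show False
  proof (cases "\<mu> = 0")
    case True
    have "(W has_real_derivative 0) (at t)" if "0 < t" for t using W'[OF that] True by simp
    then obtain c where c: "\<And>t. 0 < t \<Longrightarrow> W t = c"
      using has_field_derivative_zero_constant[of "{0<..}" W] by (auto intro: has_field_derivative_at_within)
    have cc: "c * c = 1" using W2[of 1] speed0[of 1] True c[of 1] by simp
    \<comment> \<open>Along the geodesic the height moves monotonically at rate at least \<delta>,
      hence by 3 in this time, while the band allows less than 2. Time 1 stands for the start, since
      nothing is assumed at time 0.\<close>
    define T where "T = 3 / \<delta>"
    have T: "0 < T" using \<delta> by (simp add: T_def)
    have "((\<lambda>t. c * z t) has_real_derivative r t) (at t)" if "0 < t" for t
    proof -
      have "v t $ 3 = c * r t" using c[OF that] r0[OF that] by (simp add: W_def field_simps)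
      then have "c * v t $ 3 = (c * c) * r t" by simp
      then show ?thesis using DERIV_cmult[OF z'[OF that], of c] cc by simp
    qed
    then obtain s where s: "1 < s" "c * z (1 + T) - c * z 1 = (1 + T - 1) * r s"
      using MVT2[of 1 "1 + T" "\<lambda>t. c * z t" r] T by auto
    have "3 = T * \<delta>" using \<delta> by (simp add: T_def)
    also have "\<dots> \<le> T * r s" using r\<delta>[of s] s(1) T by simp
    also have "\<dots> = c * z (1 + T) - c * z 1" using s(2) by simp
    also have "\<dots> \<le> \<bar>c\<bar> * \<bar>z (1 + T)\<bar> + \<bar>c\<bar> * \<bar>z 1\<bar>" by (simp add: abs_mult[symmetric])
    also have "\<bar>c\<bar> = 1" using cc by (auto simp: square_eq_1_iff)
    finally show False using band[of "1 + T"] band[of 1] T b by (simp add: z_def)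
  next
    case False
    have "compact {-b..b}" "{-b..b} \<noteq> {}" using b by auto
    then obtain m where m: "m \<in> {-b..b}" "\<And>w. w \<in> {-b..b} \<Longrightarrow> g m \<le> g w"
      using continuous_attains_inf[of "{-b..b}" g] g(1) by (metis continuous_on_subset subset_UNIV)
    define \<kappa> where "\<kappa> = \<mu> / 2 * g m * \<delta>"
    have gm: "0 < g m" using m(1) b by (intro g) auto
    have \<kappa>: "0 < \<kappa>" using gm \<delta> False \<mu> by (simp add: \<kappa>_def)
    \<comment> \<open>\<open>W\<close> decreases at rate at least \<kappa>, the infimum of the force
      over the band times the least radius; a drop by 3 contradicts
      \<open>\<bar>W t\<bar> \<le> 1\<close>.\<close>
    define T where "T = 3 / \<kappa>"
    have T: "0 < T" using \<kappa> by (simp add: T_def)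
    obtain s where s: "1 < s" "W (1 + T) - W 1 = (1 + T - 1) * (- (\<mu> / 2 * g (z s)) * r s)"
      using MVT2[of 1 "1 + T" W "\<lambda>t. - (\<mu> / 2 * g (z t)) * r t"] T W' by auto
    have "z s \<in> {-b..b}" using band[of s] s(1) by (auto simp: z_def abs_le_iff)
    then have "\<mu> / 2 * g m * \<delta> \<le> \<mu> / 2 * g (z s) * r s"
      using m(2)[of "z s"] gm \<mu> r\<delta>[of s] s(1) \<delta> by (intro mult_mono) auto
    then have "T * \<kappa> \<le> T * (\<mu> / 2 * g (z s) * r s)" using T by (simp add: \<kappa>_def)
    moreover have "T * \<kappa> = 3" using \<kappa> by (simp add: T_def)
    ultimately have "W (1 + T) - W 1 \<le> - 3" using s(2) by simp
    then show False using W1[of 1] W1[of "1 + T"] T by (simp add: abs_le_iff)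
  qed
qed

section \<open>Nonzero angular momentum: crossing a path between the poles\<close>

text \<open>An arc from pole to pole inside \<omega> is injective, so it meets the poles only at its
  ends. Trimming the ends keeps it off the axis, where no longitude exists, while its endpoints
  still lie beyond the band.\<close>

lemma path_in_open_subset_of_S2:
  assumes op: "openin (top_of_set S2) \<omega>" and conn: "connected \<omega>" and poles: "{south_pole, north_pole} \<subseteq> \<omega>"
    and b: "0 \<le> b" "b < 1"
  obtains p a c where "a \<le> (c::real)" "continuous_on {a..c} p" "p ` {a..c} \<subseteq> \<omega>"
    "\<And>s. s \<in> {a..c} \<Longrightarrow> \<not> (p s $ 1 = 0 \<and> p s $ 2 = (0::real))" "p a $ 3 < - b" "b < p c $ 3"
proof -
  have lpc: "locally path_connected \<omega>"
    by (rule locally_open_subset[OF _ op]) (rule locally_path_connected_sphere)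
  have "path_connected \<omega>" using conn
    by (simp add: path_connected_component_set path_component_eq_connected_component_set[OF lpc] connected_iff_eq_connected_component_set)
  moreover have "south_pole \<noteq> north_pole"
    by (auto simp: south_pole_def north_pole_def vec_eq_iff forall_3 axis_def)
  ultimately have "\<exists>p. arc p \<and> path_image p \<subseteq> \<omega> \<and> pathstart p = south_pole \<and> pathfinish p = north_pole"
    using poles by (auto simp: path_connected_arcwise)
  then obtain p where p: "arc p" "path_image p \<subseteq> \<omega>" "pathstart p = south_pole" "pathfinish p = north_pole"
    by blast
  have cont: "continuous_on {0..1} p" and inj: "inj_on p {0..1}"
    using p(1) by (auto simp: arc_def path_def)
  have p0: "p 0 = south_pole" and p1: "p 1 = north_pole" using p(3,4) by (auto simp: pathstart_def pathfinish_def)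
  have cont3: "continuous_on {0..1} (\<lambda>s. p s $ 3)" using cont by (intro continuous_intros)
  have ev0: "\<forall>\<^sub>F s in at 0 within {0..1}. p s $ 3 < - b"
    by (rule order_tendstoD(2)[OF continuous_on_tendsto_compose[OF cont3 tendsto_ident_at]])
       (use b in \<open>auto simp: p0 south_pole_def eventually_at_filter\<close>)
  have ev1: "\<forall>\<^sub>F s in at 1 within {0..1}. b < p s $ 3"
    by (rule order_tendstoD(1)[OF continuous_on_tendsto_compose[OF cont3 tendsto_ident_at]])
       (use b in \<open>auto simp: p1 north_pole_def eventually_at_filter\<close>)
  obtain d0 where d0: "0 < d0" "\<And>s. s \<in> {0..1} \<Longrightarrow> s \<noteq> 0 \<Longrightarrow> dist s 0 < d0 \<Longrightarrow> p s $ 3 < - b"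
    using ev0 unfolding eventually_at by auto
  obtain d1 where d1: "0 < d1" "\<And>s. s \<in> {0..1} \<Longrightarrow> s \<noteq> 1 \<Longrightarrow> dist s 1 < d1 \<Longrightarrow> b < p s $ 3"
    using ev1 unfolding eventually_at by auto
  \<comment> \<open>Halving stays strictly within the radii found at the ends; \<open>1 / 3\<close>
    keeps the two trimming points in order.\<close>
  define a where "a = min (d0 / 2) (1 / 3)"
  define c where "c = 1 - min (d1 / 2) (1 / 3)"
  have a: "0 < a" "a < d0" "a \<le> 1/3" using d0(1) by (auto simp: a_def)
  have c: "c < 1" "1 - c < d1" "2/3 \<le> c" using d1(1) by (auto simp: c_def)
  have ac: "a \<le> c" "{a..c} \<subseteq> {0..1}" using a c by auto
  show thesis
  proof (rule that[OF ac(1)])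
    show "continuous_on {a..c} p" by (rule continuous_on_subset[OF cont ac(2)])
    show "p ` {a..c} \<subseteq> \<omega>" using p(2) ac(2) by (auto simp: path_image_def)
    show "p a $ 3 < - b" using d0(2)[of a] a by (auto simp: dist_real_def)
    show "b < p c $ 3" using d1(2)[of c] c by (auto simp: dist_real_def)
    fix s assume s: "s \<in> {a..c}"
    show "\<not> (p s $ 1 = 0 \<and> p s $ 2 = 0)"
    proof
      assume 0: "p s $ 1 = 0 \<and> p s $ 2 = 0"
      have "p s \<in> S2" using openin_imp_subset[OF op] p(2) s ac(2) unfolding path_image_def by blast
      then have "p s $ 3 * p s $ 3 = 1" using 0 by (simp add: norm_eq_1 inner_vec_def sum_3)
      then have "p s $ 3 = 1 \<or> p s $ 3 = -1" by (simp add: square_eq_1_iff)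
      then have "p s = p 1 \<or> p s = p 0"
        using 0 by (auto simp: p0 p1 south_pole_def north_pole_def vec_eq_iff forall_3 axis_def)
      then have "s = 1 \<or> s = 0" using inj s ac(2) by (auto dest!: inj_onD)
      then show False using s a c by auto
    qed
  qed
qed

text \<open>In the plane of lifted longitude and height the trajectory is a graph, and the lifted
  path runs from below the band to above it. The intermediate value theorem for the height
  difference at equal longitude gives a crossing.\<close>

lemma winding_curve_meets_open_set:
  fixes x v :: "real \<Rightarrow> real^3"
  assumes x': "\<And>t. 0 < t \<Longrightarrow> (x has_vector_derivative v t) (at t)"
    and xS: "\<And>t. 0 < t \<Longrightarrow> x t \<bullet> x t = 1" and vx: "\<And>t. 0 < t \<Longrightarrow> v t \<bullet> x t = 0"
    and j: "\<And>t. 0 < t \<Longrightarrow> x t $ 1 * v t $ 2 - x t $ 2 * v t $ 1 = j" "j \<noteq> 0"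
    and b: "0 \<le> b" "b < 1" and band: "\<And>t. 0 < t \<Longrightarrow> \<bar>x t $ 3\<bar> \<le> b"
    and op: "openin (top_of_set S2) \<omega>" and conn: "connected \<omega>" and poles: "{south_pole, north_pole} \<subseteq> \<omega>"
  obtains t where "0 < t" "x t \<in> \<omega>"
proof -
  \<comment> \<open>Reflecting the second coordinate by \<sigma> makes the longitude of the
    trajectory increasing in either case.\<close>
  define \<sigma> where "\<sigma> = sgn j"
  have \<sigma>: "\<sigma> * \<sigma> = 1" "\<sigma> * j = \<bar>j\<bar>" using j(2) by (auto simp: \<sigma>_def sgn_real_def)
  define z where "z t = x t $ 3" for t
  define r where "r t = sqrt (1 - z t * z t)" for t
  have bb: "b * b < 1" using b mult_strict_mono[of b 1 b 1] by (cases "b = 0") auto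
  have zz: "z t * z t \<le> b * b" if "0 < t" for t
    using band[OF that] b abs_mult_self_eq[of "z t"] mult_mono[of "\<bar>z t\<bar>" b "\<bar>z t\<bar>" b] by (simp add: z_def)
  have r0: "0 < r t" and rr: "r t * r t = 1 - z t * z t" if "0 < t" for t
    using zz[OF that] bb by (auto simp: r_def)
  have x12: "x t $ 1 * x t $ 1 + x t $ 2 * x t $ 2 = r t * r t" if "0 < t" for t
    using xS[OF that] by (simp add: rr[OF that] inner_vec_def sum_3 z_def)
  have comp': "((\<lambda>t. x t $ i) has_real_derivative v t $ i) (at t)" if "0 < t" for i t
    using bounded_linear.has_vector_derivative[OF bounded_linear_vec_nth x'[OF that]]
    by (simp add: has_real_derivative_iff_has_vector_derivative)
  then have z': "(z has_real_derivative v t $ 3) (at t)" if "0 < t" for t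
    using that by (simp add: z_def[abs_def])
  define k where "k t = inverse (r t)" for t
  have k': "(k has_real_derivative z t * v t $ 3 * (k t * k t * k t)) (at t)" if t: "0 < t" for t
  proof -
    have "((\<lambda>t. 1 - z t * z t) has_real_derivative - 2 * z t * v t $ 3) (at t)"
      by (auto intro!: derivative_eq_intros z'[OF t])
    moreover have "(sqrt has_real_derivative inverse (r t) / 2) (at (1 - z t * z t))"
      using DERIV_real_sqrt[of "1 - z t * z t"] mult_pos_pos[OF r0[OF t] r0[OF t]] rr[OF t] by (simp add: r_def)
    ultimately have "(r has_real_derivative inverse (r t) / 2 * (- 2 * z t * v t $ 3)) (at t)"
      unfolding r_def[abs_def] by (rule DERIV_chain2[rotated])
    from DERIV_inverse'[OF this] r0[OF t] show ?thesis
      unfolding k_def[abs_def] by (auto elim!: DERIV_cong simp: field_simps)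
  qed
  \<comment> \<open>Next, the horizontal velocity is solved from its inner product with the
    horizontal position, known from \<open>v \<bullet> x = 0\<close>, and from its angular momentum
    \<open>j\<close>.\<close>
  have kr: "k t * r t = 1" if "0 < t" for t using r0[OF that] by (simp add: k_def)
  have v12: "v t $ 1 = (- (z t * v t $ 3) * x t $ 1 - j * x t $ 2) * (k t * k t)"
    "v t $ 2 = (- (z t * v t $ 3) * x t $ 2 + j * x t $ 1) * (k t * k t)" if t: "0 < t" for t
  proof -
    have d: "x t $ 1 * v t $ 1 + x t $ 2 * v t $ 2 = - (z t * v t $ 3)"
      using vx[OF t] by (simp add: inner_vec_def sum_3 z_def algebra_simps)
    have kk: "(x t $ 1 * x t $ 1 + x t $ 2 * x t $ 2) * (k t * k t) = 1"
      using kr[OF t] unfolding x12[OF t] by (metis mult.assoc mult.commute mult_1)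
    have "v t $ 1 * ((x t $ 1 * x t $ 1 + x t $ 2 * x t $ 2) * (k t * k t)) =
      ((x t $ 1 * v t $ 1 + x t $ 2 * v t $ 2) * x t $ 1 - (x t $ 1 * v t $ 2 - x t $ 2 * v t $ 1) * x t $ 2) * (k t * k t)"
      by (simp add: algebra_simps)
    then show "v t $ 1 = (- (z t * v t $ 3) * x t $ 1 - j * x t $ 2) * (k t * k t)"
      unfolding kk d j(1)[OF t] by simp
    have "v t $ 2 * ((x t $ 1 * x t $ 1 + x t $ 2 * x t $ 2) * (k t * k t)) =
      ((x t $ 1 * v t $ 1 + x t $ 2 * v t $ 2) * x t $ 2 + (x t $ 1 * v t $ 2 - x t $ 2 * v t $ 1) * x t $ 1) * (k t * k t)"
      by (simp add: algebra_simps)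
    then show "v t $ 2 = (- (z t * v t $ 3) * x t $ 2 + j * x t $ 1) * (k t * k t)"
      unfolding kk d j(1)[OF t] by simp
  qed
  obtain a c p where p: "a \<le> (c::real)" "continuous_on {a..c} p" "p ` {a..c} \<subseteq> \<omega>"
    "\<And>s. s \<in> {a..c} \<Longrightarrow> \<not> (p s $ 1 = 0 \<and> p s $ 2 = (0::real))" "p a $ 3 < - b" "b < p c $ 3"
    by (rule path_in_open_subset_of_S2[OF op conn poles b]) blast
  define P where "P s = Complex (p s $ 1) (\<sigma> * p s $ 2)" for s
  have "continuous_on {a..c} P"
    unfolding P_def Complex_eq by (intro continuous_intros p)
  moreover have "P s \<noteq> 0" if "s \<in> {a..c}" for s
    using p(4)[OF that] \<sigma>(1) by (auto simp: P_def complex_eq_iff)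
  moreover have "contractible {a..c}" by (rule convex_imp_contractible) simp
  ultimately obtain L where L: "continuous_on {a..c} L" "\<And>s. s \<in> {a..c} \<Longrightarrow> P s = exp (L s)"
    using continuous_logarithm_on_contractible by metis
  have p_exp: "p s $ 1 = exp (Re (L s)) * cos (Im (L s))" "\<sigma> * p s $ 2 = exp (Re (L s)) * sin (Im (L s))"
    if "s \<in> {a..c}" for s
    using L(2)[OF that] by (simp_all add: P_def complex_eq_iff Re_exp Im_exp)
  have p_radius: "exp (Re (L s)) = sqrt (1 - p s $ 3 * p s $ 3)" if "s \<in> {a..c}" for s
  proof -
    have "p s \<in> S2" using p(3) that openin_imp_subset[OF op] by blast
    then have "1 - p s $ 3 * p s $ 3 = p s $ 1 * p s $ 1 + (\<sigma> * \<sigma>) * (p s $ 2 * p s $ 2)"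
      by (simp add: \<sigma> norm_eq_1 inner_vec_def sum_3)
    also have "\<dots> = p s $ 1 * p s $ 1 + (\<sigma> * p s $ 2) * (\<sigma> * p s $ 2)" by (simp add: algebra_simps)
    also have "\<dots> = (exp (Re (L s)))\<^sup>2 * ((cos (Im (L s)))\<^sup>2 + (sin (Im (L s)))\<^sup>2)"
      unfolding p_exp[OF that] by algebra
    finally show ?thesis by simp
  qed
  have "x 1 $ 1 * x 1 $ 1 + (\<sigma> * x 1 $ 2) * (\<sigma> * x 1 $ 2) = x 1 $ 1 * x 1 $ 1 + (\<sigma> * \<sigma>) * (x 1 $ 2 * x 1 $ 2)"
    by (simp add: algebra_simps)
  also have "\<dots> = r 1 * r 1" using x12[of 1] by (simp add: \<sigma>)
  finally have "(x 1 $ 1 * k 1)\<^sup>2 + (\<sigma> * x 1 $ 2 * k 1)\<^sup>2 = (k 1 * r 1) * (k 1 * r 1)"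
    by algebra
  then obtain \<phi>1 where \<phi>1: "x 1 $ 1 * k 1 = cos \<phi>1" "\<sigma> * x 1 $ 2 * k 1 = sin \<phi>1"
    using sincos_total_2pi_le[of "x 1 $ 1 * k 1" "\<sigma> * x 1 $ 2 * k 1"] kr[of 1] by auto
  have "compact ((\<lambda>s. Im (L s)) ` {a..c})"
    by (intro compact_continuous_image continuous_intros L) simp
  then obtain B where "\<forall>s\<in>{a..c}. \<bar>Im (L s)\<bar> \<le> B"
    by (auto dest!: compact_imp_bounded simp: bounded_iff)
  then have B: "\<bar>Im (L s)\<bar> \<le> B" if "s \<in> {a..c}" for s using that by blast
  \<comment> \<open>Adding \<open>n\<close> full turns moves the lifted path beyond the longitude
    \<open>\<phi>1\<close> of the trajectory at time 1.\<close>
  obtain n :: nat where n: "B + \<phi>1 \<le> real n * (2 * pi)"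
    using real_arch_simple[of "(B + \<phi>1) / (2 * pi)"] by (auto simp: divide_le_eq)
  define \<theta> where "\<theta> s = Im (L s) + real n * (2 * pi)" for s
  have \<theta>_cont: "continuous_on {a..c} \<theta>" unfolding \<theta>_def by (intro continuous_intros L)
  have \<theta>_lower: "\<phi>1 \<le> \<theta> s" and \<theta>_upper: "\<theta> s \<le> B + real n * (2 * pi)" if "s \<in> {a..c}" for s
    using B[OF that] n by (auto simp: \<theta>_def abs_le_iff)
  have trig: "cos (\<theta> s) = cos (Im (L s))" "sin (\<theta> s) = sin (Im (L s))" for s
  proof -
    have "real n * (2 * pi) = 2 * real n * pi" by simp
    then have "cos (real n * (2 * pi)) = 1" "sin (real n * (2 * pi)) = 0"
      by (simp_all only: cos_2npi sin_2npi)
    then show "cos (\<theta> s) = cos (Im (L s))" "sin (\<theta> s) = sin (Im (L s))"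
      by (simp_all add: \<theta>_def cos_add sin_add)
  qed
  \<comment> \<open>Longitude speed: angular momentum divided by the squared distance to the
    axis.\<close>
  define \<phi>' where "\<phi>' t = \<bar>j\<bar> * (k t * k t)" for t
  \<comment> \<open>The distance to the axis is at most 1, so the longitude grows at rate at least
    \<open>\<bar>j\<bar>\<close>; by time \<open>T\<close> it has passed every longitude of the
    lifted path.\<close>
  define T where "T = 1 + max 0 ((B + real n * (2 * pi) - \<phi>1) / \<bar>j\<bar>)"
  have T: "1 \<le> T" "B + real n * (2 * pi) - \<phi>1 \<le> \<bar>j\<bar> * (T - 1)"
    using j(2) by (auto simp: T_def max_def field_simps)
  have k_cont: "continuous_on {1..T} k"
    by (intro continuous_at_imp_continuous_on ballI DERIV_isCont[OF k']) simp
  have z_cont: "continuous_on {1..T} z"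
    by (intro continuous_at_imp_continuous_on ballI DERIV_isCont[OF z']) simp
  have "continuous_on {1..T} \<phi>'" unfolding \<phi>'_def by (intro continuous_intros k_cont)
  then obtain \<Phi> where \<Phi>: "\<And>t. t \<in> {1..T} \<Longrightarrow> (\<Phi> has_vector_derivative \<phi>' t) (at t within {1..T})"
    by (rule antiderivative_continuous) blast
  define \<phi> where "\<phi> t = \<Phi> t - \<Phi> 1 + \<phi>1" for t
  have \<phi>: "(\<phi> has_real_derivative \<phi>' t) (at t within {1..T})" if "t \<in> {1..T}" for t
    using \<Phi>[OF that] unfolding \<phi>_def[abs_def]
    by (auto intro!: derivative_eq_intros simp: has_real_derivative_iff_has_vector_derivative[symmetric])
  have \<phi>_cont: "continuous_on {1..T} \<phi>"
    using \<phi> by (rule DERIV_continuous_on)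
  have \<phi>'_lower: "\<bar>j\<bar> \<le> \<phi>' t" if "0 < t" for t
  proof -
    have "r t \<le> 1" using rr[OF that] by (simp add: r_def)
    then have "1 \<le> k t" using r0[OF that] by (simp add: k_def one_le_inverse)
    then have "1 * 1 \<le> k t * k t" by (intro mult_mono) auto
    then show ?thesis by (simp add: \<phi>'_def mult_le_cancel_left1)
  qed
  have growth: "\<bar>j\<bar> * (u - t) \<le> \<phi> u - \<phi> t" if tu: "1 \<le> t" "t < u" "u \<le> T" for t u
  proof -
    have "\<exists>s\<in>{t<..<u}. \<phi> u - \<phi> t = (u - t) * \<phi>' s"
    proof (rule mvt_simple[of t u \<phi> "\<lambda>s h. h * \<phi>' s"])
      show "(\<phi> has_derivative (\<lambda>h. h * \<phi>' s)) (at s within {t..u})" if "t \<le> s" "s \<le> u" for s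
        using has_field_derivative_subset[OF \<phi>[of s], of "{t..u}"] that tu
        by (simp add: has_field_derivative_def mult_commute_abs)
    qed (use tu in auto)
    then obtain s where "s \<in> {t<..<u}" "\<phi> u - \<phi> t = (u - t) * \<phi>' s" by blast
    then show ?thesis
      using mult_right_mono[OF \<phi>'_lower[of s], of "u - t"] tu by (simp add: mult.commute)
  qed
  have \<phi>_inj: "inj_on \<phi> {1..T}"
  proof (rule linorder_inj_onI')
    fix t u assume "t \<in> {1..T}" "u \<in> {1..T}" "t < u"
    moreover from this have "0 < \<bar>j\<bar> * (u - t)" using j(2) by simp
    ultimately show "\<phi> t \<noteq> \<phi> u" using growth[of t u] by auto
  qed
  have \<phi>T: "B + real n * (2 * pi) \<le> \<phi> T"
    using growth[of 1 T] T by (cases "T = 1") (auto simp: \<phi>_def)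
  have range: "\<theta> s \<in> \<phi> ` {1..T}" if "s \<in> {a..c}" for s
  proof -
    have "\<phi> 1 \<le> \<theta> s" "\<theta> s \<le> \<phi> T" using \<theta>_lower[OF that] \<theta>_upper[OF that] \<phi>T by (auto simp: \<phi>_def)
    then obtain t where "1 \<le> t" "t \<le> T" "\<phi> t = \<theta> s"
      using IVT'[of \<phi> 1 "\<theta> s" T] \<phi>_cont T(1) by blast
    then show ?thesis by (intro image_eqI[of _ _ t]) auto
  qed
  define \<tau> where "\<tau> s = inv_into {1..T} \<phi> (\<theta> s)" for s
  have \<tau>: "\<tau> s \<in> {1..T}" "\<phi> (\<tau> s) = \<theta> s" if "s \<in> {a..c}" for s
    using inv_into_into[OF range[OF that]] f_inv_into_f[OF range[OF that]] by (simp_all add: \<tau>_def)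
  have "continuous_on (\<phi> ` {1..T}) (inv_into {1..T} \<phi>)"
    by (rule continuous_on_inv[OF \<phi>_cont]) (simp_all add: inv_into_f_f[OF \<phi>_inj])
  then have \<tau>_cont: "continuous_on {a..c} \<tau>"
    unfolding \<tau>_def by (rule continuous_on_compose2[OF _ \<theta>_cont]) (use range in auto)
  have polar: "x t $ 1 = r t * cos (\<phi> t)" "\<sigma> * x t $ 2 = r t * sin (\<phi> t)" if t: "t \<in> {1..T}" for t
  proof -
    \<comment> \<open>\<phi> is only the integral of the expected speed. \<open>A\<close> and
      \<open>D\<close> are the cosine and sine of the difference between the true longitude and
      \<phi>; both are constant, with values 1 and 0 at time 1.\<close>
    define A where "A t = (x t $ 1 * cos (\<phi> t) + \<sigma> * (x t $ 2 * sin (\<phi> t))) * k t" for t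
    define D where "D t = (\<sigma> * (x t $ 2 * cos (\<phi> t)) - x t $ 1 * sin (\<phi> t)) * k t" for t
    have deriv: "(A has_real_derivative 0) (at t within {1..T})" "(D has_real_derivative 0) (at t within {1..T})"
      if t: "t \<in> {1..T}" for t
    proof -
      have t0: "0 < t" using t by simp
      note comp = has_field_derivative_at_within[OF comp'[OF t0]]
      note ders = DERIV_chain2[OF DERIV_cos \<phi>[OF t]] DERIV_chain2[OF DERIV_sin \<phi>[OF t]]
      define zv where "zv = z t * v t $ 3"
      have \<phi>'_eq: "\<phi>' t = \<sigma> * j * (k t * k t)" by (simp add: \<phi>'_def \<sigma>)
      have s2: "\<sigma> * (\<sigma> * w) = w" for w using \<sigma>(1) by (simp flip: mult.assoc)
      have "(A has_real_derivative
        (v t $ 1 * cos (\<phi> t) + - sin (\<phi> t) * \<phi>' t * x t $ 1 + \<sigma> * (v t $ 2 * sin (\<phi> t) + cos (\<phi> t) * \<phi>' t * x t $ 2)) * k t +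
        zv * (k t * k t * k t) * (x t $ 1 * cos (\<phi> t) + \<sigma> * (x t $ 2 * sin (\<phi> t)))) (at t within {1..T})"
        unfolding A_def[abs_def] zv_def
        by (intro DERIV_mult DERIV_add DERIV_cmult comp ders has_field_derivative_at_within[OF k'[OF t0]])
      moreover have "(v t $ 1 * cos (\<phi> t) + - sin (\<phi> t) * \<phi>' t * x t $ 1 + \<sigma> * (v t $ 2 * sin (\<phi> t) + cos (\<phi> t) * \<phi>' t * x t $ 2)) * k t +
        zv * (k t * k t * k t) * (x t $ 1 * cos (\<phi> t) + \<sigma> * (x t $ 2 * sin (\<phi> t))) = 0"
        unfolding v12[OF t0] \<phi>'_eq zv_def[symmetric] by (simp add: algebra_simps s2)
      ultimately show "(A has_real_derivative 0) (at t within {1..T})" by metis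
      have "(D has_real_derivative
        (\<sigma> * (v t $ 2 * cos (\<phi> t) + - sin (\<phi> t) * \<phi>' t * x t $ 2) - (v t $ 1 * sin (\<phi> t) + cos (\<phi> t) * \<phi>' t * x t $ 1)) * k t +
        zv * (k t * k t * k t) * (\<sigma> * (x t $ 2 * cos (\<phi> t)) - x t $ 1 * sin (\<phi> t))) (at t within {1..T})"
        unfolding D_def[abs_def] zv_def
        by (intro DERIV_mult DERIV_add DERIV_diff DERIV_cmult comp ders has_field_derivative_at_within[OF k'[OF t0]])
      moreover have "(\<sigma> * (v t $ 2 * cos (\<phi> t) + - sin (\<phi> t) * \<phi>' t * x t $ 2) - (v t $ 1 * sin (\<phi> t) + cos (\<phi> t) * \<phi>' t * x t $ 1)) * k t +
        zv * (k t * k t * k t) * (\<sigma> * (x t $ 2 * cos (\<phi> t)) - x t $ 1 * sin (\<phi> t)) = 0"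
        unfolding v12[OF t0] \<phi>'_eq zv_def[symmetric] by (simp add: algebra_simps s2)
      ultimately show "(D has_real_derivative 0) (at t within {1..T})" by metis
    qed
    have one: "1 \<in> {1..T}" using T(1) by simp
    have const: "A t = A 1"
      using has_field_derivative_zero_constant[of "{1..T}" A, OF _ deriv(1)] t one by (metis convex_real_interval(5))
    have const': "D t = D 1"
      using has_field_derivative_zero_constant[of "{1..T}" D, OF _ deriv(2)] t one by (metis convex_real_interval(5))
    have sc: "cos \<phi>1 * cos \<phi>1 + sin \<phi>1 * sin \<phi>1 = 1" "cos (\<phi> t) * cos (\<phi> t) + sin (\<phi> t) * sin (\<phi> t) = 1"
      by (simp_all flip: power2_eq_square)
    have "A 1 = (x 1 $ 1 * k 1) * cos \<phi>1 + (\<sigma> * x 1 $ 2 * k 1) * sin \<phi>1" by (simp add: A_def \<phi>_def algebra_simps)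
    then have A1: "A 1 = 1" using sc(1) by (simp only: \<phi>1)
    have "D 1 = (\<sigma> * x 1 $ 2 * k 1) * cos \<phi>1 - (x 1 $ 1 * k 1) * sin \<phi>1" by (simp add: D_def \<phi>_def algebra_simps)
    then have D1: "D 1 = 0" by (simp only: \<phi>1) simp
    have t0: "0 < t" using t by simp
    have "A t * r t = (x t $ 1 * cos (\<phi> t) + \<sigma> * (x t $ 2 * sin (\<phi> t))) * (k t * r t)" by (simp add: A_def)
    then have A: "x t $ 1 * cos (\<phi> t) + \<sigma> * (x t $ 2 * sin (\<phi> t)) = r t" by (simp add: const A1 kr[OF t0])
    have "D t * r t = (\<sigma> * (x t $ 2 * cos (\<phi> t)) - x t $ 1 * sin (\<phi> t)) * (k t * r t)" by (simp add: D_def)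
    then have D: "\<sigma> * (x t $ 2 * cos (\<phi> t)) - x t $ 1 * sin (\<phi> t) = 0" by (simp add: const' D1 kr[OF t0])
    have "x t $ 1 * (cos (\<phi> t) * cos (\<phi> t) + sin (\<phi> t) * sin (\<phi> t)) =
      (x t $ 1 * cos (\<phi> t) + \<sigma> * (x t $ 2 * sin (\<phi> t))) * cos (\<phi> t) - (\<sigma> * (x t $ 2 * cos (\<phi> t)) - x t $ 1 * sin (\<phi> t)) * sin (\<phi> t)"
      by algebra
    then show "x t $ 1 = r t * cos (\<phi> t)" unfolding A D sc by simp
    have "\<sigma> * x t $ 2 * (cos (\<phi> t) * cos (\<phi> t) + sin (\<phi> t) * sin (\<phi> t)) =
      (x t $ 1 * cos (\<phi> t) + \<sigma> * (x t $ 2 * sin (\<phi> t))) * sin (\<phi> t) + (\<sigma> * (x t $ 2 * cos (\<phi> t)) - x t $ 1 * sin (\<phi> t)) * cos (\<phi> t)"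
      by algebra
    then show "\<sigma> * x t $ 2 = r t * sin (\<phi> t)" unfolding A D sc by simp
  qed
  \<comment> \<open>\<open>\<tau> s\<close> is the time at which the trajectory has the lifted
    longitude of \<open>p s\<close>. At equal longitude on the sphere, equal height means equal
    points.\<close>
  have "continuous_on {a..c} (\<lambda>s. p s $ 3 - z (\<tau> s))"
    using \<tau> by (intro continuous_intros p continuous_on_compose2[OF z_cont \<tau>_cont]) auto
  moreover have "p a $ 3 - z (\<tau> a) \<le> 0" "0 \<le> p c $ 3 - z (\<tau> c)"
    using band[of "\<tau> a"] band[of "\<tau> c"] \<tau>(1)[of a] \<tau>(1)[of c] p(1,5,6) by (auto simp: z_def abs_le_iff)
  ultimately obtain s where s: "a \<le> s" "s \<le> c" "p s $ 3 - z (\<tau> s) = 0"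
    using IVT'[of "\<lambda>s. p s $ 3 - z (\<tau> s)" a 0 c] p(1) by blast
  have sac: "s \<in> {a..c}" using s by simp
  define t where "t = \<tau> s"
  have t: "t \<in> {1..T}" "\<phi> t = \<theta> s" using \<tau>[OF sac] by (auto simp: t_def)
  have p3: "p s $ 3 = x t $ 3" using s(3) by (simp add: t_def z_def)
  have rad: "exp (Re (L s)) = r t" using p_radius[OF sac] p3 by (simp add: r_def z_def)
  have "p s $ 1 = x t $ 1" using p_exp(1)[OF sac] polar(1)[OF t(1)] by (simp add: rad t(2) trig)
  moreover have "\<sigma> * p s $ 2 = \<sigma> * x t $ 2" using p_exp(2)[OF sac] polar(2)[OF t(1)] by (simp add: rad t(2) trig)
  then have "p s $ 2 = x t $ 2" using \<sigma>(1) by auto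
  ultimately have "x t = p s" using p3 by (simp add: vec_eq_iff forall_3)
  then have "x t \<in> \<omega>" using p(3) sac by auto
  then show thesis using that[of t] t(1) by simp
qed

section \<open>From a single trajectory to a uniform time\<close>

text \<open>Consequently a trajectory that avoids \<omega> is confined to the band of heights
  between \<open>- b\<close> and \<open>b\<close>.\<close>

lemma polar_caps_subset:
  assumes op: "openin (top_of_set S2) \<omega>" and poles: "{south_pole, north_pole} \<subseteq> \<omega>"
  obtains b where "0 \<le> b" "b < 1" "\<And>u. u \<in> S2 \<Longrightarrow> b < \<bar>u $ 3\<bar> \<Longrightarrow> u \<in> \<omega>"
proof -
  obtain W where W: "open W" "\<omega> = S2 \<inter> W" using op by (auto simp: openin_open)
  have "north_pole \<in> W" "south_pole \<in> W" using poles W(2) by auto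
  then obtain e1 e2 where e: "0 < e1" "ball north_pole e1 \<subseteq> W" "0 < e2" "ball south_pole e2 \<subseteq> W"
    using W(1) by (meson openE)
  define e where "e = min e1 e2"
  \<comment> \<open>On the sphere the squared distance to the north pole is
    \<open>2 - 2 * u $ 3\<close>, so distance less than \<open>e\<close> means height above
    \<open>1 - e\<^sup>2 / 2\<close>; the south pole is symmetric.\<close>
  define b where "b = max 0 (1 - e\<^sup>2 / 2)"
  have e0: "0 < e" using e by (simp add: e_def)
  have "u \<in> \<omega>" if u: "u \<in> S2" "b < \<bar>u $ 3\<bar>" for u
  proof -
    have uu: "u \<bullet> u = 1" by (rule S2_inner_self[OF u(1)])
    have "(norm (north_pole - u))\<^sup>2 = 2 - 2 * u $ 3" "(norm (south_pole - u))\<^sup>2 = 2 + 2 * u $ 3"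
      by (simp_all add: power2_norm_eq_inner inner_diff_left inner_diff_right uu north_pole_def south_pole_def
          inner_axis inner_axis' inner_axis_axis)
    moreover have "1 - e\<^sup>2 / 2 < \<bar>u $ 3\<bar>" using u(2) by (simp add: b_def)
    ultimately have "(norm (north_pole - u))\<^sup>2 < e\<^sup>2 \<or> (norm (south_pole - u))\<^sup>2 < e\<^sup>2"
      by (cases "0 \<le> u $ 3") auto
    then have "norm (north_pole - u) < e \<or> norm (south_pole - u) < e"
      using e0 by (auto dest: power_less_imp_less_base)
    then have "u \<in> ball north_pole e1 \<or> u \<in> ball south_pole e2"
      by (auto simp: e_def dist_norm)
    then show ?thesis using e u(1) W(2) by blast
  qed
  then show thesis using that[of b] e0 by (simp add: b_def)
qed

lemma normalized_solution_components:
  assumes y: "(y has_vector_derivative normalized_field g (y t)) (at t within S)"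
  defines "x \<equiv> \<lambda>t. fst (fst (y t))" and "v \<equiv> \<lambda>t. snd (fst (y t))" and "\<mu> \<equiv> \<lambda>t. snd (y t)"
  shows "(x has_vector_derivative v t) (at t within S)"
    and "(v has_vector_derivative
      - (\<mu> t / 2 * g (x t $ 3)) *\<^sub>R (axis 3 1 - x t $ 3 *\<^sub>R x t) - (v t \<bullet> v t) *\<^sub>R x t) (at t within S)"
    and "(\<mu> has_real_derivative 0) (at t within S)"
proof -
  have eq: "normalized_field g (y t) = ((v t,
      - (\<mu> t / 2 * g (x t $ 3)) *\<^sub>R (axis 3 1 - x t $ 3 *\<^sub>R x t) - (v t \<bullet> v t) *\<^sub>R x t), 0)"
    by (simp add: normalized_field_def case_prod_beta x_def v_def \<mu>_def)
  have y1: "((\<lambda>t. fst (y t)) has_vector_derivative fst (normalized_field g (y t))) (at t within S)"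
    by (rule bounded_linear.has_vector_derivative[OF bounded_linear_fst y])
  show "(x has_vector_derivative v t) (at t within S)"
    using bounded_linear.has_vector_derivative[OF bounded_linear_fst y1] by (simp add: x_def[symmetric] eq)
  show "(v has_vector_derivative
      - (\<mu> t / 2 * g (x t $ 3)) *\<^sub>R (axis 3 1 - x t $ 3 *\<^sub>R x t) - (v t \<bullet> v t) *\<^sub>R x t) (at t within S)"
    using bounded_linear.has_vector_derivative[OF bounded_linear_snd y1] by (simp add: v_def[symmetric] eq)
  show "(\<mu> has_real_derivative 0) (at t within S)"
    using bounded_linear.has_vector_derivative[OF bounded_linear_snd y]
    by (simp add: \<mu>_def[symmetric] eq has_real_derivative_iff_has_vector_derivative)
qed

lemma zero_derivative_on_positive_reals:
  fixes f :: "real \<Rightarrow> real"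
  assumes "\<And>t. 0 < t \<Longrightarrow> (f has_real_derivative 0) (at t)" and "0 < t"
  shows "f t = f 1"
proof -
  have "\<exists>c. \<forall>s\<in>{0<..}. f s = c"
    using assms(1) by (intro has_field_derivative_zero_constant) (auto intro: has_field_derivative_at_within)
  then show ?thesis using assms(2) by auto
qed

text \<open>Stated on a half-line, because a limit of trajectories is only controlled there. The
  time must be positive, the control conditions using open time intervals.\<close>

lemma normalized_solution_meets:
  assumes y: "\<And>t. 0 \<le> t \<Longrightarrow> (y has_vector_derivative normalized_field g (y t)) (at t within {0..})"
    and K: "\<And>t. 0 \<le> t \<Longrightarrow> y t \<in> energy_surface F M"
    and F: "\<And>z. z \<in> {-1..1} \<Longrightarrow> 0 \<le> F z"
    and g: "continuous_on UNIV g" "\<And>z. z \<in> {-1<..<1} \<Longrightarrow> 0 < g z"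
    and op: "openin (top_of_set S2) \<omega>" and conn: "connected \<omega>" and poles: "{south_pole, north_pole} \<subseteq> \<omega>"
  shows "\<exists>t>0. fst (fst (y t)) \<in> \<omega>"
proof (rule ccontr)
  define x v \<mu> where "x = (\<lambda>t. fst (fst (y t)))" and "v = (\<lambda>t. snd (fst (y t)))" and "\<mu> = (\<lambda>t. snd (y t))"
  assume "\<not> (\<exists>t>0. fst (fst (y t)) \<in> \<omega>)"
  then have avoid: "x t \<notin> \<omega>" if "0 < t" for t using that by (auto simp: x_def)
  have y': "(y has_vector_derivative normalized_field g (y t)) (at t)" if "0 < t" for t
    using y[of t] that at_within_interior[of t "{0..}"] by simp
  have x': "(x has_vector_derivative v t) (at t)"
    and v\<mu>: "(v has_vector_derivative
      - (\<mu> t / 2 * g (x t $ 3)) *\<^sub>R (axis 3 1 - x t $ 3 *\<^sub>R x t) - (v t \<bullet> v t) *\<^sub>R x t) (at t)"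
    and \<mu>': "(\<mu> has_real_derivative 0) (at t)" if "0 < t" for t
    using normalized_solution_components[OF y'[OF that]] by (simp_all only: x_def v_def \<mu>_def)
  have \<mu>: "\<mu> t = \<mu> 1" if "0 < t" for t
    by (rule zero_derivative_on_positive_reals[OF \<mu>' that])
  have surf: "x t \<in> S2" "v t \<bullet> x t = 0" "v t \<bullet> v t + \<mu> t * F (x t $ 3) = 1" "0 \<le> \<mu> t" if "0 < t" for t
    using K[of t] that by (auto simp: energy_surface_def x_def v_def \<mu>_def)
  have F0: "0 \<le> F (x t $ 3)" if "0 < t" for t
    using S2_component_le[OF surf(1)[OF that]] by (intro F) (auto simp: abs_le_iff)
  have speed: "v t \<bullet> v t \<le> 1" if "0 < t" for t
    using surf(3,4)[OF that] F0[OF that] mult_nonneg_nonneg[of "\<mu> t" "F (x t $ 3)"] by linarith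
  have speed0: "v t \<bullet> v t = 1" if "\<mu> 1 = 0" "0 < t" for t
    using surf(3)[OF that(2)] \<mu>[OF that(2)] that(1) by simp
  obtain b where b: "0 \<le> b" "b < 1" "\<And>u. u \<in> S2 \<Longrightarrow> b < \<bar>u $ 3\<bar> \<Longrightarrow> u \<in> \<omega>"
    by (rule polar_caps_subset[OF op poles]) blast
  have band: "\<bar>x t $ 3\<bar> \<le> b" if "0 < t" for t
    using b(3)[OF surf(1)[OF that]] avoid[OF that] by force
  have v': "(v has_vector_derivative
      - (\<mu> 1 / 2 * g (x t $ 3)) *\<^sub>R (axis 3 1 - x t $ 3 *\<^sub>R x t) - (v t \<bullet> v t) *\<^sub>R x t) (at t)" if "0 < t" for t
    using v\<mu>[OF that] unfolding \<mu>[OF that] .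
  \<comment> \<open>Angular momentum about the polar axis. The acceleration is a combination of
    \<open>axis 3 1\<close> and \<open>x t\<close>, so its first two components are a common
    multiple of those of \<open>x t\<close>, and \<open>J\<close> is conserved.\<close>
  define J where "J t = x t $ 1 * v t $ 2 - x t $ 2 * v t $ 1" for t
  have "(J has_real_derivative 0) (at t)" if t: "0 < t" for t
  proof -
    define s where "s = \<mu> 1 / 2 * g (x t $ 3) * x t $ 3 - v t \<bullet> v t"
    have x_i: "((\<lambda>t. x t $ i) has_real_derivative v t $ i) (at t)" for i
      using bounded_linear.has_vector_derivative[OF bounded_linear_vec_nth x'[OF t]]
      by (simp add: has_real_derivative_iff_has_vector_derivative)
    have v_i: "((\<lambda>t. v t $ i) has_real_derivative s * x t $ i) (at t)" if "i \<noteq> 3" for i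
      using bounded_linear.has_vector_derivative[OF bounded_linear_vec_nth[of i] v'[OF t]] that
      by (simp add: has_real_derivative_iff_has_vector_derivative s_def axis_def algebra_simps)
    have "(J has_real_derivative (v t $ 1 * v t $ 2 + s * x t $ 2 * x t $ 1) - (v t $ 2 * v t $ 1 + s * x t $ 1 * x t $ 2)) (at t)"
      unfolding J_def[abs_def] by (intro DERIV_diff DERIV_mult x_i v_i) auto
    then show ?thesis by (simp add: algebra_simps)
  qed
  then have J: "J t = J 1" if "0 < t" for t
    using zero_derivative_on_positive_reals[of J] that by blast
  show False
  proof (cases "J 1 = 0")
    case True
    show False
    proof (rule meridian_solution_leaves_band[where x = x and v = v and \<mu> = "\<mu> 1" and g = g and b = b])
      show "x t $ 1 * v t $ 2 - x t $ 2 * v t $ 1 = 0" if "0 < t" for t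
        using J[OF that] True by (simp add: J_def)
    qed (use x' v' surf S2_inner_self speed speed0 g b(1,2) band in auto)
  next
    case False
    obtain t where "0 < t" "x t \<in> \<omega>"
    proof (rule winding_curve_meets_open_set[where x = x and v = v and j = "J 1" and b = b and \<omega> = \<omega>])
      show "x t $ 1 * v t $ 2 - x t $ 2 * v t $ 1 = J 1" if "0 < t" for t
        using J[OF that] by (simp add: J_def)
    qed (use x' surf S2_inner_self b(1,2) band op conn poles False in auto)
    then show False using avoid by blast
  qed
qed

text \<open>\<open>F\<close> is known to be continuous on \<open>{-1..1}\<close> only, so the closed
  condition \<open>x \<bullet> x = 1\<close> comes first; on it the height lies in that
  interval.\<close>

lemma closed_energy_surface:
  assumes F: "continuous_on {-1..1} F"
  shows "closed (energy_surface F M)"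
proof -
  define C where "C = {p :: normalized_state. fst (fst p) \<bullet> fst (fst p) = 1}"
  have C: "closed C" unfolding C_def by (intro closed_Collect_eq continuous_intros)
  have "continuous_on C (\<lambda>p. fst (fst p) $ 3)" by (intro continuous_intros)
  moreover have "fst (fst p) $ 3 \<in> {-1..1}" if "p \<in> C" for p
    using S2_component_le[of "fst (fst p)"] that by (simp add: C_def norm_eq_1 abs_le_iff)
  ultimately have "continuous_on C (\<lambda>p. F (fst (fst p) $ 3))"
    by (intro continuous_on_compose2[OF F]) auto
  then have "closed (C \<inter> (\<lambda>p. (snd (fst p) \<bullet> fst (fst p), snd (fst p) \<bullet> snd (fst p) + snd p * F (fst (fst p) $ 3), snd p))
      -` ({0} \<times> {1} \<times> {0..M}))"
    by (intro continuous_closed_preimage closed_Times continuous_intros C) auto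
  moreover have "C \<inter> (\<lambda>p. (snd (fst p) \<bullet> fst (fst p), snd (fst p) \<bullet> snd (fst p) + snd p * F (fst (fst p) $ 3), snd p))
      -` ({0} \<times> {1} \<times> {0..M}) = energy_surface F M"
    by (auto simp: energy_surface_def C_def norm_eq_1)
  ultimately show ?thesis by simp
qed

lemma uniform_meeting_time:
  assumes F: "\<And>z. z \<in> {-1..1} \<Longrightarrow> (F has_real_derivative g z) (at z)" "\<And>z. z \<in> {-1..1} \<Longrightarrow> 0 \<le> F z"
    and g: "continuous_on UNIV g" "\<And>z. z \<in> {-1<..<1} \<Longrightarrow> 0 < g z"
    and op: "openin (top_of_set S2) \<omega>" and conn: "connected \<omega>" and poles: "{south_pole, north_pole} \<subseteq> \<omega>"
  obtains T where "0 < T"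
    "\<And>y. (\<And>t. (y has_vector_derivative normalized_field g (y t)) (at t)) \<Longrightarrow>
      (\<And>t. y t \<in> energy_surface F M) \<Longrightarrow> \<exists>t\<in>{0<..<T}. fst (fst (y t)) \<in> \<omega>"
proof (rule ccontr)
  assume "\<not> thesis"
  then have "\<exists>y. (\<forall>t. (y has_vector_derivative normalized_field g (y t)) (at t)) \<and>
      (\<forall>t. y t \<in> energy_surface F M) \<and> (\<forall>t\<in>{0<..<T}. fst (fst (y t)) \<notin> \<omega>)" if "0 < T" for T
    using that \<open>\<And>T. \<lbrakk>0 < T; \<And>y. \<lbrakk>\<And>t. (y has_vector_derivative normalized_field g (y t)) (at t); \<And>t. y t \<in> energy_surface F M\<rbrakk> \<Longrightarrow> \<exists>t\<in>{0<..<T}. fst (fst (y t)) \<in> \<omega>\<rbrakk> \<Longrightarrow> thesis\<close> by blast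
  then have "\<forall>n. \<exists>y. (\<forall>t. (y has_vector_derivative normalized_field g (y t)) (at t)) \<and>
      (\<forall>t. y t \<in> energy_surface F M) \<and> (\<forall>t\<in>{0<..<real (Suc n)}. fst (fst (y t)) \<notin> \<omega>)"
    by simp
  then obtain Y where Y: "\<And>n t. (Y n has_vector_derivative normalized_field g (Y n t)) (at t)"
    "\<And>n t. Y n t \<in> energy_surface F M" "\<And>n t. t \<in> {0<..<real (Suc n)} \<Longrightarrow> fst (fst (Y n t)) \<notin> \<omega>"
    by metis
  \<comment> \<open>The compactness result needs a bounded field. Solutions on the energy surface do
    not see the cutoff, and the limit stays on that closed set.\<close>
  define r where "r = 2 + M"
  define G where "G p = cutoff r p *\<^sub>R normalized_field g p" for p
  have G_eq: "G p = normalized_field g p" if "p \<in> energy_surface F M" for p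
    using norm_energy_surface_le[OF that F(2)] by (simp add: G_def cutoff_eq_1 r_def)
  have G_cont: "continuous_on UNIV G"
    unfolding G_def by (intro continuous_on_scaleR continuous_on_cutoff continuous_normalized_field g)
  obtain B where B: "\<And>p. norm (G p) \<le> B"
    unfolding G_def using cutoff_scaleR_bounded[OF continuous_normalized_field[OF g(1)], of r] by blast
  have Y_G: "(Y n has_vector_derivative G (Y n t)) (at t within {0..})" for n t
    using Y(1)[of n t] G_eq[OF Y(2)] by (simp add: has_vector_derivative_at_within)
  have "norm (Y n 0) \<le> r" for n using norm_energy_surface_le[OF Y(2) F(2)] by (simp add: r_def)
  then obtain k y where k: "strict_mono (k :: nat \<Rightarrow> nat)" and lim: "\<And>t. 0 \<le> t \<Longrightarrow> (\<lambda>n. Y (k n) t) \<longlonglongrightarrow> y t"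
    and y: "\<And>t. 0 \<le> t \<Longrightarrow> (y has_vector_derivative G (y t)) (at t within {0..})"
    by (rule solutions_convergent_subsequence[where y = Y, OF G_cont B Y_G]) blast+
  have "continuous_on {-1..1} F"
    by (intro continuous_at_imp_continuous_on ballI DERIV_isCont[OF F(1)])
  then have K: "y t \<in> energy_surface F M" if "0 \<le> t" for t
    using closed_sequentially[OF closed_energy_surface _ lim[OF that]] Y(2) by blast
  have y': "(y has_vector_derivative normalized_field g (y t)) (at t within {0..})" if "0 \<le> t" for t
    using y[OF that] G_eq[OF K[OF that]] by simp
  obtain t where t: "0 < t" "fst (fst (y t)) \<in> \<omega>"
    using normalized_solution_meets[OF y' K F(2) g op conn poles] by auto
  obtain W where W: "open W" "\<omega> = S2 \<inter> W" using op by (auto simp: openin_open)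
  have "(\<lambda>n. fst (fst (Y (k n) t))) \<longlonglongrightarrow> fst (fst (y t))"
    using t(1) by (intro tendsto_fst lim) simp
  \<comment> \<open>Openness transfers the hit at the fixed time \<open>t\<close> to late members of
    the subsequence, whose avoidance intervals contain \<open>t\<close> by then.\<close>
  then have "\<forall>\<^sub>F n in sequentially. fst (fst (Y (k n) t)) \<in> W"
    using topological_tendstoD W t(2) by blast
  moreover have "\<forall>\<^sub>F n in sequentially. t < real (Suc (k n))"
  proof -
    obtain N :: nat where "t < N" using reals_Archimedean2 by blast
    then have "t < real (Suc (k n))" if "N \<le> n" for n
      using seq_suble[OF k, of n] that by linarith
    then show ?thesis by (auto simp: eventually_sequentially)
  qed
  ultimately have "\<forall>\<^sub>F n in sequentially. False"
  proof eventually_elim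
    case (elim n)
    have "fst (fst (Y (k n) t)) \<in> S2" using Y(2)[of "k n" t] by (auto simp: energy_surface_def)
    then show False using Y(3)[of t "k n"] elim t(1) W(2) by auto
  qed
  then show False by simp
qed

section \<open>Both Hamiltonian flows as normalized trajectories\<close>

text \<open>The flow is a chosen integral curve. A rescaled normalized solution shows that one
  exists; then the chosen curve, whichever it is, is shown to conserve \<open>k\<close> and to be a
  rescaled normalized solution itself, so uniqueness is never invoked.\<close>

lemma hamiltonian_flow_normalized:
  fixes k :: "phase_point \<Rightarrow> real"
  assumes k: "\<And>x \<xi>. x \<in> S2 \<Longrightarrow> \<xi> \<bullet> x = 0 \<Longrightarrow> k (x, \<xi>) = sqrt (\<xi> \<bullet> \<xi> + F (x$3))"
    and F: "\<And>z. z \<in> {-1..1} \<Longrightarrow> (F has_real_derivative g z) (at z)" "\<And>z. z \<in> {-1..1} \<Longrightarrow> 0 \<le> F z"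
    and g: "continuous_on UNIV g"
    and D: "D = {p \<in> cotangent S2. 0 < k p}" and \<rho>: "\<rho> \<in> D" and M: "1 / (k \<rho>)\<^sup>2 \<le> M"
  shows "\<exists>y. (\<forall>t. (y has_vector_derivative normalized_field g (y t)) (at t)) \<and>
    (\<forall>t. y t \<in> energy_surface F M) \<and> (\<forall>t. fst (hamiltonian_flow D k t \<rho>) = fst (fst (y t)))"
proof -
  define c where "c = k \<rho>"
  have c: "0 < c" using \<rho> by (simp add: D c_def)
  define \<mu> where "\<mu> = 1 / c\<^sup>2"
  have on_surface: "((x, \<xi> /\<^sub>R c), \<mu>) \<in> energy_surface F M" if "x \<in> S2" "\<xi> \<bullet> x = 0" "k (x, \<xi>) = c" for x \<xi>
  proof -
    have "0 \<le> F (x$3)" using S2_component_le[OF that(1)] by (intro F) (auto simp: abs_le_iff)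
    then have "\<xi> \<bullet> \<xi> + F (x$3) = c\<^sup>2" using k[OF that(1,2)] that(3) by (metis add_nonneg_nonneg inner_ge_zero real_sqrt_pow2)
    then have "(\<xi> /\<^sub>R c) \<bullet> (\<xi> /\<^sub>R c) + \<mu> * F (x$3) = 1"
      using c by (simp add: \<mu>_def power2_eq_square field_simps)
    then show ?thesis using that M by (simp add: energy_surface_def \<mu>_def c_def[symmetric])
  qed
  have surface_k: "k (x, c *\<^sub>R v) = c" if "((x, v), \<mu>) \<in> energy_surface F M" for x v
  proof -
    have s: "x \<in> S2" "v \<bullet> x = 0" "v \<bullet> v + \<mu> * F (x$3) = 1" using that by (auto simp: energy_surface_def)
    have "(c *\<^sub>R v) \<bullet> (c *\<^sub>R v) + F (x$3) = c\<^sup>2 * (v \<bullet> v + \<mu> * F (x$3))"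
      using c by (simp add: \<mu>_def power2_eq_square field_simps)
    then show ?thesis using k[of x "c *\<^sub>R v"] s c by simp
  qed
  have D_sub: "D \<subseteq> cotangent S2" and pos: "\<And>p. p \<in> D \<Longrightarrow> 0 < k p" by (auto simp: D)
  note iff = integral_curve_iff_ambient_field[OF D_sub k F(1) pos]
  obtain x0 \<xi>0 where \<rho>_eq: "\<rho> = (x0, \<xi>0)" by (metis surj_pair)
  have \<rho>0: "x0 \<in> S2" "\<xi>0 \<bullet> x0 = 0" using \<rho> by (auto simp: D cotangent_def \<rho>_eq)
  have "((x0, \<xi>0 /\<^sub>R c), \<mu>) \<in> energy_surface F M" by (intro on_surface \<rho>0) (simp add: c_def \<rho>_eq)
  from normalized_solution_exists[OF g F this]
  obtain y where y: "y 0 = ((x0, \<xi>0 /\<^sub>R c), \<mu>)" "\<And>t. (y has_vector_derivative normalized_field g (y t)) (at t)"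
    "\<And>t. y t \<in> energy_surface F M" by blast
  have y_comp: "y t = ((fst (fst (y t)), snd (fst (y t))), \<mu>)" for t
  proof -
    have "snd (y t) = snd (y 0)"
      by (rule DERIV_isconst_all[of "\<lambda>t. snd (y t)"]) (use normalized_solution_components(3)[OF y(2)] in blast)
    then show ?thesis using y(1) by (simp add: prod_eq_iff)
  qed
  \<comment> \<open>Undoing the normalization yields a witness for the choice operator; its energy
    is constant because the solution stays on the energy surface with fixed \<mu>.\<close>
  define \<gamma>0 where "\<gamma>0 t = (fst (fst (y t)), c *\<^sub>R snd (fst (y t)))" for t
  have k\<gamma>0: "k (\<gamma>0 t) = c" for t
    unfolding \<gamma>0_def using y(3)[of t] y_comp[of t] by (intro surface_k) simp
  have "integral_curve D k \<gamma>0 \<and> \<gamma>0 0 = \<rho>"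
  proof (intro conjI iff[THEN iffD2] allI)
    show "\<gamma>0 t \<in> D" for t
      using y(3)[of t] k\<gamma>0[of t] c by (auto simp: D cotangent_def \<gamma>0_def energy_surface_def)
    show "\<gamma>0 0 = \<rho>" using c by (simp add: \<gamma>0_def y(1) \<rho>_eq)
    show "(\<gamma>0 has_vector_derivative ambient_field g (k (\<gamma>0 t)) (\<gamma>0 t)) (at t)" for t
    proof -
      define x v where "x = fst (fst (y t))" and "v = snd (fst (y t))"
      have \<mu>: "snd (y t) = \<mu>" using arg_cong[OF y_comp[of t], of snd] by simp
      note comp = normalized_solution_components[OF y(2)[of t], unfolded \<mu>, folded x_def v_def]
      have "(\<gamma>0 has_vector_derivative (v, c *\<^sub>R (- (\<mu> / 2 * g (x $ 3)) *\<^sub>R (axis 3 1 - x $ 3 *\<^sub>R x) - (v \<bullet> v) *\<^sub>R x))) (at t)"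
        unfolding \<gamma>0_def[abs_def]
        by (intro has_vector_derivative_Pair comp(1) bounded_linear.has_vector_derivative[OF bounded_linear_scaleR_right comp(2)])
      moreover have "ambient_field g c (\<gamma>0 t) = (v, c *\<^sub>R (- (\<mu> / 2 * g (x $ 3)) *\<^sub>R (axis 3 1 - x $ 3 *\<^sub>R x) - (v \<bullet> v) *\<^sub>R x))"
        using c by (simp add: ambient_field_def \<gamma>0_def x_def[symmetric] v_def[symmetric] \<mu>_def scaleR_diff_right power2_eq_square mult.commute)
      ultimately show ?thesis by (simp add: k\<gamma>0)
    qed
  qed
  then have some: "integral_curve D k (SOME \<gamma>. integral_curve D k \<gamma> \<and> \<gamma> 0 = \<rho>) \<and>
      (SOME \<gamma>. integral_curve D k \<gamma> \<and> \<gamma> 0 = \<rho>) 0 = \<rho>"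
    by (rule someI[of "\<lambda>\<gamma>. integral_curve D k \<gamma> \<and> \<gamma> 0 = \<rho>"])
  define \<gamma> where "\<gamma> = (SOME \<gamma>. integral_curve D k \<gamma> \<and> \<gamma> 0 = \<rho>)"
  have \<gamma>D: "\<gamma> t \<in> D" and \<gamma>': "(\<gamma> has_vector_derivative ambient_field g (k (\<gamma> t)) (\<gamma> t)) (at t)" for t
    using some iff unfolding \<gamma>_def[symmetric] by blast+
  have \<gamma>0: "\<gamma> 0 = \<rho>" using some unfolding \<gamma>_def[symmetric] by blast
  define x \<xi> where "x = (\<lambda>t. fst (\<gamma> t))" and "\<xi> = (\<lambda>t. snd (\<gamma> t))"
  have \<gamma>_eq: "\<gamma> t = (x t, \<xi> t)" for t by (simp add: x_def \<xi>_def)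
  have xS: "x t \<in> S2" and \<xi>x: "\<xi> t \<bullet> x t = 0" for t
    using \<gamma>D[of t] by (auto simp: D cotangent_def \<gamma>_eq)
  define X where "X t = - (g (x t $ 3) / (2 * k (\<gamma> t))) *\<^sub>R (axis 3 1 - x t $ 3 *\<^sub>R x t) - ((\<xi> t \<bullet> \<xi> t) / k (\<gamma> t)) *\<^sub>R x t" for t
  have amb: "ambient_field g (k (\<gamma> t)) (\<gamma> t) = (\<xi> t /\<^sub>R k (\<gamma> t), X t)" for t
    by (simp add: ambient_field_def X_def case_prod_beta x_def \<xi>_def)
  have x': "(x has_vector_derivative \<xi> t /\<^sub>R k (\<gamma> t)) (at t)" for t
    using bounded_linear.has_vector_derivative[OF bounded_linear_fst \<gamma>'[of t]] by (simp add: amb x_def[symmetric])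
  have \<xi>': "(\<xi> has_vector_derivative X t) (at t)" for t
    using bounded_linear.has_vector_derivative[OF bounded_linear_snd \<gamma>'[of t]] by (simp add: amb \<xi>_def[symmetric])
  \<comment> \<open>The ambient equation still contains the unknown positive factor
    \<open>k (\<gamma> t)\<close>; it scales both contributions alike, so energy conservation
    follows before the factor is known to be constant.\<close>
  have energy: "\<xi> t \<bullet> \<xi> t + F (x t $ 3) = \<xi> 0 \<bullet> \<xi> 0 + F (x 0 $ 3)" for t
  proof (rule DERIV_isconst_all[of "\<lambda>t. \<xi> t \<bullet> \<xi> t + F (x t $ 3)"], rule allI)
    fix t
    have x3': "((\<lambda>t. x t $ 3) has_real_derivative \<xi> t $ 3 / k (\<gamma> t)) (at t)"
      using bounded_linear.has_vector_derivative[OF bounded_linear_vec_nth[of 3] x'[of t]]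
      by (simp add: has_real_derivative_iff_has_vector_derivative divide_inverse mult.commute)
    have "(F has_real_derivative g (x t $ 3)) (at (x t $ 3))"
      using S2_component_le[OF xS[of t]] by (intro F) (auto simp: abs_le_iff)
    from DERIV_chain2[OF this x3']
    have "((\<lambda>t. \<xi> t \<bullet> \<xi> t + F (x t $ 3)) has_real_derivative
        (\<xi> t \<bullet> X t + X t \<bullet> \<xi> t) + g (x t $ 3) * (\<xi> t $ 3 / k (\<gamma> t))) (at t)"
      by (intro DERIV_add has_real_derivative_inner \<xi>')
    moreover have "\<xi> t \<bullet> X t = - (g (x t $ 3) / (2 * k (\<gamma> t))) * \<xi> t $ 3"
      by (simp add: X_def inner_diff_right inner_axis \<xi>x)
    ultimately show "((\<lambda>t. \<xi> t \<bullet> \<xi> t + F (x t $ 3)) has_real_derivative 0) (at t)"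
      by (simp add: inner_commute[of "X t"])
  qed
  have k\<gamma>: "k (\<gamma> t) = c" for t
  proof -
    have "k (\<gamma> t) = k (\<gamma> 0)" using k[OF xS[of t] \<xi>x[of t]] k[OF xS[of 0] \<xi>x[of 0]] energy[of t] by (simp add: \<gamma>_eq)
    then show ?thesis by (simp add: \<gamma>0 c_def)
  qed
  define z where "z t = ((x t, \<xi> t /\<^sub>R c), \<mu>)" for t
  show ?thesis
  proof (intro exI[of _ z] conjI allI)
    show "z t \<in> energy_surface F M" for t
      unfolding z_def by (intro on_surface xS \<xi>x) (simp add: k\<gamma> flip: \<gamma>_eq)
    show "fst (hamiltonian_flow D k t \<rho>) = fst (fst (z t))" for t
      by (simp add: hamiltonian_flow_def z_def x_def \<gamma>_def)
    show "(z has_vector_derivative normalized_field g (z t)) (at t)" for t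
    proof -
      have "(z has_vector_derivative ((\<xi> t /\<^sub>R c, X t /\<^sub>R c), 0)) (at t)"
        unfolding z_def[abs_def] using x'[of t]
        by (intro has_vector_derivative_Pair bounded_linear.has_vector_derivative[OF bounded_linear_scaleR_right \<xi>']) (simp_all add: k\<gamma>)
      moreover have "normalized_field g (z t) = ((\<xi> t /\<^sub>R c, X t /\<^sub>R c), 0)"
        using c by (simp add: normalized_field_def z_def X_def k\<gamma> \<mu>_def scaleR_diff_right power2_eq_square field_simps)
      ultimately show ?thesis by simp
    qed
  qed
qed

theorem proposition1p8:
  fixes \<V> :: "real \<Rightarrow> real" and V :: "real^3 \<Rightarrow> real"
  assumes V_smooth_interval: "smooth_on {0..pi\<^sup>2} \<V>"
    and V_range: "\<V> ` {0..pi\<^sup>2} \<subseteq> {0<..1}"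
    and V_increasing: "strict_mono_on {0..pi\<^sup>2} \<V>"
    and V_no_critical: "\<And>s. s \<in> {0<..<pi\<^sup>2} \<Longrightarrow> deriv \<V> s \<noteq> 0"
    and V_eq: "\<And>x. x \<in> S2 \<Longrightarrow> V x = \<V> ((dist_S2 x south_pole)\<^sup>2)"
    and V_smooth: "smooth_on_S2 V"
    and V_norm: "(SUP x\<in>S2. \<bar>V x\<bar>) = 1"
  shows "\<forall>\<omega>. openin (top_of_set S2) \<omega> \<and> connected \<omega> \<and> {south_pole, north_pole} \<subseteq> \<omega> \<longrightarrow>
           (\<exists>T>0. GCC_V_plus V \<omega> T)"
proof (intro allI impI, elim conjE)
  fix \<omega> assume \<omega>: "openin (top_of_set S2) \<omega>" "connected \<omega>" "{south_pole, north_pole} \<subseteq> \<omega>"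
  obtain F g :: "real \<Rightarrow> real" where g: "continuous_on UNIV g" and F: "\<And>z. z \<in> {-1..1} \<Longrightarrow> (F has_real_derivative g z) (at z)"
    and VF: "\<And>x. x \<in> S2 \<Longrightarrow> V x = F (x$3)" and g_pos: "\<And>z. z \<in> {-1<..<1} \<Longrightarrow> 0 < g z"
    and F_pos: "\<And>z. z \<in> {-1..1} \<Longrightarrow> 0 < F z"
    by (rule potential_profile[OF V_smooth_interval V_range V_increasing V_no_critical V_eq V_smooth]) blast+
  have "continuous_on {-1..1} F"
    by (intro continuous_at_imp_continuous_on ballI DERIV_isCont[OF F])
  then obtain z0 where z0: "z0 \<in> {-1..1}" "\<And>z. z \<in> {-1..1} \<Longrightarrow> F z0 \<le> F z"
    using continuous_attains_inf[of "{-1..1}" F] by auto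
  \<comment> \<open>The minimum of the potential: \<open>c\<^sup>2 \<ge> m\<close> for every
    covector, the zero covector included, which bounds \<mu> by \<open>1 / m\<close>.\<close>
  define m where "m = F z0"
  have m: "0 < m" using F_pos[OF z0(1)] by (simp add: m_def)
  have F_S2: "m \<le> F (x$3)" if "x \<in> S2" for x
    using z0(2)[of "x$3"] S2_component_le[OF that] by (auto simp: m_def abs_le_iff)
  have F_nonneg: "0 \<le> F z" if "z \<in> {-1..1}" for z using F_pos[OF that] by simp
  obtain T where T: "0 < T"
    "\<And>y. (\<And>t. (y has_vector_derivative normalized_field g (y t)) (at t)) \<Longrightarrow>
      (\<And>t. y t \<in> energy_surface F (1 / m)) \<Longrightarrow> \<exists>t\<in>{0<..<T}. fst (fst (y t)) \<in> \<omega>"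
    by (rule uniform_meeting_time[OF F F_nonneg g g_pos \<omega>, where M = "1 / m"]) blast+
  have "GCC_V V \<omega> T"
    unfolding GCC_V_def
  proof
    fix \<rho> assume \<rho>: "\<rho> \<in> cotangent S2"
    have k: "ham_q V (x, \<xi>) = sqrt (\<xi> \<bullet> \<xi> + F (x$3))" if "x \<in> S2" "\<xi> \<bullet> x = 0" for x \<xi>
      using VF[OF that(1)] by (simp add: ham_q_def power2_norm_eq_inner)
    have k_sq: "m \<le> (ham_q V p)\<^sup>2" "0 < ham_q V p" if "p \<in> cotangent S2" for p
    proof -
      obtain x \<xi> where "p = (x, \<xi>)" by (metis surj_pair)
      then have p: "p = (x, \<xi>)" "x \<in> S2" "\<xi> \<bullet> x = 0" using that by (auto simp: cotangent_def)
      have le: "m \<le> \<xi> \<bullet> \<xi> + F (x$3)" using F_S2[OF p(2)] by (simp add: add_increasing)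
      then show "m \<le> (ham_q V p)\<^sup>2" "0 < ham_q V p" using m by (simp_all add: p(1) k[OF p(2,3)])
    qed
    have D: "cotangent S2 = {p \<in> cotangent S2. 0 < ham_q V p}" using k_sq(2) by blast
    have "1 / (ham_q V \<rho>)\<^sup>2 \<le> 1 / m" using k_sq(1)[OF \<rho>] m by (intro divide_left_mono mult_pos_pos) auto
    then have "\<exists>y. (\<forall>t. (y has_vector_derivative normalized_field g (y t)) (at t)) \<and> (\<forall>t. y t \<in> energy_surface F (1 / m)) \<and>
        (\<forall>t. fst (hamiltonian_flow (cotangent S2) (ham_q V) t \<rho>) = fst (fst (y t)))"
      by (intro hamiltonian_flow_normalized[OF k F F_nonneg g D \<rho>])
    then obtain y where "\<And>t. (y has_vector_derivative normalized_field g (y t)) (at t)"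
      "\<And>t. y t \<in> energy_surface F (1 / m)" "\<And>t. fst (hamiltonian_flow (cotangent S2) (ham_q V) t \<rho>) = fst (fst (y t))"
      by blast
    then show "\<exists>t\<in>{0<..<T}. fst (hamiltonian_flow (cotangent S2) (ham_q V) t \<rho>) \<in> \<omega>"
      using T(2)[of y] by simp
  qed
  moreover have "GCC \<omega> T"
    unfolding GCC_def
  proof
    fix \<rho> assume \<rho>: "\<rho> \<in> unit_cotangent"
    \<comment> \<open>The geodesic Hamiltonian is the case of zero potential, on the domain where it
      is positive.\<close>
    have k: "ham_norm (x, \<xi>) = sqrt (\<xi> \<bullet> \<xi> + 0)" for x \<xi>
      by (simp add: ham_norm_def norm_eq_sqrt_inner)
    have D: "cotangent_nonzero = {p \<in> cotangent S2. 0 < ham_norm p}"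
      by (auto simp: cotangent_nonzero_def ham_norm_def)
    have \<rho>D: "\<rho> \<in> cotangent_nonzero" and "ham_norm \<rho> = 1"
      using \<rho> by (auto simp: unit_cotangent_def cotangent_nonzero_def ham_norm_def)
    then have "1 / (ham_norm \<rho>)\<^sup>2 \<le> 1" by simp
    then have "\<exists>y. (\<forall>t. (y has_vector_derivative normalized_field (\<lambda>_. 0) (y t)) (at t)) \<and>
        (\<forall>t. y t \<in> energy_surface (\<lambda>_. 0) 1) \<and>
        (\<forall>t. fst (hamiltonian_flow cotangent_nonzero ham_norm t \<rho>) = fst (fst (y t)))"
      by (intro hamiltonian_flow_normalized[OF k _ _ _ D \<rho>D]) auto
    then obtain y where y: "\<And>t. (y has_vector_derivative normalized_field (\<lambda>_. 0) (y t)) (at t)"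
      "\<And>t. y t \<in> energy_surface (\<lambda>_. 0) 1" "\<And>t. fst (hamiltonian_flow cotangent_nonzero ham_norm t \<rho>) = fst (fst (y t))"
      by blast
    \<comment> \<open>A geodesic solves the zero-force system for any value of \<mu>. Resetting
      \<mu> to 0 places it in the family for \<open>F\<close> and \<open>g\<close>, so the same time
      \<open>T\<close> serves both conditions.\<close>
    define z where "z t = (fst (y t), 0 :: real)" for t
    have "(z has_vector_derivative normalized_field g (z t)) (at t)" for t
    proof -
      have "(z has_vector_derivative (fst (normalized_field (\<lambda>_. 0) (y t)), 0)) (at t)"
        unfolding z_def[abs_def]
        by (intro has_vector_derivative_Pair bounded_linear.has_vector_derivative[OF bounded_linear_fst y(1)] has_vector_derivative_const)
      then show ?thesis by (simp add: normalized_field_def z_def case_prod_beta)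
    qed
    moreover have "z t \<in> energy_surface F (1 / m)" for t
      using y(2)[of t] m by (auto simp: energy_surface_def z_def)
    ultimately have "\<exists>t\<in>{0<..<T}. fst (fst (z t)) \<in> \<omega>" by (rule T(2))
    then show "\<exists>t\<in>{0<..<T}. fst (hamiltonian_flow cotangent_nonzero ham_norm t \<rho>) \<in> \<omega>"
      by (simp add: y(3) z_def)
  qed
  ultimately show "\<exists>T>0. GCC_V_plus V \<omega> T" using T(1) by (auto simp: GCC_V_plus_def)
qed

end
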